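(* Let $n\ge 1$, let $\alpha=(\alpha_1,\dots,\alpha_n)$ be a vector of positive real numbers, $|\alpha|=\sum_{i=1}^n\alpha_i$, and let $g:(0,\infty)\to(0,\infty)$. Let $\mu$ be the multivariate Liouville distribution on $(0,\infty)^n$ with density $$\rho(x)=Z^{-1}\prod_{i=1}^n x_i^{\alpha_i-1}\,g\Big(\sum_{i=1}^n x_i\Big),\qquad x\in(0,\infty)^n,$$ where $Z$ is the normalization constant. Suppose that $g$ is log-concave (that is, $g=e^{-V_g}$ with $V_g$ convex), that $|\alpha|>1$, and furthermore that $\alpha_i>1$ for each $i\in\{1,\dots,n\}$. Then $\mu$ satisfies $$\mathrm{Var}_\mu(f)\le\int_{(0,\infty)^n}\sum_{i=1}^n\frac{1}{\alpha_i-1}\,x_i^2\left(\frac{\partial f}{\partial x_i}(x)\right)^2d\mu(x)$$ for all $f\in L^2(\mu)$ for which the right-hand side is finite.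
   Context: $\mathrm{Var}_\mu(f)=\int f^2\,d\mu-(\int f\,d\mu)^2$; the partial derivatives of $f$ are weak partial derivatives (so $f$ is understood to be weakly differentiable). The function $g$ is such that the density $\rho$ is normalizable. *)

theory Defs
  imports "HOL-Probability.Probability"
begin

definition pderiv_at :: "'n::finite \<Rightarrow> (real^'n \<Rightarrow> real) \<Rightarrow> real^'n \<Rightarrow> real" where
  "pderiv_at i \<phi> x = frechet_derivative \<phi> (at x) (axis i 1)"

primrec C_k :: "nat \<Rightarrow> (real^'n::finite \<Rightarrow> real) \<Rightarrow> bool" where
  "C_k 0 \<phi> \<longleftrightarrow> continuous_on UNIV \<phi>"
| "C_k (Suc k) \<phi> \<longleftrightarrow> (\<forall>x. \<phi> differentiable (at x)) \<and> (\<forall>i. C_k k (pderiv_at i \<phi>))"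

text \<open>The class of smooth functions with compact support in \<open>\<Omega>\<close>, each extended by zero
  to the whole space.\<close>

definition test_functions :: "(real^'n::finite) set \<Rightarrow> (real^'n \<Rightarrow> real) set" where
  "test_functions \<Omega> =
     {\<phi>. (\<forall>k. C_k k \<phi>) \<and> (\<exists>K. compact K \<and> K \<subseteq> \<Omega> \<and> (\<forall>x. x \<notin> K \<longrightarrow> \<phi> x = 0))}"

definition locally_integrable_on :: "(real^'n::finite \<Rightarrow> real) \<Rightarrow> (real^'n) set \<Rightarrow> bool" where
  "locally_integrable_on f \<Omega> \<longleftrightarrow> (\<forall>K. compact K \<and> K \<subseteq> \<Omega> \<longrightarrow> set_integrable lborel K f)"

text \<open>\<open>h\<close> is a version of the weak partial derivative of \<open>f\<close> in direction \<open>i\<close> on the open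
  set \<open>\<Omega>\<close>. Such an \<open>h\<close> is unique up to Lebesgue null sets, which is why this is a relation.\<close>

definition has_weak_pderiv_on ::
    "(real^'n::finite \<Rightarrow> real) \<Rightarrow> 'n \<Rightarrow> (real^'n \<Rightarrow> real) \<Rightarrow> (real^'n) set \<Rightarrow> bool" where
  "has_weak_pderiv_on f i h \<Omega> \<longleftrightarrow>
     locally_integrable_on f \<Omega> \<and> locally_integrable_on h \<Omega> \<and>
     (\<forall>\<phi>\<in>test_functions \<Omega>.
        (LINT x:\<Omega>|lborel. f x * pderiv_at i \<phi> x) = - (LINT x:\<Omega>|lborel. h x * \<phi> x))"

definition log_concave_on :: "real set \<Rightarrow> (real \<Rightarrow> real) \<Rightarrow> bool" where
  "log_concave_on S g \<longleftrightarrow> (\<exists>V. convex_on S V \<and> (\<forall>r\<in>S. g r = exp (- V r)))"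

definition pos_orthant :: "(real^'n::finite) set" where
  "pos_orthant = {x. \<forall>i. 0 < x $ i}"

definition liouville_weight :: "real^'n::finite \<Rightarrow> (real \<Rightarrow> real) \<Rightarrow> real^'n \<Rightarrow> real" where
  "liouville_weight \<alpha> g x = (\<Prod>i\<in>UNIV. (x $ i) powr (\<alpha> $ i - 1)) * g (\<Sum>i\<in>UNIV. x $ i)"

definition liouville_normalizable :: "real^'n::finite \<Rightarrow> (real \<Rightarrow> real) \<Rightarrow> bool" where
  "liouville_normalizable \<alpha> g \<longleftrightarrow> set_integrable lborel pos_orthant (liouville_weight \<alpha> g)"

definition liouville_Z :: "real^'n::finite \<Rightarrow> (real \<Rightarrow> real) \<Rightarrow> real" where
  "liouville_Z \<alpha> g = (LINT x:pos_orthant|lborel. liouville_weight \<alpha> g x)"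

definition liouville_density :: "real^'n::finite \<Rightarrow> (real \<Rightarrow> real) \<Rightarrow> real^'n \<Rightarrow> real" where
  "liouville_density \<alpha> g x = inverse (liouville_Z \<alpha> g) * liouville_weight \<alpha> g x"

text \<open>The underlying space of this measure is the open orthant, so the values of functions
  on \<open>real^'n\<close> outside the orthant play no role.\<close>

definition liouville :: "real^'n::finite \<Rightarrow> (real \<Rightarrow> real) \<Rightarrow> (real^'n) measure" where
  "liouville \<alpha> g =
     density (restrict_space lborel pos_orthant) (\<lambda>x. ennreal (liouville_density \<alpha> g x))"

definition L2 :: "'a measure \<Rightarrow> ('a \<Rightarrow> real) set" where
  "L2 M = {f. f \<in> borel_measurable M \<and> integrable M (\<lambda>x. (f x)\<^sup>2)}"

definition Var :: "'a measure \<Rightarrow> ('a \<Rightarrow> real) \<Rightarrow> real" where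
  "Var M f = (LINT x|M. (f x)\<^sup>2) - (LINT x|M. f x)\<^sup>2"

end

theory Submission
  imports Defs
begin

text \<open>The inequality is a Brascamp-Lieb inequality: if \<open>\<rho> = exp (- V)\<close>, then
\<open>Var f \<le> \<integral> \<langle>(Hess V)\<inverse> \<nabla>f, \<nabla>f\<rangle> \<rho>\<close>. Here \<open>V\<close> is the sum of
\<open>- (\<alpha>\<^sub>i - 1) ln x\<^sub>i\<close> over \<open>i\<close> and of a convex function of \<open>\<Sum>i. x\<^sub>i\<close>, so its Hessian dominates the
diagonal matrix with entries \<open>(\<alpha>\<^sub>i - 1) / x\<^sub>i\<^sup>2\<close>, whose inverse is the quadratic form in the claim.
As \<open>g\<close> need not be differentiable, the Hessian is replaced by a finite difference: with
\<open>m = (x + y) / 2\<close> and \<open>h = (x - y) / 2\<close>,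
\<open>\<rho> x \<rho> y \<le> (\<rho> m)\<^sup>2 exp (- (\<Sum>i. (\<alpha>\<^sub>i - 1) (h\<^sub>i / m\<^sub>i)\<^sup>2))\<close>
(\<open>liouville_weight_midpoint\<close>). The power functions give the exponential factor, and log-concavity
of \<open>g\<close> says that \<open>g\<close> does no harm.

Following Bobkov and Ledoux, this is combined with the Prekopa-Leindler inequality
(\<open>prekopa_leindler\<close>) for the three functions \<open>\<rho> exp (\<delta> f)\<close>, \<open>\<rho> exp (- \<delta> f)\<close> and
\<open>\<rho> exp (\<delta>\<^sup>2 q)\<close>. To second order in \<open>\<delta>\<close> the conclusion reads \<open>Var f \<le> 2 \<integral> q \<rho>\<close>
(\<open>variance_le_of_midpoint_bound\<close>). The pointwise hypothesis asks that \<open>\<delta>\<^sup>2 q\<close> dominate the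
supremum over \<open>h\<close> of \<open>\<delta> \<Sum>i. h\<^sub>i \<partial>\<^sub>i f - \<Sum>i. (\<alpha>\<^sub>i - 1) (h\<^sub>i / m\<^sub>i)\<^sup>2 / 2\<close>, up to an error of order
\<open>\<delta> |h|\<^sup>2\<close>. Completing squares gives \<open>q = \<Sum>i. m\<^sub>i\<^sup>2 (\<partial>\<^sub>i f)\<^sup>2 / (2 (\<alpha>\<^sub>i - 1))\<close>, which is the claim.

Multiplying all three functions by the indicator of a convex set preserves the hypothesis of
Prekopa-Leindler. Hence the argument works on each compact box inside the orthant without any
boundary condition on \<open>f\<close> (\<open>brascamp_lieb_convex\<close>), so that \<open>f\<close> need not be cut off near the
boundary of the orthant. On a box the density is bounded and bounded away from zero, so a weakly
differentiable \<open>f\<close> can be approximated by mollification in ordinary mean square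
(\<open>mollify_tendsto_L2\<close>, \<open>brascamp_lieb_box_weak\<close>). Letting the boxes exhaust the orthant gives
the theorem.\<close>

section \<open>The Prekopa-Leindler inequality\<close>

text \<open>The one-dimensional Brunn-Minkowski inequality. If \<open>a\<close> were the largest point of \<open>A\<close> and \<open>b\<close> the
smallest point of \<open>B\<close>, then the midpoints of \<open>A\<close> with \<open>b\<close> and those of \<open>a\<close> with \<open>B\<close> would lie in
\<open>C\<close> on different sides of \<open>(a + b) / 2\<close>, and they are copies of \<open>A\<close> and \<open>B\<close> scaled by one half.
The extreme points need not exist, so points within \<open>e / 2\<close> of the supremum and the infimum are
used, at the cost of a piece of \<open>A\<close> and of \<open>B\<close> of measure at most \<open>e / 2\<close>.\<close>

lemma emeasure_midpoint_real:
  fixes A B C :: "real set"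
  assumes [measurable]: "A \<in> sets borel" "B \<in> sets borel" "C \<in> sets borel"
    and ne: "A \<noteq> {}" "B \<noteq> {}" and bd: "bounded A" "bounded B"
    and mid: "\<And>x y. x \<in> A \<Longrightarrow> y \<in> B \<Longrightarrow> (x + y) / 2 \<in> C"
  shows "emeasure lborel A + emeasure lborel B \<le> 2 * emeasure lborel C"
proof (rule ennreal_le_epsilon)
  fix e :: real assume e: "0 < e"
  have half: "emeasure lborel S = 2 * emeasure lborel {z. 2 * z - t \<in> S}"
    if [measurable]: "S \<in> sets borel" for S :: "real set" and t
  proof -
    have "emeasure lborel S = (\<integral>\<^sup>+x. indicator S x \<partial>lborel)" by simp
    also have "\<dots> = 2 * (\<integral>\<^sup>+z. indicator S (- t + 2 * z) \<partial>lborel)"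
      by (subst nn_integral_real_affine[where c=2 and t="-t"]) auto
    also have "(\<integral>\<^sup>+z. indicator S (- t + 2 * z) \<partial>lborel) = (\<integral>\<^sup>+z. indicator {z. 2 * z - t \<in> S} z \<partial>lborel)"
      by (intro nn_integral_cong) (auto simp: indicator_def)
    also have "\<dots> = emeasure lborel {z. 2 * z - t \<in> S}"
      by (subst nn_integral_indicator) auto
    finally show ?thesis .
  qed
  have "\<exists>a\<in>A. Sup A - e / 2 < a"
    using ne bd e less_cSup_iff[of A "Sup A - e / 2"] bounded_imp_bdd_above by auto
  then obtain a where a: "a \<in> A" "Sup A - e / 2 < a" by blast
  have "\<exists>b\<in>B. b < Inf B + e / 2"
    using ne bd e cInf_less_iff[of B "Inf B + e / 2"] bounded_imp_bdd_below by auto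
  then obtain b where b: "b \<in> B" "b < Inf B + e / 2" by blast
  define A' B' where "A' = A \<inter> {..a}" and "B' = B \<inter> {b..}"
  have [measurable]: "A' \<in> sets borel" "B' \<in> sets borel" by (auto simp: A'_def B'_def)
  define X Y where "X = {z. 2 * z - b \<in> A'}" and "Y = {z. 2 * z - a \<in> B'}"
  have [measurable]: "X \<in> sets borel" "Y \<in> sets borel" by (auto simp: X_def Y_def)
  have XC: "X \<subseteq> C"
  proof
    fix z assume "z \<in> X"
    then show "z \<in> C" using mid[of "2 * z - b" b] b by (auto simp: X_def A'_def)
  qed
  have YC: "Y \<subseteq> C"
  proof
    fix z assume "z \<in> Y"
    then show "z \<in> C" using mid[of a "2 * z - a"] a by (auto simp: Y_def B'_def)
  qed
  have le: "emeasure lborel A \<le> emeasure lborel A' + ennreal (e / 2)"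
  proof -
    have "A \<subseteq> A' \<union> {a<..Sup A}"
      using bd cSup_upper[of _ A] bounded_imp_bdd_above by (force simp: A'_def)
    then have "emeasure lborel A \<le> emeasure lborel (A' \<union> {a<..Sup A})"
      by (intro emeasure_mono) auto
    also have "\<dots> \<le> emeasure lborel A' + emeasure lborel {a<..Sup A}"
      by (intro emeasure_subadditive) auto
    also have "emeasure lborel {a<..Sup A} \<le> ennreal (e / 2)"
      using a e bd cSup_upper[of a A] bounded_imp_bdd_above by (auto intro!: ennreal_leI)
    finally show ?thesis by (simp add: add_left_mono)
  qed
  have le2: "emeasure lborel B \<le> emeasure lborel B' + ennreal (e / 2)"
  proof -
    have "B \<subseteq> B' \<union> {Inf B..<b}"
      using bd cInf_lower[of _ B] bounded_imp_bdd_below by (force simp: B'_def)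
    then have "emeasure lborel B \<le> emeasure lborel (B' \<union> {Inf B..<b})"
      by (intro emeasure_mono) auto
    also have "\<dots> \<le> emeasure lborel B' + emeasure lborel {Inf B..<b}"
      by (intro emeasure_subadditive) auto
    also have "emeasure lborel {Inf B..<b} \<le> ennreal (e / 2)"
      using b e bd cInf_lower[of b B] bounded_imp_bdd_below by (auto intro!: ennreal_leI)
    finally show ?thesis by (simp add: add_left_mono)
  qed
  have "X \<inter> (Y - {(a + b) / 2}) = {}"
    by (auto simp: X_def Y_def A'_def B'_def)
  then have "emeasure lborel X + emeasure lborel (Y - {(a + b) / 2}) = emeasure lborel (X \<union> (Y - {(a + b) / 2}))"
    by (intro plus_emeasure) auto
  also have "\<dots> \<le> emeasure lborel C" using XC YC by (intro emeasure_mono) auto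
  also have "emeasure lborel (Y - {(a + b) / 2}) = emeasure lborel Y"
    by (intro emeasure_Diff_null_set) (auto simp: null_sets_def)
  finally have XY: "emeasure lborel X + emeasure lborel Y \<le> emeasure lborel C" .
  have "emeasure lborel A + emeasure lborel B
    \<le> (emeasure lborel A' + ennreal (e / 2)) + (emeasure lborel B' + ennreal (e / 2))"
    using le le2 by (rule add_mono)
  also have "\<dots> = 2 * (emeasure lborel X + emeasure lborel Y) + (ennreal (e / 2) + ennreal (e / 2))"
    using half[of A' b] half[of B' a] by (simp add: X_def Y_def distrib_left ac_simps)
  also have "ennreal (e / 2) + ennreal (e / 2) = ennreal e"
    using e by (simp flip: ennreal_plus)
  also have "2 * (emeasure lborel X + emeasure lborel Y) + ennreal e \<le> 2 * emeasure lborel C + ennreal e"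
    using XY by (intro add_right_mono mult_left_mono) auto
  finally show "emeasure lborel A + emeasure lborel B \<le> 2 * emeasure lborel C + ennreal e" .
qed

text \<open>The layer-cake formula, cut off at height 1: below, the suprema of the two given functions
are scaled to 1, and only levels \<open>t < 1\<close> have nonempty level sets for both.\<close>

lemma nn_integral_min_1_eq_level_sets:
  assumes "sigma_finite_measure M" and [measurable]: "\<phi> \<in> borel_measurable M"
  shows "(\<integral>\<^sup>+x. min (\<phi> x) 1 \<partial>M) =
    (\<integral>\<^sup>+t. emeasure M {x\<in>space M. ennreal t < \<phi> x} * indicator {0..<1} t \<partial>lborel)"
proof -
  interpret sigma_finite_measure M by fact
  interpret pair_sigma_finite M lborel ..
  have "min (\<phi> x) 1 = (\<integral>\<^sup>+t. indicator {t. ennreal t < \<phi> x} t * indicator {0..<1} t \<partial>(lborel :: real measure))" for x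
  proof -
    have "(\<integral>\<^sup>+t. indicator {t. ennreal t < \<phi> x} t * indicator {0..<1} t \<partial>(lborel :: real measure))
      = (\<integral>\<^sup>+t. indicator {0..<enn2real (min (\<phi> x) 1)} t \<partial>lborel)"
    proof (intro nn_integral_cong)
      fix t :: real
      show "indicator {t. ennreal t < \<phi> x} t * indicator {0..<1} t =
          (indicator {0..<enn2real (min (\<phi> x) 1)} t :: ennreal)"
      proof (cases "\<phi> x \<ge> 1")
        case True
        then have "t < 1 \<Longrightarrow> ennreal t < \<phi> x"
          by (metis ennreal_1 ennreal_lessI less_le_trans zero_less_one)
        then show ?thesis using True by (auto simp: indicator_def min_absorb2)
      next
        case False
        then obtain r where r: "0 \<le> r" "\<phi> x = ennreal r" "r < 1"
          by (metis ennreal_1 ennreal_cases ennreal_leI le_less_linear top_greatest)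
        then have "min (\<phi> x) 1 = ennreal r" using False by (auto simp: min_def)
        then show ?thesis using r by (auto simp: indicator_def ennreal_less_iff)
      qed
    qed
    also have "\<dots> = ennreal (enn2real (min (\<phi> x) 1))" by simp
    also have "\<dots> = min (\<phi> x) 1"
      by (intro ennreal_enn2real) (auto simp: min_less_iff_disj)
    finally show ?thesis by simp
  qed
  then have "(\<integral>\<^sup>+x. min (\<phi> x) 1 \<partial>M) =
    (\<integral>\<^sup>+x. \<integral>\<^sup>+t. indicator {t. ennreal t < \<phi> x} t * indicator {0..<1} t \<partial>(lborel :: real measure) \<partial>M)"
    by simp
  also have "\<dots> = (\<integral>\<^sup>+t. \<integral>\<^sup>+x. indicator {t. ennreal t < \<phi> x} t * indicator {0..<1} t \<partial>M \<partial>(lborel :: real measure))"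
    by (intro Fubini'[symmetric]) (simp add: split_beta')
  also have "\<dots> = (\<integral>\<^sup>+t. emeasure M {x\<in>space M. ennreal t < \<phi> x} * indicator {0..<1} t \<partial>lborel)"
  proof (intro nn_integral_cong)
    fix t :: real
    have "(\<integral>\<^sup>+x. indicator {t. ennreal t < \<phi> x} t * indicator {0..<1} t \<partial>M)
      = (\<integral>\<^sup>+x. indicator {x\<in>space M. ennreal t < \<phi> x} x * indicator {0..<1} t \<partial>M)"
      by (intro nn_integral_cong) (auto simp: indicator_def)
    also have "\<dots> = emeasure M {x\<in>space M. ennreal t < \<phi> x} * indicator {0..<1} t"
      by (subst nn_integral_multc) auto
    finally show "(\<integral>\<^sup>+x. indicator {t. ennreal t < \<phi> x} t * indicator {0..<1} t \<partial>M)
      = emeasure M {x\<in>space M. ennreal t < \<phi> x} * indicator {0..<1} t" .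
  qed
  finally show ?thesis .
qed

lemma ennreal_amgm: "P + Q \<le> 2 * X \<Longrightarrow> P * Q \<le> X\<^sup>2" for P Q X :: ennreal
proof (cases "X = top")
  case False
  assume le: "P + Q \<le> 2 * X"
  obtain x where x: "X = ennreal x" "0 \<le> x" using False by (cases X) auto
  have "2 * X < top" using x by (simp add: ennreal_mult_less_top less_top)
  then have "P \<noteq> top" "Q \<noteq> top" using le by (auto simp: top_unique)
  then obtain p q where pq: "P = ennreal p" "Q = ennreal q" "0 \<le> p" "0 \<le> q"
    by (metis ennreal_cases)
  have "ennreal (p + q) \<le> ennreal (2 * x)" using le x pq by (simp add: ennreal_mult)
  then have *: "p + q \<le> 2 * x" using x by (simp add: ennreal_le_iff)
  have "4 * (p * q) \<le> (p + q)\<^sup>2" using sum_squares_ge_zero[of "p - q" 0] by (simp add: power2_eq_square algebra_simps)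
  also have "\<dots> \<le> (2 * x)\<^sup>2" using * pq by (intro power_mono) auto
  finally have "p * q \<le> x\<^sup>2" by simp
  then show ?thesis using x pq by (simp add: ennreal_leI ennreal_power flip: ennreal_mult)
qed (simp add: power2_eq_square)

text \<open>After scaling both suprema to 1, the level sets of \<open>F\<close> and \<open>G\<close> at each height \<open>t < 1\<close> are nonempty
and their midpoints lie in the level set of \<open>H\<close>. Brunn-Minkowski at each level, integrated over
\<open>t\<close>, bounds the arithmetic mean of the two integrals by the integral of \<open>H\<close>. The geometric mean is
smaller still, and it is the one that scales back.\<close>

lemma prekopa_leindler_real_bounded:
  fixes F G H :: "real \<Rightarrow> ennreal"
  assumes [measurable]: "F \<in> borel_measurable borel" "G \<in> borel_measurable borel" "H \<in> borel_measurable borel"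
    and bd: "\<And>x. F x \<le> ennreal N" "\<And>x. G x \<le> ennreal N"
    and supp: "\<And>x. x \<notin> {-N..N} \<Longrightarrow> F x = 0" "\<And>x. x \<notin> {-N..N} \<Longrightarrow> G x = 0"
    and FGH: "\<And>x y. F x * G y \<le> (H ((x + y) / 2))\<^sup>2"
  shows "(\<integral>\<^sup>+x. F x \<partial>lborel) * (\<integral>\<^sup>+x. G x \<partial>lborel) \<le> (\<integral>\<^sup>+x. H x \<partial>lborel)\<^sup>2"
proof -
  have le_top: "(SUP x. F x) < top" "(SUP x. G x) < top"
    using SUP_least[of UNIV F, OF bd(1)] SUP_least[of UNIV G, OF bd(2)] by (auto intro: le_less_trans)
  show ?thesis
  proof (cases "(SUP x. F x) = 0 \<or> (SUP x. G x) = 0")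
    case True
    then have "(\<forall>x. F x = 0) \<or> (\<forall>x. G x = 0)" using SUP_upper[of _ UNIV F] SUP_upper[of _ UNIV G] by fastforce
    then show ?thesis by auto
  next
    case False
    obtain a where a: "0 < a" "(SUP x. F x) = ennreal a"
      using False le_top by (metis ennreal_cases ennreal_eq_0_iff less_irrefl linorder_not_less)
    obtain b where b: "0 < b" "(SUP x. G x) = ennreal b"
      using False le_top by (metis ennreal_cases ennreal_eq_0_iff less_irrefl linorder_not_less)
    define c where "c = sqrt (a * b)"
    have c: "0 < c" "c * c = a * b" using a b by (auto simp: c_def)
    define F' G' H' where "F' x = ennreal (1 / a) * F x" and "G' x = ennreal (1 / b) * G x"
      and "H' x = ennreal (1 / c) * H x" for x
    have [measurable]: "F' \<in> borel_measurable borel" "G' \<in> borel_measurable borel" "H' \<in> borel_measurable borel"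
      unfolding F'_def G'_def H'_def by measurable
    have inv: "ennreal r * (ennreal (1 / r) * z) = z" if "0 < r" for r z
      using that by (simp add: mult.assoc[symmetric] flip: ennreal_mult)
    have F: "F x = ennreal a * F' x" and G: "G x = ennreal b * G' x" and H: "H x = ennreal c * H' x" for x
      using a b c by (auto simp: F'_def G'_def H'_def inv)
    have F1: "F' x \<le> 1" for x
    proof -
      have "F x \<le> ennreal a" using SUP_upper[of x UNIV F] a by simp
      then have "F' x \<le> ennreal (1 / a) * ennreal a" unfolding F'_def by (intro mult_left_mono) auto
      then show ?thesis using a by (simp flip: ennreal_mult)
    qed
    have G1: "G' x \<le> 1" for x
    proof -
      have "G x \<le> ennreal b" using SUP_upper[of x UNIV G] b by simp
      then have "G' x \<le> ennreal (1 / b) * ennreal b" unfolding G'_def by (intro mult_left_mono) auto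
      then show ?thesis using b by (simp flip: ennreal_mult)
    qed
    have FGH': "F' x * G' y \<le> (H' ((x + y) / 2))\<^sup>2" for x y
    proof -
      have "F' x * G' y = ennreal (1 / (a * b)) * (F x * G y)"
        using a b by (simp add: F'_def G'_def ac_simps ennreal_mult flip: divide_divide_eq_left)
          (simp add: mult.assoc[symmetric] flip: ennreal_mult)
      also have "\<dots> \<le> ennreal (1 / (a * b)) * (H ((x + y) / 2))\<^sup>2"
        by (intro mult_left_mono FGH) auto
      also have "\<dots> = (H' ((x + y) / 2))\<^sup>2"
        using c by (simp add: H'_def power2_eq_square ac_simps flip: c(2))
          (simp add: mult.assoc[symmetric] flip: ennreal_mult)
      finally show ?thesis .
    qed
    have lev: "emeasure lborel {x. ennreal t < F' x} + emeasure lborel {x. ennreal t < G' x}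
      \<le> 2 * emeasure lborel {x. ennreal t < H' x}" if t: "0 \<le> t" "t < 1" for t
    proof (rule emeasure_midpoint_real)
      have "ennreal (t * a) < (SUP x. F x)" using t a by (simp add: ennreal_less_iff)
      then obtain x where "ennreal (t * a) < F x" by (auto simp: less_SUP_iff)
      then have "ennreal a * ennreal t < ennreal a * F' x" using t a by (simp add: F ennreal_mult mult.commute)
      then have "ennreal t < F' x" by (meson mult_left_mono not_less zero_le)
      then show "{x. ennreal t < F' x} \<noteq> {}" by auto
      have "ennreal (t * b) < (SUP x. G x)" using t b by (simp add: ennreal_less_iff)
      then obtain x where "ennreal (t * b) < G x" by (auto simp: less_SUP_iff)
      then have "ennreal b * ennreal t < ennreal b * G' x" using t b by (simp add: G ennreal_mult mult.commute)
      then have "ennreal t < G' x" by (meson mult_left_mono not_less zero_le)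
      then show "{x. ennreal t < G' x} \<noteq> {}" by auto
      have "{x. ennreal t < F' x} \<subseteq> {-N..N}" using supp(1) by (force simp: F'_def)
      then show "bounded {x. ennreal t < F' x}" by (rule bounded_subset[rotated]) simp
      have "{x. ennreal t < G' x} \<subseteq> {-N..N}" using supp(2) by (force simp: G'_def)
      then show "bounded {x. ennreal t < G' x}" by (rule bounded_subset[rotated]) simp
      fix x y assume xy: "x \<in> {x. ennreal t < F' x}" "y \<in> {x. ennreal t < G' x}"
      obtain p q where pq: "0 \<le> p" "F' x = ennreal p" "0 \<le> q" "G' y = ennreal q"
        using F1[of x] G1[of y] by (cases "F' x"; cases "G' y") (auto simp: top_unique)
      then have "t * t < p * q" using xy t by (intro mult_strict_mono) (auto simp: ennreal_less_iff)
      then have "(ennreal t)\<^sup>2 < F' x * G' y"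
        using pq t by (simp add: power2_eq_square ennreal_less_iff flip: ennreal_mult)
      also have "\<dots> \<le> (H' ((x + y) / 2))\<^sup>2" by (rule FGH')
      finally have "\<not> H' ((x + y) / 2) \<le> ennreal t" by (meson not_less power_mono zero_le)
      then show "(x + y) / 2 \<in> {x. ennreal t < H' x}" by auto
    qed measurable
    \<comment> \<open>Cutting off at height 1 loses nothing for \<open>F'\<close> and \<open>G'\<close> and only decreases the integral
      of \<open>H'\<close>.\<close>
    have "(\<integral>\<^sup>+x. F' x \<partial>lborel) + (\<integral>\<^sup>+x. G' x \<partial>lborel) = (\<integral>\<^sup>+x. min (F' x) 1 \<partial>lborel) + (\<integral>\<^sup>+x. min (G' x) 1 \<partial>lborel)"
      using F1 G1 by (simp add: min_absorb1)
    also have "\<dots> = (\<integral>\<^sup>+t. emeasure lborel {x. ennreal t < F' x} * indicator {0..<1} t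
        + emeasure lborel {x. ennreal t < G' x} * indicator {0..<1} t \<partial>lborel)"
      by (subst (1 2) nn_integral_min_1_eq_level_sets) (auto simp: nn_integral_add lborel.sigma_finite_measure_axioms)
    also have "\<dots> \<le> (\<integral>\<^sup>+t. 2 * (emeasure lborel {x. ennreal t < H' x} * indicator {0..<1} t) \<partial>lborel)"
      using lev by (intro nn_integral_mono) (auto simp: indicator_def)
    also have "\<dots> = 2 * (\<integral>\<^sup>+t. emeasure lborel {x. ennreal t < H' x} * indicator {0..<1} t \<partial>lborel)"
      by (intro nn_integral_cmult) simp
    also have "\<dots> = 2 * (\<integral>\<^sup>+x. min (H' x) 1 \<partial>lborel)"
      by (subst nn_integral_min_1_eq_level_sets) (auto simp: lborel.sigma_finite_measure_axioms)
    also have "\<dots> \<le> 2 * (\<integral>\<^sup>+x. H' x \<partial>lborel)" by (intro mult_left_mono nn_integral_mono) auto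
    finally have "(\<integral>\<^sup>+x. F' x \<partial>lborel) * (\<integral>\<^sup>+x. G' x \<partial>lborel) \<le> (\<integral>\<^sup>+x. H' x \<partial>lborel)\<^sup>2"
      by (rule ennreal_amgm)
    then have "ennreal (a * b) * ((\<integral>\<^sup>+x. F' x \<partial>lborel) * (\<integral>\<^sup>+x. G' x \<partial>lborel))
      \<le> ennreal (a * b) * (\<integral>\<^sup>+x. H' x \<partial>lborel)\<^sup>2" by (intro mult_left_mono) auto
    moreover have "(\<integral>\<^sup>+x. F x \<partial>lborel) * (\<integral>\<^sup>+x. G x \<partial>lborel)
      = ennreal (a * b) * ((\<integral>\<^sup>+x. F' x \<partial>lborel) * (\<integral>\<^sup>+x. G' x \<partial>lborel))"
      using a b by (simp add: F G nn_integral_cmult ennreal_mult ac_simps)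
    moreover have "(\<integral>\<^sup>+x. H x \<partial>lborel)\<^sup>2 = ennreal (c * c) * (\<integral>\<^sup>+x. H' x \<partial>lborel)\<^sup>2"
      using c(1) by (simp add: H nn_integral_cmult ennreal_mult power2_eq_square ac_simps)
    ultimately show ?thesis by (simp add: c(2))
  qed
qed

lemma prekopa_leindler_real:
  fixes F G H :: "real \<Rightarrow> ennreal"
  assumes [measurable]: "F \<in> borel_measurable borel" "G \<in> borel_measurable borel" "H \<in> borel_measurable borel"
    and FGH: "\<And>x y. F x * G y \<le> (H ((x + y) / 2))\<^sup>2"
  shows "(\<integral>\<^sup>+x. F x \<partial>lborel) * (\<integral>\<^sup>+x. G x \<partial>lborel) \<le> (\<integral>\<^sup>+x. H x \<partial>lborel)\<^sup>2"
proof -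
  \<comment> \<open>Truncation in height and in space keeps the hypothesis, since it decreases the left side.\<close>
  define T where "T U n x = min (U x) (of_nat n) * indicator {- real n..real n} x" for U :: "real \<Rightarrow> ennreal" and n x
  have Tle: "T U n x \<le> U x" for U n x by (auto simp: T_def indicator_def)
  have inc: "incseq (T U)" for U
  proof (intro incseq_SucI le_funI)
    fix n x
    show "T U n x \<le> T U (Suc n) x"
      unfolding T_def by (intro mult_mono min.mono) (auto simp: indicator_def)
  qed
  have sup: "(SUP n. T U n x) = U x" for U x
  proof (rule antisym)
    show "(SUP n. T U n x) \<le> U x" by (intro SUP_least Tle)
    obtain m :: nat where m: "\<bar>x\<bar> \<le> real m" using real_arch_simple by blast
    have "U x = (SUP n. min (U x) (of_nat n))"
    proof (cases "U x = top")
      case True then show ?thesis by (simp add: ennreal_SUP_of_nat_eq_top)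
    next
      case False
      then obtain k where "U x < of_nat k" using ennreal_Ex_less_of_nat by (auto simp: less_top)
      then show ?thesis by (intro antisym SUP_upper2[of k] SUP_least) (auto simp: min_def)
    qed
    also have "\<dots> \<le> (SUP n. T U n x)"
    proof (intro SUP_mono bexI)
      fix n
      have "(of_nat n :: ennreal) \<le> of_nat (max m n)" by (rule of_nat_mono) simp
      then have "min (U x) (of_nat n) \<le> min (U x) (of_nat (max m n))" by (intro min.mono) auto
      moreover have "x \<in> {- real (max m n)..real (max m n)}" using m by auto
      ultimately show "min (U x) (of_nat n) \<le> T U (max m n) x" by (simp add: T_def)
    qed simp
    finally show "U x \<le> (SUP n. T U n x)" .
  qed
  have [measurable]: "T U n \<in> borel_measurable borel" if [measurable]: "U \<in> borel_measurable borel" for U n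
    unfolding T_def by measurable
  have int: "(\<integral>\<^sup>+x. U x \<partial>lborel) = (SUP n. \<integral>\<^sup>+x. T U n x \<partial>lborel)"
    if [measurable]: "U \<in> borel_measurable borel" for U
    using nn_integral_monotone_convergence_SUP[OF inc, of U lborel] by (simp add: sup)
  have incI: "incseq (\<lambda>n. \<integral>\<^sup>+x. T U n x \<partial>lborel)" for U
    using inc[of U] by (auto simp: incseq_def le_fun_def intro!: nn_integral_mono)
  have "(\<integral>\<^sup>+x. F x \<partial>lborel) * (\<integral>\<^sup>+x. G x \<partial>lborel)
    = (SUP n. SUP m. (\<integral>\<^sup>+x. T F m x \<partial>lborel) * (\<integral>\<^sup>+x. T G n x \<partial>lborel))"
    by (simp add: int[of F] int[of G] SUP_mult_left_ennreal SUP_mult_right_ennreal)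
  also have "\<dots> \<le> (\<integral>\<^sup>+x. H x \<partial>lborel)\<^sup>2"
  proof (intro SUP_least)
    fix n m :: nat
    let ?k = "max m n"
    have "(\<integral>\<^sup>+x. T F m x \<partial>lborel) * (\<integral>\<^sup>+x. T G n x \<partial>lborel)
      \<le> (\<integral>\<^sup>+x. T F ?k x \<partial>lborel) * (\<integral>\<^sup>+x. T G ?k x \<partial>lborel)"
      using incI[of F] incI[of G] by (intro mult_mono) (auto simp: incseq_def)
    also have "\<dots> \<le> (\<integral>\<^sup>+x. H x \<partial>lborel)\<^sup>2"
    proof (rule prekopa_leindler_real_bounded[where N="real ?k"])
      fix x y
      show "T F ?k x * T G ?k y \<le> (H ((x + y) / 2))\<^sup>2"
        by (rule order_trans[OF mult_mono FGH]) (auto simp: Tle)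
    qed (auto simp: T_def ennreal_of_nat_eq_real_of_nat indicator_def simp del: of_nat_max)
    finally show "(\<integral>\<^sup>+x. T F m x \<partial>lborel) * (\<integral>\<^sup>+x. T G n x \<partial>lborel) \<le> (\<integral>\<^sup>+x. H x \<partial>lborel)\<^sup>2" .
  qed
  finally show ?thesis .
qed

text \<open>Induction on the number of coordinates: for fixed values \<open>s\<close>, \<open>t\<close> and \<open>(s + t) / 2\<close> of the new
coordinate, the slices of the three functions satisfy the hypothesis, so their integrals are three
functions of one variable that satisfy it again.\<close>

lemma prekopa_leindler_PiM:
  fixes F G H :: "('i \<Rightarrow> real) \<Rightarrow> ennreal"
  assumes "finite I"
    and "F \<in> borel_measurable (Pi\<^sub>M I (\<lambda>_. lborel))" "G \<in> borel_measurable (Pi\<^sub>M I (\<lambda>_. lborel))"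
      "H \<in> borel_measurable (Pi\<^sub>M I (\<lambda>_. lborel))"
    and "\<And>x y. x \<in> extensional I \<Longrightarrow> y \<in> extensional I \<Longrightarrow> F x * G y \<le> (H (\<lambda>i\<in>I. (x i + y i) / 2))\<^sup>2"
  shows "(\<integral>\<^sup>+x. F x \<partial>Pi\<^sub>M I (\<lambda>_. lborel)) * (\<integral>\<^sup>+x. G x \<partial>Pi\<^sub>M I (\<lambda>_. lborel))
    \<le> (\<integral>\<^sup>+x. H x \<partial>Pi\<^sub>M I (\<lambda>_. lborel))\<^sup>2"
  using assms
proof (induction I arbitrary: F G H rule: finite_induct)
  case empty
  interpret product_sigma_finite "\<lambda>_. lborel" ..
  show ?case
    using empty(4)[of "\<lambda>_. undefined" "\<lambda>_. undefined"] empty(1-3)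
    by (simp add: nn_integral_empty restrict_def)
next
  case (insert i I)
  interpret product_sigma_finite "\<lambda>_. lborel" ..
  note [measurable] = insert.prems(1-3)
  let ?P = "Pi\<^sub>M I (\<lambda>_. lborel) :: ('i \<Rightarrow> real) measure"
  have rev: "(\<integral>\<^sup>+x. U x \<partial>Pi\<^sub>M (insert i I) (\<lambda>_. lborel)) = (\<integral>\<^sup>+s. \<integral>\<^sup>+x. U (x(i := s)) \<partial>?P \<partial>lborel)"
    if "U \<in> borel_measurable (Pi\<^sub>M (insert i I) (\<lambda>_. lborel))" for U :: "('i \<Rightarrow> real) \<Rightarrow> ennreal"
    using insert.hyps that by (intro product_nn_integral_insert_rev) auto
  have slice: "(\<lambda>x. U (x(i := s))) \<in> borel_measurable ?P"
    if [measurable]: "U \<in> borel_measurable (Pi\<^sub>M (insert i I) (\<lambda>_. lborel))" for U :: "('i \<Rightarrow> real) \<Rightarrow> ennreal" and s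
    by measurable
  interpret P: sigma_finite_measure ?P by (rule sigma_finite[OF insert.hyps(1)])
  have marg: "(\<lambda>s. \<integral>\<^sup>+x. U (x(i := s)) \<partial>?P) \<in> borel_measurable borel"
    if [measurable]: "U \<in> borel_measurable (Pi\<^sub>M (insert i I) (\<lambda>_. lborel))" for U :: "('i \<Rightarrow> real) \<Rightarrow> ennreal"
    by measurable
  show ?case
    unfolding rev[OF insert.prems(1)] rev[OF insert.prems(2)] rev[OF insert.prems(3)]
  proof (rule prekopa_leindler_real)
    fix s t :: real
    show "(\<integral>\<^sup>+x. F (x(i := s)) \<partial>?P) * (\<integral>\<^sup>+x. G (x(i := t)) \<partial>?P)
      \<le> (\<integral>\<^sup>+x. H (x(i := (s + t) / 2)) \<partial>?P)\<^sup>2"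
    proof (rule insert.IH)
      fix x y :: "'i \<Rightarrow> real"
      assume "x \<in> extensional I" "y \<in> extensional I"
      then have "F (x(i := s)) * G (y(i := t))
          \<le> (H (\<lambda>j\<in>insert i I. ((x(i := s)) j + (y(i := t)) j) / 2))\<^sup>2"
        by (intro insert.prems(4)) (auto simp: extensional_def)
      also have "(\<lambda>j\<in>insert i I. ((x(i := s)) j + (y(i := t)) j) / 2)
          = (\<lambda>j\<in>I. (x j + y j) / 2)(i := (s + t) / 2)"
        using insert.hyps by (auto simp: fun_eq_iff restrict_def)
      finally show "F (x(i := s)) * G (y(i := t)) \<le> (H ((\<lambda>j\<in>I. (x j + y j) / 2)(i := (s + t) / 2)))\<^sup>2" .
    qed (rule slice[OF insert.prems(1)] slice[OF insert.prems(2)] slice[OF insert.prems(3)])+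
  qed (use insert.prems(1-3) marg in auto)
qed

text \<open>The squares avoid roots of possibly infinite values. The function \<open>H\<close> is required to be measurable,
because the smallest function satisfying the hypothesis need not be.\<close>

theorem prekopa_leindler:
  fixes F G H :: "'a::euclidean_space \<Rightarrow> ennreal"
  assumes [measurable]: "F \<in> borel_measurable borel" "G \<in> borel_measurable borel" "H \<in> borel_measurable borel"
    and FGH: "\<And>x y. F x * G y \<le> (H ((1/2) *\<^sub>R (x + y)))\<^sup>2"
  shows "(\<integral>\<^sup>+x. F x \<partial>lborel) * (\<integral>\<^sup>+x. G x \<partial>lborel) \<le> (\<integral>\<^sup>+x. H x \<partial>lborel)\<^sup>2"
proof -
  let ?P = "Pi\<^sub>M Basis (\<lambda>_. lborel) :: ('a \<Rightarrow> real) measure"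
  let ?v = "\<lambda>u. \<Sum>b\<in>Basis. u b *\<^sub>R (b :: 'a)"
  have eq: "(\<integral>\<^sup>+x. U x \<partial>lborel) = (\<integral>\<^sup>+u. U (?v u) \<partial>?P)"
    if [measurable]: "U \<in> borel_measurable borel" for U :: "'a \<Rightarrow> ennreal"
    by (subst lborel_eq) (simp add: nn_integral_distr)
  have "?v (\<lambda>i\<in>Basis. (x i + y i) / 2) = (1/2) *\<^sub>R (?v x + ?v y)" for x y :: "'a \<Rightarrow> real"
  proof -
    have "?v (\<lambda>i\<in>Basis. (x i + y i) / 2) = (\<Sum>b\<in>Basis. (1/2) *\<^sub>R (x b *\<^sub>R b + y b *\<^sub>R b))"
      by (intro sum.cong) (simp_all add: add_divide_distrib scaleR_add_left scaleR_add_right)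
    also have "\<dots> = (1/2) *\<^sub>R (?v x + ?v y)"
      by (simp only: scaleR_sum_right[symmetric] sum.distrib)
    finally show ?thesis .
  qed
  then show ?thesis
    unfolding eq[OF assms(1)] eq[OF assms(2)] eq[OF assms(3)]
    by (intro prekopa_leindler_PiM) (auto intro: FGH)
qed

section \<open>From Prekopa-Leindler to a variance bound\<close>

text \<open>A Taylor polynomial of odd degree bounds \<open>exp\<close> from below on the whole line. The quadratic one
does not do so for negative arguments, and both signs of \<open>t\<close> occur below.\<close>

lemma exp_ge_cubic: "1 + t + t\<^sup>2 / 2 + t ^ 3 / 6 \<le> exp t" for t :: real
proof -
  obtain s where "exp t = (\<Sum>m<4. t ^ m / fact m) + exp s / fact 4 * t ^ 4"
    using Maclaurin_exp_le[of t 4] by blast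
  moreover have "(\<Sum>m<4. t ^ m / fact m) = 1 + t + t\<^sup>2 / 2 + t ^ 3 / 6"
    by (simp add: eval_nat_numeral fact_numeral)
  ultimately show ?thesis by simp
qed

text \<open>Prekopa-Leindler for \<open>w exp (\<delta> f)\<close>, \<open>w exp (- \<delta> f)\<close> and \<open>w exp (\<delta>\<^sup>2 q)\<close>, expanded at \<open>\<delta> = 0\<close>.
The terms of order 0 agree and those of order 1 cancel. Those of order 2 give the claim, which is
\<open>Var f \<le> 2 \<integral> q\<close> for the probability measure proportional to \<open>w\<close>, with denominators cleared.\<close>

proposition variance_le_of_midpoint_bound:
  fixes w f q :: "'a::euclidean_space \<Rightarrow> real"
  assumes w: "integrable lborel w" "\<And>x. 0 \<le> w x"
    and f: "f \<in> borel_measurable borel" "\<And>x. \<bar>f x\<bar> \<le> M"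
    and q: "q \<in> borel_measurable borel" "\<And>x. 0 \<le> q x" "\<And>x. q x \<le> M"
    and d0: "0 < \<delta>\<^sub>0"
    and mid: "\<And>\<delta> x y. 0 < \<delta> \<Longrightarrow> \<delta> < \<delta>\<^sub>0 \<Longrightarrow>
      w x * w y * exp (\<delta> * (f x - f y))
        \<le> (w ((1/2) *\<^sub>R (x + y)))\<^sup>2 * exp (2 * \<delta>\<^sup>2 * q ((1/2) *\<^sub>R (x + y)))"
  shows "(\<integral>x. w x \<partial>lborel) * (\<integral>x. (f x)\<^sup>2 * w x \<partial>lborel) - (\<integral>x. f x * w x \<partial>lborel)\<^sup>2
    \<le> 2 * (\<integral>x. w x \<partial>lborel) * (\<integral>x. q x * w x \<partial>lborel)"
proof -
  note [measurable] = borel_measurable_integrable[OF w(1)] f(1) q(1)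
  have intw: "integrable lborel (\<lambda>x. h x * w x)"
    if "h \<in> borel_measurable borel" "\<And>x. \<bar>h x\<bar> \<le> c" for h :: "'a \<Rightarrow> real" and c
  proof (rule Bochner_Integration.integrable_bound[of _ "\<lambda>x. c * w x"])
    show "AE x in lborel. norm (h x * w x) \<le> norm (c * w x)"
    proof (intro AE_I2)
      fix x
      have "\<bar>h x\<bar> * w x \<le> \<bar>c\<bar> * w x" using that(2)[of x] w(2)[of x] by (intro mult_right_mono) auto
      then show "norm (h x * w x) \<le> norm (c * w x)" using w(2)[of x] by (simp add: abs_mult)
    qed
  qed (use w that in auto)
  have M: "0 \<le> M" using f(2)[of 0] by linarith
  have if1: "integrable lborel (\<lambda>x. f x ^ n * w x)" for n
    using f M by (intro intw[of _ "M ^ n"]) (auto simp: power_abs intro!: power_mono)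
  have iq1: "integrable lborel (\<lambda>x. q x ^ n * w x)" for n
    using q M by (intro intw[of _ "M ^ n"]) (auto simp: power_abs intro!: power_mono)
  define A B C T Q R where "A = (\<integral>x. w x \<partial>lborel)" and "B = (\<integral>x. f x * w x \<partial>lborel)"
    and "C = (\<integral>x. (f x)\<^sup>2 * w x \<partial>lborel)" and "T = (\<integral>x. f x ^ 3 * w x \<partial>lborel)"
    and "Q = (\<integral>x. q x * w x \<partial>lborel)" and "R = (\<integral>x. (q x)\<^sup>2 * w x \<partial>lborel)"
  have A0: "0 \<le> A" using w unfolding A_def by (intro Bochner_Integration.integral_nonneg) auto
  show ?thesis
  proof (cases "A = 0")
    case True
    then have "AE x in lborel. w x = 0"
      using w integral_nonneg_eq_0_iff_AE[of lborel w] by (simp add: A_def)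
    then have "C = 0" "B = 0"
      unfolding C_def B_def by (auto intro!: integral_eq_zero_AE elim!: eventually_mono)
    then show ?thesis using True by (simp add: A_def B_def C_def)
  next
    case False
    \<comment> \<open>Polynomial bounds for the three integrals: \<open>P \<delta>\<close> and \<open>P (- \<delta>)\<close> from below, \<open>J \<delta>\<close> from above.\<close>
    define P where "P \<delta> = A + \<delta> * B + \<delta>\<^sup>2 / 2 * C + \<delta> ^ 3 / 6 * T" for \<delta>
    define J where "J \<delta> = A + \<delta>\<^sup>2 * Q + \<delta> ^ 4 * R" for \<delta>
    define I where "I \<delta> = (\<integral>x. w x * exp (\<delta> * f x) \<partial>lborel)" for \<delta>
    have iI: "integrable lborel (\<lambda>x. w x * exp (\<delta> * f x))" for \<delta>
    proof -
      have "\<delta> * f x \<le> \<bar>\<delta>\<bar> * M" for x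
      proof -
        have "\<bar>\<delta> * f x\<bar> \<le> \<bar>\<delta>\<bar> * M" unfolding abs_mult using f(2)[of x] by (intro mult_left_mono) auto
        then show ?thesis by linarith
      qed
      then have "integrable lborel (\<lambda>x. exp (\<delta> * f x) * w x)" by (intro intw[of _ "exp (\<bar>\<delta>\<bar> * M)"]) auto
      then show ?thesis by (simp add: mult.commute)
    qed
    have PI: "P \<delta> \<le> I \<delta>" for \<delta>
    proof -
      have "P \<delta> = (\<integral>x. w x + \<delta> * (f x * w x) + \<delta>\<^sup>2 / 2 * ((f x)\<^sup>2 * w x) + \<delta> ^ 3 / 6 * (f x ^ 3 * w x) \<partial>lborel)"
        unfolding P_def A_def B_def C_def T_def using w if1[of 1] if1[of 2] if1[of 3] by simp
      also have "\<dots> \<le> I \<delta>"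
        unfolding I_def
      proof (intro integral_mono iI)
        show "integrable lborel (\<lambda>x. w x + \<delta> * (f x * w x) + \<delta>\<^sup>2 / 2 * ((f x)\<^sup>2 * w x) + \<delta> ^ 3 / 6 * (f x ^ 3 * w x))"
          using w if1[of 1] if1[of 2] if1[of 3] by simp
        fix x
        have "w x * (1 + (\<delta> * f x) + (\<delta> * f x)\<^sup>2 / 2 + (\<delta> * f x) ^ 3 / 6) \<le> w x * exp (\<delta> * f x)"
          using w by (intro mult_left_mono exp_ge_cubic) auto
        then show "w x + \<delta> * (f x * w x) + \<delta>\<^sup>2 / 2 * ((f x)\<^sup>2 * w x) + \<delta> ^ 3 / 6 * (f x ^ 3 * w x) \<le> w x * exp (\<delta> * f x)"
          by (simp add: algebra_simps power_mult_distrib)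
      qed
      finally show ?thesis .
    qed
    have key: "P \<delta> * P (- \<delta>) \<le> (J \<delta>)\<^sup>2"
      if d: "0 < \<delta>" "\<delta> < \<delta>\<^sub>0" "\<delta>\<^sup>2 * M \<le> 1" "0 \<le> P \<delta>" "0 \<le> P (- \<delta>)" for \<delta>
    proof -
      have dq: "\<delta>\<^sup>2 * q x \<le> 1" for x using mult_left_mono[OF q(3)[of x], of "\<delta>\<^sup>2"] d(3) by (simp add: order_trans)
      have iJ: "integrable lborel (\<lambda>x. w x * exp (\<delta>\<^sup>2 * q x))"
        using intw[of "\<lambda>x. exp (\<delta>\<^sup>2 * q x)" "exp 1"] dq by (simp add: mult.commute)
      have "(\<integral>\<^sup>+x. ennreal (w x * exp (\<delta> * f x)) \<partial>lborel) * (\<integral>\<^sup>+x. ennreal (w x * exp (- \<delta> * f x)) \<partial>lborel)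
        \<le> (\<integral>\<^sup>+x. ennreal (w x * exp (\<delta>\<^sup>2 * q x)) \<partial>lborel)\<^sup>2"
      proof (rule prekopa_leindler)
        fix x y :: 'a
        let ?m = "(1/2) *\<^sub>R (x + y)"
        have "w x * exp (\<delta> * f x) * (w y * exp (- \<delta> * f y)) = w x * w y * exp (\<delta> * (f x - f y))"
          by (simp add: algebra_simps exp_diff exp_minus field_simps)
        also have "\<dots> \<le> (w ?m * exp (\<delta>\<^sup>2 * q ?m))\<^sup>2"
          using mid[OF d(1,2), of x y] by (simp add: power_mult_distrib exp_double[symmetric] mult.assoc)
        finally show "ennreal (w x * exp (\<delta> * f x)) * ennreal (w y * exp (- \<delta> * f y))
            \<le> (ennreal (w ?m * exp (\<delta>\<^sup>2 * q ?m)))\<^sup>2"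
          using w(2) by (simp add: ennreal_power ennreal_leI flip: ennreal_mult)
      qed measurable
      also have "(\<integral>\<^sup>+x. ennreal (w x * exp (\<delta>\<^sup>2 * q x)) \<partial>lborel) = ennreal (\<integral>x. w x * exp (\<delta>\<^sup>2 * q x) \<partial>lborel)"
        using iJ w(2) by (intro nn_integral_eq_integral) auto
      also have "(\<integral>\<^sup>+x. ennreal (w x * exp (\<delta> * f x)) \<partial>lborel) = ennreal (I \<delta>)"
        unfolding I_def using iI w(2) by (intro nn_integral_eq_integral) auto
      also have "(\<integral>\<^sup>+x. ennreal (w x * exp (- \<delta> * f x)) \<partial>lborel) = ennreal (I (- \<delta>))"
        unfolding I_def using iI[of "-\<delta>"] w(2) by (intro nn_integral_eq_integral) auto
      finally have "I \<delta> * I (- \<delta>) \<le> (\<integral>x. w x * exp (\<delta>\<^sup>2 * q x) \<partial>lborel)\<^sup>2"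
        using w(2) by (simp add: I_def ennreal_power Bochner_Integration.integral_nonneg ennreal_le_iff flip: ennreal_mult)
      moreover have "P \<delta> * P (- \<delta>) \<le> I \<delta> * I (- \<delta>)"
        using d PI[of \<delta>] PI[of "- \<delta>"] by (intro mult_mono) auto
      moreover have "(\<integral>x. w x * exp (\<delta>\<^sup>2 * q x) \<partial>lborel) \<le> J \<delta>"
      proof -
        have "(\<integral>x. w x * exp (\<delta>\<^sup>2 * q x) \<partial>lborel)
          \<le> (\<integral>x. w x + \<delta>\<^sup>2 * (q x * w x) + \<delta> ^ 4 * ((q x)\<^sup>2 * w x) \<partial>lborel)"
        proof (intro integral_mono iJ)
          show "integrable lborel (\<lambda>x. w x + \<delta>\<^sup>2 * (q x * w x) + \<delta> ^ 4 * ((q x)\<^sup>2 * w x))"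
            using w iq1[of 1] iq1[of 2] by simp
          fix x
          have "w x * exp (\<delta>\<^sup>2 * q x) \<le> w x * (1 + \<delta>\<^sup>2 * q x + (\<delta>\<^sup>2 * q x)\<^sup>2)"
            using w q dq by (intro mult_left_mono exp_bound) auto
          then show "w x * exp (\<delta>\<^sup>2 * q x) \<le> w x + \<delta>\<^sup>2 * (q x * w x) + \<delta> ^ 4 * ((q x)\<^sup>2 * w x)"
            by (simp add: algebra_simps power_mult_distrib flip: power_mult)
        qed
        also have "\<dots> = J \<delta>"
          unfolding J_def A_def Q_def R_def using w iq1[of 1] iq1[of 2] by simp
        finally show ?thesis .
      qed
      moreover have "0 \<le> (\<integral>x. w x * exp (\<delta>\<^sup>2 * q x) \<partial>lborel)" using w by (intro Bochner_Integration.integral_nonneg) auto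
      ultimately show ?thesis by (meson order_trans power_mono)
    qed
    \<comment> \<open>Multiplying the lower bounds requires them to be nonnegative, which holds for small \<open>\<delta>\<close>.\<close>
    have Apos: "0 < A" using A0 False by simp
    have lim_P: "((\<lambda>\<delta>. P \<delta>) \<longlongrightarrow> A) (at_right 0)" "((\<lambda>\<delta>. P (- \<delta>)) \<longlongrightarrow> A) (at_right 0)"
      unfolding P_def by (auto intro!: tendsto_eq_intros)
    have "((\<lambda>\<delta>. \<delta>\<^sup>2 * M) \<longlongrightarrow> 0) (at_right (0::real))" by (auto intro!: tendsto_eq_intros)
    then have ev3: "eventually (\<lambda>\<delta>. \<delta>\<^sup>2 * M < 1) (at_right (0::real))" by (rule order_tendstoD) simp
    have ev: "eventually (\<lambda>\<delta>. A * C + \<delta>\<^sup>2 * C\<^sup>2 / 4 - (B + \<delta>\<^sup>2 * T / 6)\<^sup>2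
      \<le> 2 * A * (Q + \<delta>\<^sup>2 * R) + \<delta>\<^sup>2 * (Q + \<delta>\<^sup>2 * R)\<^sup>2) (at_right 0)"
      using order_tendstoD(1)[OF lim_P(1) Apos] order_tendstoD(1)[OF lim_P(2) Apos] ev3
        eventually_at_right_real[OF d0]
    proof eventually_elim
      case (elim \<delta>)
      then have "P \<delta> * P (- \<delta>) \<le> (J \<delta>)\<^sup>2" by (intro key) auto
      then have "\<delta>\<^sup>2 * (A * C + \<delta>\<^sup>2 * C\<^sup>2 / 4 - (B + \<delta>\<^sup>2 * T / 6)\<^sup>2)
        \<le> \<delta>\<^sup>2 * (2 * A * (Q + \<delta>\<^sup>2 * R) + \<delta>\<^sup>2 * (Q + \<delta>\<^sup>2 * R)\<^sup>2)"
      proof -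
        have "P \<delta> * P (- \<delta>) = A\<^sup>2 + \<delta>\<^sup>2 * (A * C + \<delta>\<^sup>2 * C\<^sup>2 / 4 - (B + \<delta>\<^sup>2 * T / 6)\<^sup>2)"
          unfolding P_def by (simp add: power2_eq_square power3_eq_cube field_simps)
        moreover have "(J \<delta>)\<^sup>2 = A\<^sup>2 + \<delta>\<^sup>2 * (2 * A * (Q + \<delta>\<^sup>2 * R) + \<delta>\<^sup>2 * (Q + \<delta>\<^sup>2 * R)\<^sup>2)"
          unfolding J_def by (simp add: power2_eq_square power4_eq_xxxx field_simps)
        ultimately show ?thesis using \<open>P \<delta> * P (- \<delta>) \<le> (J \<delta>)\<^sup>2\<close> by linarith
      qed
      then show ?case using elim(4) by (simp add: mult_le_cancel_left)
    qed
    have "A * C - B\<^sup>2 \<le> 2 * A * Q"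
    proof (rule tendsto_le[OF _ _ _ ev])
      show "((\<lambda>\<delta>. A * C + \<delta>\<^sup>2 * C\<^sup>2 / 4 - (B + \<delta>\<^sup>2 * T / 6)\<^sup>2) \<longlongrightarrow> A * C - B\<^sup>2) (at_right 0)"
        by (auto intro!: tendsto_eq_intros)
      show "((\<lambda>\<delta>. 2 * A * (Q + \<delta>\<^sup>2 * R) + \<delta>\<^sup>2 * (Q + \<delta>\<^sup>2 * R)\<^sup>2) \<longlongrightarrow> 2 * A * Q) (at_right 0)"
        by (auto intro!: tendsto_eq_intros)
    qed simp
    then show ?thesis by (simp add: A_def B_def C_def Q_def)
  qed
qed

text \<open>With \<open>u = ((x - y) / (2 m))\<^sup>2\<close> one has \<open>x y = m\<^sup>2 (1 - u) \<le> m\<^sup>2 exp (- u)\<close>.\<close>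

lemma powr_mult_midpoint_le:
  fixes x y p :: real
  assumes "0 < x" "0 < y" "0 \<le> p"
  defines "m \<equiv> (x + y) / 2"
  shows "x powr p * y powr p \<le> (m powr p)\<^sup>2 * exp (- (p * ((x - y) / (2 * m))\<^sup>2))"
proof -
  let ?u = "((x - y) / (2 * m))\<^sup>2"
  have m: "0 < m" using assms by simp
  have "x * y = m\<^sup>2 - ((x - y) / 2)\<^sup>2" by (simp add: m_def power2_eq_square field_simps)
  also have "\<dots> = m\<^sup>2 * (1 - ?u)" using m by (simp add: power_divide field_simps power2_eq_square)
  also have "\<dots> \<le> m\<^sup>2 * exp (- ?u)" using exp_ge_add_one_self[of "- ?u"] by (intro mult_left_mono) auto
  finally have "(x * y) powr p \<le> (m\<^sup>2 * exp (- ?u)) powr p" using assms by (intro powr_mono2) auto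
  also have "(x * y) powr p = x powr p * y powr p" using assms by (simp add: powr_mult)
  also have "(m\<^sup>2 * exp (- ?u)) powr p = (m\<^sup>2) powr p * exp (- ?u) powr p" by (rule powr_mult)
  also have "(m\<^sup>2) powr p = (m powr p)\<^sup>2" using m by (simp add: power2_eq_square powr_mult)
  also have "exp (- ?u) powr p = exp (- (p * ?u))" by (simp add: powr_def)
  finally show ?thesis .
qed

lemma log_concave_on_midpoint:
  assumes "log_concave_on {0<..} g" "0 < r" "0 < s"
  shows "g r * g s \<le> (g ((r + s) / 2))\<^sup>2"
proof -
  obtain V where V: "convex_on {0<..} V" "\<And>r. 0 < r \<Longrightarrow> g r = exp (- V r)"
    using assms(1) by (auto simp: log_concave_on_def)
  have "V ((r + s) / 2) \<le> V r / 2 + V s / 2"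
    using convex_onD[OF V(1), of "1/2" r s] assms by (simp add: field_simps)
  then show ?thesis
    using assms V(2)[of r] V(2)[of s] V(2)[of "(r + s) / 2"]
    by (simp add: power2_eq_square flip: exp_add)
qed

lemma continuous_on_liouville_weight:
  fixes \<alpha> :: "real^'n::finite"
  assumes "log_concave_on {0<..} g"
  shows "continuous_on pos_orthant (liouville_weight \<alpha> g)"
proof -
  obtain V where V: "convex_on {0<..} V" "\<And>r. 0 < r \<Longrightarrow> g r = exp (- V r)"
    using assms by (auto simp: log_concave_on_def)
  have "continuous_on {0<..} V" using V(1) by (intro convex_on_continuous) auto
  then have "continuous_on {0<..} (\<lambda>r. exp (- V r))" by (intro continuous_intros)
  then have g: "continuous_on {0<..} g" by (rule continuous_on_eq) (use V(2) in auto)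
  have "continuous_on pos_orthant (\<lambda>x::real^'n. g (\<Sum>i\<in>UNIV. x $ i))"
    by (rule continuous_on_compose2[OF g])
       (auto intro!: continuous_intros sum_pos simp: pos_orthant_def)
  then show ?thesis
    unfolding liouville_weight_def
    by (intro continuous_intros) (auto simp: pos_orthant_def less_imp_neq[THEN not_sym])
qed

lemma liouville_weight_pos:
  fixes x :: "real^'n::finite"
  assumes "x \<in> pos_orthant" "\<And>r. 0 < r \<Longrightarrow> 0 < g r"
  shows "0 < liouville_weight \<alpha> g x"
proof -
  have x: "0 < x $ i" for i using assms(1) by (simp add: pos_orthant_def)
  then have "0 < (\<Sum>i\<in>UNIV. x $ i)" by (intro sum_pos) auto
  moreover have "0 < x $ i powr (\<alpha> $ i - 1)" for i using x[of i] by simp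
  ultimately show ?thesis unfolding liouville_weight_def using assms(2) by (intro mult_pos_pos prod_pos) auto
qed

text \<open>This replaces the lower bound on the Hessian of the negative logarithm of the weight. The gain in the
exponent comes from the power functions alone.\<close>

lemma liouville_weight_midpoint:
  fixes x y :: "real^'n::finite"
  assumes x: "x \<in> pos_orthant" and y: "y \<in> pos_orthant" and \<alpha>: "\<And>i. 1 \<le> \<alpha> $ i"
    and g: "log_concave_on {0<..} g" "\<And>r. 0 < r \<Longrightarrow> 0 < g r"
  defines "m \<equiv> (1/2) *\<^sub>R (x + y)"
  shows "liouville_weight \<alpha> g x * liouville_weight \<alpha> g y
    \<le> (liouville_weight \<alpha> g m)\<^sup>2 * exp (- (\<Sum>i\<in>UNIV. (\<alpha> $ i - 1) * ((x $ i - y $ i) / (2 * m $ i))\<^sup>2))"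
proof -
  have pos: "0 < x $ i" "0 < y $ i" for i using x y by (auto simp: pos_orthant_def)
  have m: "m $ i = (x $ i + y $ i) / 2" for i by (simp add: m_def)
  have "(\<Prod>i\<in>UNIV. x $ i powr (\<alpha> $ i - 1)) * (\<Prod>i\<in>UNIV. y $ i powr (\<alpha> $ i - 1))
    = (\<Prod>i\<in>UNIV. x $ i powr (\<alpha> $ i - 1) * y $ i powr (\<alpha> $ i - 1))" by (simp add: prod.distrib)
  also have "\<dots> \<le> (\<Prod>i\<in>UNIV. (m $ i powr (\<alpha> $ i - 1))\<^sup>2 * exp (- ((\<alpha> $ i - 1) * ((x $ i - y $ i) / (2 * m $ i))\<^sup>2)))"
    unfolding m using pos \<alpha> by (intro prod_mono conjI powr_mult_midpoint_le) auto
  also have "\<dots> = (\<Prod>i\<in>UNIV. m $ i powr (\<alpha> $ i - 1))\<^sup>2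
      * exp (- (\<Sum>i\<in>UNIV. (\<alpha> $ i - 1) * ((x $ i - y $ i) / (2 * m $ i))\<^sup>2))"
    by (simp add: prod.distrib prod_power_distrib exp_sum flip: sum_negf)
  finally have 1: "(\<Prod>i\<in>UNIV. x $ i powr (\<alpha> $ i - 1)) * (\<Prod>i\<in>UNIV. y $ i powr (\<alpha> $ i - 1))
    \<le> (\<Prod>i\<in>UNIV. m $ i powr (\<alpha> $ i - 1))\<^sup>2
      * exp (- (\<Sum>i\<in>UNIV. (\<alpha> $ i - 1) * ((x $ i - y $ i) / (2 * m $ i))\<^sup>2))" .
  have s: "0 < (\<Sum>i\<in>UNIV. x $ i)" "0 < (\<Sum>i\<in>UNIV. y $ i)" using pos by (auto intro!: sum_pos)
  have sm: "((\<Sum>i\<in>UNIV. x $ i) + (\<Sum>i\<in>UNIV. y $ i)) / 2 = (\<Sum>i\<in>UNIV. m $ i)"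
    by (simp add: m sum.distrib flip: sum_divide_distrib)
  have 2: "g (\<Sum>i\<in>UNIV. x $ i) * g (\<Sum>i\<in>UNIV. y $ i) \<le> (g (\<Sum>i\<in>UNIV. m $ i))\<^sup>2"
    using log_concave_on_midpoint[OF g(1) s] by (simp add: sm)
  have "0 \<le> g (\<Sum>i\<in>UNIV. x $ i) * g (\<Sum>i\<in>UNIV. y $ i)" using g(2) s by (simp add: less_imp_le)
  then have "((\<Prod>i\<in>UNIV. x $ i powr (\<alpha> $ i - 1)) * (\<Prod>i\<in>UNIV. y $ i powr (\<alpha> $ i - 1)))
      * (g (\<Sum>i\<in>UNIV. x $ i) * g (\<Sum>i\<in>UNIV. y $ i))
    \<le> ((\<Prod>i\<in>UNIV. m $ i powr (\<alpha> $ i - 1))\<^sup>2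
      * exp (- (\<Sum>i\<in>UNIV. (\<alpha> $ i - 1) * ((x $ i - y $ i) / (2 * m $ i))\<^sup>2))) * (g (\<Sum>i\<in>UNIV. m $ i))\<^sup>2"
    by (intro mult_mono[OF 1 2]) auto
  then show ?thesis by (simp add: liouville_weight_def power_mult_distrib ac_simps)
qed

text \<open>The second-order Taylor bound turns \<open>\<delta> (f x - f y)\<close> into \<open>\<delta> \<Sum>i. (2 h\<^sub>i G\<^sub>i + 2 C h\<^sub>i\<^sup>2)\<close>, where \<open>h\<close>
is half of \<open>x - y\<close> and the gradient \<open>G\<close> is taken at the midpoint. The gain in
\<open>liouville_weight_midpoint\<close> is \<open>\<Sum>i. p\<^sub>i h\<^sub>i\<^sup>2\<close> with \<open>p\<^sub>i = (\<alpha>\<^sub>i - 1) / m\<^sub>i\<^sup>2\<close>, and it absorbs the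
error \<open>2 \<delta> C h\<^sub>i\<^sup>2\<close> for small \<open>\<delta>\<close>, because \<open>p\<^sub>i\<close> is bounded below on the bounded set \<open>K\<close>. The part
of the gain spent on the error costs a factor \<open>c > 1\<close> in the result, which can be chosen
arbitrarily close to 1.\<close>

proposition brascamp_lieb_convex:
  fixes \<alpha> :: "real^'n::finite" and f :: "real^'n \<Rightarrow> real" and G :: "'n \<Rightarrow> real^'n \<Rightarrow> real"
  assumes \<alpha>: "\<And>i. 1 < \<alpha> $ i"
    and g: "log_concave_on {0<..} g" "\<And>r. 0 < r \<Longrightarrow> 0 < g r"
    and K: "K \<in> sets borel" "convex K" "\<And>x i. x \<in> K \<Longrightarrow> 0 < x $ i" "\<And>x i. x \<in> K \<Longrightarrow> x $ i \<le> u"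
    and w: "set_integrable lborel K (liouville_weight \<alpha> g)"
    and f: "f \<in> borel_measurable borel" "\<And>x. x \<in> K \<Longrightarrow> \<bar>f x\<bar> \<le> M"
    and G: "\<And>i. G i \<in> borel_measurable borel" "\<And>x i. x \<in> K \<Longrightarrow> \<bar>G i x\<bar> \<le> M"
    and taylor: "\<And>x y. x \<in> K \<Longrightarrow> y \<in> K \<Longrightarrow>
      \<bar>f y - f x - (\<Sum>i\<in>UNIV. (y $ i - x $ i) * G i x)\<bar> \<le> C * (\<Sum>i\<in>UNIV. (y $ i - x $ i)\<^sup>2)"
  defines "S \<equiv> \<lambda>x. \<Sum>i\<in>UNIV. 1 / (\<alpha> $ i - 1) * (x $ i)\<^sup>2 * (G i x)\<^sup>2"
  shows "(LINT x:K|lborel. liouville_weight \<alpha> g x) * (LINT x:K|lborel. (f x)\<^sup>2 * liouville_weight \<alpha> g x)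
      - (LINT x:K|lborel. f x * liouville_weight \<alpha> g x)\<^sup>2
    \<le> (LINT x:K|lborel. liouville_weight \<alpha> g x) * (LINT x:K|lborel. S x * liouville_weight \<alpha> g x)"
proof -
  let ?W = "liouville_weight \<alpha> g"
  have Wpos: "0 < ?W x" if "x \<in> K" for x
    using K(3)[OF that] g(2) by (intro liouville_weight_pos) (auto simp: pos_orthant_def)
  define w f' q where "w x = indicator K x * ?W x" and "f' x = indicator K x * f x"
    and "q x = indicator K x * (1/2) * S x" for x
  note [measurable] = f(1) G(1) K(1)
  define N where "N = \<bar>M\<bar> + (\<Sum>i\<in>UNIV. 1 / (\<alpha> $ i - 1) * u\<^sup>2 * M\<^sup>2)"
  have sumN: "0 \<le> (\<Sum>i\<in>UNIV. 1 / (\<alpha> $ i - 1) * u\<^sup>2 * M\<^sup>2)"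
    using \<alpha> by (intro sum_nonneg) (auto simp: less_imp_le)
  have S0: "0 \<le> S x" for x
    unfolding S_def using \<alpha> by (intro sum_nonneg) (auto simp: less_imp_le)
  have SN: "S x \<le> N" if "x \<in> K" for x
  proof -
    have "S x \<le> (\<Sum>i\<in>UNIV. 1 / (\<alpha> $ i - 1) * u\<^sup>2 * M\<^sup>2)"
      unfolding S_def
    proof (intro sum_mono mult_mono)
      fix i
      show "(x $ i)\<^sup>2 \<le> u\<^sup>2" using K(3,4)[OF that, of i] by (intro power_mono) auto
      show "(G i x)\<^sup>2 \<le> M\<^sup>2" using G(2)[OF that, of i] by (simp add: abs_le_square_iff[symmetric])
    qed (use \<alpha> in \<open>auto simp: less_imp_le\<close>)
    then show ?thesis by (simp add: N_def)
  qed
  have [measurable]: "S \<in> borel_measurable borel" unfolding S_def by measurable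
  have wint: "integrable lborel w" using w by (simp add: w_def[abs_def] set_integrable_def)
  have lin: "(\<integral>x. w x \<partial>lborel) * (\<integral>x. (f' x)\<^sup>2 * w x \<partial>lborel) - (\<integral>x. f' x * w x \<partial>lborel)\<^sup>2
    \<le> c * ((\<integral>x. w x \<partial>lborel) * (\<integral>x. 2 * q x * w x \<partial>lborel))" if c: "1 < c" for c
  proof -
    define a where "a = (MIN i. \<alpha> $ i - 1)"
    have a: "0 < a" "\<And>i. a \<le> \<alpha> $ i - 1" using \<alpha> by (auto simp: a_def)
    \<comment> \<open>Chosen such that \<open>2 \<delta> C \<le> (1 - 1 / c) p\<^sub>i\<close> whenever \<open>\<delta> < d\<close>, as \<open>p\<^sub>i \<ge> a / (u\<^sup>2 + 1)\<close> on \<open>K\<close>. The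
      summands 1 only keep the denominator positive.\<close>
    define d where "d = a * (1 - 1 / c) / (2 * (\<bar>C\<bar> + 1) * (u\<^sup>2 + 1))"
    have "0 < 1 - 1 / c" using c by simp
    moreover have "0 < u\<^sup>2 + 1" by (intro add_nonneg_pos) auto
    ultimately have d: "0 < d" unfolding d_def using a by (intro divide_pos_pos mult_pos_pos) auto
    have "(\<integral>x. w x \<partial>lborel) * (\<integral>x. (f' x)\<^sup>2 * w x \<partial>lborel) - (\<integral>x. f' x * w x \<partial>lborel)\<^sup>2
      \<le> 2 * (\<integral>x. w x \<partial>lborel) * (\<integral>x. (c * q x) * w x \<partial>lborel)"
    proof (rule variance_le_of_midpoint_bound[where M="\<bar>c\<bar> * N + N" and \<delta>\<^sub>0=d])
      have N0: "0 \<le> N" using sumN by (simp add: N_def)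
      show "\<bar>f' x\<bar> \<le> \<bar>c\<bar> * N + N" for x
      proof -
        have "\<bar>f' x\<bar> \<le> \<bar>M\<bar>" using f(2)[of x] by (auto simp: f'_def indicator_def)
        also have "\<dots> \<le> N" using sumN by (simp add: N_def)
        finally show ?thesis using N0 by (simp add: add_increasing)
      qed
      show "0 \<le> c * q x" for x using S0 c by (simp add: q_def)
      show "c * q x \<le> \<bar>c\<bar> * N + N" for x
      proof -
        have "q x \<le> N" using SN[of x] S0[of x] N0 by (auto simp: q_def indicator_def)
        then have "c * q x \<le> \<bar>c\<bar> * N" using c by (auto intro!: mult_mono)
        then show ?thesis using N0 by simp
      qed
      show "0 \<le> w x" for x using Wpos[of x] by (auto simp: w_def indicator_def less_imp_le)
      fix \<delta> :: real and x y :: "real^'n"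
      assume \<delta>: "0 < \<delta>" "\<delta> < d"
      let ?m = "(1/2) *\<^sub>R (x + y)"
      show "w x * w y * exp (\<delta> * (f' x - f' y)) \<le> (w ?m)\<^sup>2 * exp (2 * \<delta>\<^sup>2 * (c * q ?m))"
      proof (cases "x \<in> K \<and> y \<in> K")
        case False
        then have "w x * w y = 0" by (auto simp: w_def)
        moreover have "0 \<le> (w ?m)\<^sup>2 * exp (2 * \<delta>\<^sup>2 * (c * q ?m))" by simp
        ultimately show ?thesis by (simp only: mult_zero_left)
      next
        case True
        then have xy: "x \<in> K" "y \<in> K" by auto
        have mK: "?m \<in> K" using convexD[OF K(2) xy, of "1/2" "1/2"] by (simp add: scaleR_add_right)
        define h where "h i = (x $ i - y $ i) / 2" for i
        have hx: "x $ i - ?m $ i = h i" and hy: "y $ i - ?m $ i = - h i" for i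
          by (simp_all add: h_def field_simps)
        have "f x - f ?m - (\<Sum>i\<in>UNIV. h i * G i ?m) \<le> C * (\<Sum>i\<in>UNIV. (h i)\<^sup>2)"
          using taylor[OF mK xy(1)] by (simp only: hx abs_le_iff)
        moreover have "- (f y - f ?m - (\<Sum>i\<in>UNIV. - h i * G i ?m)) \<le> C * (\<Sum>i\<in>UNIV. (h i)\<^sup>2)"
          using taylor[OF mK xy(2)] by (simp only: hy abs_le_iff power2_minus)
        ultimately have fdiff: "f x - f y \<le> (\<Sum>i\<in>UNIV. 2 * (h i * G i ?m) + 2 * C * (h i)\<^sup>2)"
          by (simp add: sum_negf sum.distrib sum_distrib_left mult.assoc[symmetric])
            (simp add: sum_distrib_left[symmetric] mult.assoc)
        have bound: "\<delta> * (2 * (h i * G i ?m) + 2 * C * (h i)\<^sup>2) - (\<alpha> $ i - 1) * (h i / ?m $ i)\<^sup>2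
            \<le> \<delta>\<^sup>2 * c * (1 / (\<alpha> $ i - 1) * (?m $ i)\<^sup>2 * (G i ?m)\<^sup>2)" for i
        proof -
          define p where "p = (\<alpha> $ i - 1) / (?m $ i)\<^sup>2"
          have mi: "0 < ?m $ i" "?m $ i \<le> u" using K(3,4)[OF mK] by auto
          have p0: "0 < p" unfolding p_def using \<alpha>[of i] mi by (intro divide_pos_pos) auto
          have "a / (u\<^sup>2 + 1) \<le> p"
          proof -
            have "(?m $ i)\<^sup>2 \<le> u\<^sup>2" using mi by (intro power_mono) auto
            then have "(?m $ i)\<^sup>2 \<le> u\<^sup>2 + 1" by simp
            then show ?thesis unfolding p_def using a(1) a(2)[of i] mi by (intro frac_le) auto
          qed
          then have "a * (1 - 1 / c) / (u\<^sup>2 + 1) \<le> p * (1 - 1 / c)"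
            using c mult_right_mono[of "a / (u\<^sup>2 + 1)" p "1 - 1 / c"] by simp
          moreover have "2 * \<delta> * C \<le> a * (1 - 1 / c) / (u\<^sup>2 + 1)"
          proof -
            have "2 * \<delta> * C \<le> 2 * \<delta> * (\<bar>C\<bar> + 1)" using \<delta> by (intro mult_left_mono) auto
            also have "\<dots> \<le> 2 * d * (\<bar>C\<bar> + 1)" using \<delta> by (intro mult_right_mono) auto
            also have "\<dots> = a * (1 - 1 / c) / (u\<^sup>2 + 1)"
            proof -
              have gen: "2 * (z / (2 * k * v)) * k = z / v" if "k \<noteq> 0" for z k v :: real using that by simp
              show ?thesis unfolding d_def by (rule gen) linarith
            qed
            finally show ?thesis .
          qed
          ultimately have "2 * \<delta> * C \<le> p - p / c" by (simp add: algebra_simps)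
          then have 1: "2 * \<delta> * C * (h i)\<^sup>2 \<le> (p - p / c) * (h i)\<^sup>2" by (intro mult_right_mono) auto
          \<comment> \<open>Completing the square in \<open>h i\<close>.\<close>
          have "0 \<le> (\<delta> * c * G i ?m - p * h i)\<^sup>2 / (p * c)" using p0 c by (intro divide_nonneg_pos) auto
          also have "\<dots> = \<delta>\<^sup>2 * c * (G i ?m)\<^sup>2 / p - 2 * \<delta> * (h i * G i ?m) + p / c * (h i)\<^sup>2"
            using p0 c by (simp add: power2_eq_square field_simps)
          finally have 2: "2 * \<delta> * (h i * G i ?m) \<le> \<delta>\<^sup>2 * c * (G i ?m)\<^sup>2 / p + p / c * (h i)\<^sup>2" by simp
          have 3: "(\<alpha> $ i - 1) * (h i / ?m $ i)\<^sup>2 = p * (h i)\<^sup>2" by (simp add: p_def power_divide)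
          have 4: "\<delta>\<^sup>2 * c * (1 / (\<alpha> $ i - 1) * (?m $ i)\<^sup>2 * (G i ?m)\<^sup>2) = \<delta>\<^sup>2 * c * (G i ?m)\<^sup>2 / p"
            by (simp add: p_def)
          show ?thesis using 1 2 unfolding 3 4 by (simp add: algebra_simps)
        qed
        have pm: "(x $ i - y $ i) / (2 * ?m $ i) = h i / ?m $ i" for i by (simp add: h_def)
        have "w x * w y * exp (\<delta> * (f' x - f' y)) = ?W x * ?W y * exp (\<delta> * (f x - f y))"
          using xy by (simp add: w_def f'_def)
        also have "\<dots> \<le> ((?W ?m)\<^sup>2 * exp (- (\<Sum>i\<in>UNIV. (\<alpha> $ i - 1) * (h i / ?m $ i)\<^sup>2))) * exp (\<delta> * (f x - f y))"
          using liouville_weight_midpoint[of x y \<alpha> g] xy K(3) \<alpha> g unfolding pm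
          by (intro mult_right_mono) (auto simp: pos_orthant_def less_imp_le)
        also have "\<dots> = (?W ?m)\<^sup>2 * exp (\<delta> * (f x - f y) - (\<Sum>i\<in>UNIV. (\<alpha> $ i - 1) * (h i / ?m $ i)\<^sup>2))"
        proof -
          have "b * exp (- s) * exp t = b * exp (t - s)" for b s t :: real by (simp add: exp_diff exp_minus field_simps)
          then show ?thesis .
        qed
        also have "\<dots> \<le> (?W ?m)\<^sup>2 * exp (2 * \<delta>\<^sup>2 * (c * q ?m))"
        proof (intro mult_left_mono, subst exp_le_cancel_iff)
          have "\<delta> * (f x - f y) - (\<Sum>i\<in>UNIV. (\<alpha> $ i - 1) * (h i / ?m $ i)\<^sup>2)
            \<le> \<delta> * (\<Sum>i\<in>UNIV. 2 * (h i * G i ?m) + 2 * C * (h i)\<^sup>2) - (\<Sum>i\<in>UNIV. (\<alpha> $ i - 1) * (h i / ?m $ i)\<^sup>2)"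
            using fdiff \<delta> by (intro diff_right_mono mult_left_mono) auto
          also have "\<dots> = (\<Sum>i\<in>UNIV. \<delta> * (2 * (h i * G i ?m) + 2 * C * (h i)\<^sup>2) - (\<alpha> $ i - 1) * (h i / ?m $ i)\<^sup>2)"
            by (simp only: sum_distrib_left sum_subtractf)
          also have "\<dots> \<le> (\<Sum>i\<in>UNIV. \<delta>\<^sup>2 * c * (1 / (\<alpha> $ i - 1) * (?m $ i)\<^sup>2 * (G i ?m)\<^sup>2))"
            by (intro sum_mono bound)
          also have "\<dots> = \<delta>\<^sup>2 * c * S ?m" by (simp only: S_def sum_distrib_left)
          also have "\<dots> = 2 * \<delta>\<^sup>2 * (c * q ?m)" using mK by (simp add: q_def)
          finally show "\<delta> * (f x - f y) - (\<Sum>i\<in>UNIV. (\<alpha> $ i - 1) * (h i / ?m $ i)\<^sup>2) \<le> 2 * \<delta>\<^sup>2 * (c * q ?m)" .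
        qed auto
        also have "\<dots> = (w ?m)\<^sup>2 * exp (2 * \<delta>\<^sup>2 * (c * q ?m))" using mK by (simp add: w_def)
        finally show ?thesis .
      qed
    next
      show "f' \<in> borel_measurable borel" unfolding f'_def by measurable
      show "(\<lambda>x. c * q x) \<in> borel_measurable borel" unfolding q_def by measurable
    qed (use wint d in auto)
    moreover have "(\<integral>x. (c * q x) * w x \<partial>lborel) = c * (\<integral>x. q x * w x \<partial>lborel)"
      "(\<integral>x. 2 * q x * w x \<partial>lborel) = 2 * (\<integral>x. q x * w x \<partial>lborel)" by (simp_all add: mult.assoc)
    ultimately show ?thesis by (simp add: ac_simps)
  qed
  have "((\<lambda>c. c * ((\<integral>x. w x \<partial>lborel) * (\<integral>x. 2 * q x * w x \<partial>lborel)))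
      \<longlongrightarrow> 1 * ((\<integral>x. w x \<partial>lborel) * (\<integral>x. 2 * q x * w x \<partial>lborel))) (at_right 1)"
    by (intro tendsto_intros)
  then have fin: "(\<integral>x. w x \<partial>lborel) * (\<integral>x. (f' x)\<^sup>2 * w x \<partial>lborel) - (\<integral>x. f' x * w x \<partial>lborel)\<^sup>2
    \<le> 1 * ((\<integral>x. w x \<partial>lborel) * (\<integral>x. 2 * q x * w x \<partial>lborel))"
    by (rule tendsto_lowerbound) (use lin in \<open>auto simp: eventually_at_right_field intro!: exI[of _ 2]\<close>)
  have e1: "(f' x)\<^sup>2 * w x = indicator K x *\<^sub>R ((f x)\<^sup>2 * ?W x)" for x
    by (simp add: f'_def w_def indicator_def)
  have e2: "f' x * w x = indicator K x *\<^sub>R (f x * ?W x)" for x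
    by (simp add: f'_def w_def indicator_def)
  have e3: "2 * q x * w x = indicator K x *\<^sub>R (S x * ?W x)" for x
    by (simp add: q_def w_def indicator_def)
  show ?thesis using fin unfolding e1 e2 e3 by (simp add: set_lebesgue_integral_def w_def)
qed

section \<open>Smooth compactly supported kernels\<close>

text \<open>For \<open>p = 1\<close> and \<open>m = 0\<close> this is the classical bump function on the unit interval. The two
parameters make the family closed under differentiation (\<open>bump_has_derivative\<close>), so that smoothness
follows by induction.\<close>

definition bump :: "real poly \<Rightarrow> nat \<Rightarrow> real \<Rightarrow> real" where
  "bump p m t = (if 0 < t \<and> t < 1 then poly p t / (t * (1 - t)) ^ m * exp (- 1 / (t * (1 - t))) else 0)"

text \<open>With \<open>r = t (1 - t)\<close>, the derivative of \<open>p exp (- 1 / r) / r\<^bsup>m\<^esup>\<close> is this polynomial times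
\<open>exp (- 1 / r) / r\<^bsup>m + 2\<^esup>\<close>.\<close>

definition bump_deriv_poly :: "real poly \<Rightarrow> nat \<Rightarrow> real poly" where
  "bump_deriv_poly p m = pderiv p * [:0, 1, -1:]\<^sup>2 - of_nat m * p * [:1, -2:] * [:0, 1, -1:] + p * [:1, -2:]"

lemma power_mult_exp_le: "x ^ n * exp (- x) \<le> real n ^ n" if "0 \<le> x" for x :: real
proof (cases "n = 0")
  case False
  have "x / n \<le> exp (x / n)" using exp_ge_add_one_self[of "x / n"] by linarith
  then have "(x / n) ^ n \<le> exp (x / n) ^ n" using that by (intro power_mono) auto
  also have "\<dots> = exp x" using False by (simp flip: exp_of_nat_mult)
  finally show ?thesis using False by (simp add: exp_minus field_simps power_divide)
qed (use that in simp)

text \<open>The exponential beats every negative power of \<open>t (1 - t)\<close>. Vanishing to second order at both ends is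
what makes the function differentiable there, with derivative zero.\<close>

lemma bump_le_square: "\<exists>C\<ge>0. \<forall>t. \<bar>bump p m t\<bar> \<le> C * (max 0 (t * (1 - t)))\<^sup>2"
proof -
  have "compact (poly p ` {0..1})" by (intro compact_continuous_image continuous_intros) simp
  then obtain B where "\<forall>x\<in>poly p ` {0..1}. norm x \<le> B"
    using compact_imp_bounded bounded_iff by metis
  then have B: "\<And>t. t \<in> {0..1} \<Longrightarrow> \<bar>poly p t\<bar> \<le> B" by auto
  have B0: "0 \<le> B" using B[of 0] by auto
  show ?thesis
  proof (intro exI[of _ "B * real (m + 2) ^ (m + 2)"] conjI allI)
    fix t :: real
    show "\<bar>bump p m t\<bar> \<le> B * real (m + 2) ^ (m + 2) * (max 0 (t * (1 - t)))\<^sup>2"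
    proof (cases "0 < t \<and> t < 1")
      case True
      define r where "r = t * (1 - t)"
      have r: "0 < r" using True by (simp add: r_def)
      have "\<bar>bump p m t\<bar> = \<bar>poly p t\<bar> * ((1 / r) ^ (m + 2) * exp (- (1 / r))) * r\<^sup>2"
        using True r by (simp add: bump_def r_def[symmetric] abs_mult power_divide power_add power2_eq_square)
      also have "\<dots> \<le> B * real (m + 2) ^ (m + 2) * r\<^sup>2"
        using B[of t] True r B0 by (intro mult_right_mono mult_mono power_mult_exp_le) auto
      finally show ?thesis using r by (simp add: r_def max_def)
    qed (use B0 in \<open>auto simp: bump_def\<close>)
  qed (use B0 in simp)
qed

lemma bump_bounded: "\<exists>C\<ge>0. \<forall>t. \<bar>bump p m t\<bar> \<le> C"
proof -
  obtain C where C: "0 \<le> C" "\<And>t. \<bar>bump p m t\<bar> \<le> C * (max 0 (t * (1 - t)))\<^sup>2"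
    using bump_le_square by blast
  have "\<bar>bump p m t\<bar> \<le> C" for t
  proof (cases "0 < t \<and> t < 1")
    case True
    then have "t * (1 - t) \<le> 1 * 1" by (intro mult_mono) auto
    then have "(max 0 (t * (1 - t)))\<^sup>2 \<le> 1\<^sup>2" using True by (intro power_mono) auto
    then show ?thesis using C(1) C(2)[of t] mult_left_mono[of "(max 0 (t * (1 - t)))\<^sup>2" 1 C] by simp
  qed (use C in \<open>auto simp: bump_def\<close>)
  then show ?thesis using C by blast
qed

lemma has_real_derivative_0_if_quadratic:
  fixes f :: "real \<Rightarrow> real"
  assumes "\<And>t. \<bar>f t\<bar> \<le> C * (t - a)\<^sup>2"
  shows "(f has_real_derivative 0) (at a)"
proof -
  have fa: "f a = 0" using assms[of a] by simp
  have "((\<lambda>t. (f t - f a) / (t - a)) \<longlongrightarrow> 0) (at a)"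
  proof (rule Lim_null_comparison)
    show "eventually (\<lambda>t. norm ((f t - f a) / (t - a)) \<le> \<bar>C\<bar> * \<bar>t - a\<bar>) (at a)"
    proof (rule eventually_at_filter[THEN iffD2], rule always_eventually, intro allI impI)
      fix t assume "t \<noteq> a"
      have "\<bar>f t\<bar> \<le> (\<bar>C\<bar> * \<bar>t - a\<bar>) * \<bar>t - a\<bar>"
        by (rule order_trans[OF assms]) (simp add: power2_eq_square mult.assoc abs_mult_self_eq mult_right_mono)
      then show "norm ((f t - f a) / (t - a)) \<le> \<bar>C\<bar> * \<bar>t - a\<bar>"
        using \<open>t \<noteq> a\<close> by (simp add: fa divide_le_eq)
    qed
    show "((\<lambda>t. \<bar>C\<bar> * \<bar>t - a\<bar>) \<longlongrightarrow> 0) (at a)" by (auto intro!: tendsto_eq_intros)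
  qed
  then show ?thesis by (simp add: has_field_derivative_iff)
qed

lemma bump_has_derivative:
  "(bump p m has_real_derivative bump (bump_deriv_poly p m) (m + 2) t) (at t)"
proof (cases "0 < t \<and> t < 1")
  case True
  define r where "r = t * (1 - t)"
  have r: "0 < r" using True by (simp add: r_def)
  have "((\<lambda>t. poly p t / (t * (1 - t)) ^ m * exp (- 1 / (t * (1 - t)))) has_real_derivative
     bump (bump_deriv_poly p m) (m + 2) t) (at t)"
  proof -
    have "((\<lambda>t. poly p t * (inverse (t * (1 - t))) ^ m * exp (- inverse (t * (1 - t)))) has_real_derivative
      poly (pderiv p) t * inverse r ^ m * exp (- inverse r)
      + poly p t * (of_nat m * inverse r ^ (m - 1) * (- (1 - 2 * t) * (inverse r)\<^sup>2)) * exp (- inverse r)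
      + poly p t * inverse r ^ m * ((1 - 2 * t) * (inverse r)\<^sup>2 * exp (- inverse r))) (at t)"
      using True unfolding r_def
      by (auto intro!: derivative_eq_intros poly_DERIV simp: power2_eq_square algebra_simps)
    also have "poly (pderiv p) t * inverse r ^ m * exp (- inverse r)
      + poly p t * (of_nat m * inverse r ^ (m - 1) * (- (1 - 2 * t) * (inverse r)\<^sup>2)) * exp (- inverse r)
      + poly p t * inverse r ^ m * ((1 - 2 * t) * (inverse r)\<^sup>2 * exp (- inverse r))
      = bump (bump_deriv_poly p m) (m + 2) t"
    proof -
      have "poly (bump_deriv_poly p m) t
        = poly (pderiv p) t * r\<^sup>2 - of_nat m * poly p t * (1 - 2 * t) * r + poly p t * (1 - 2 * t)"
        by (simp add: bump_deriv_poly_def r_def algebra_simps)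
      moreover have "bump (bump_deriv_poly p m) (m + 2) t
        = poly (bump_deriv_poly p m) t * inverse r ^ (m + 2) * exp (- inverse r)"
        using True by (simp add: bump_def r_def[symmetric] divide_inverse power_inverse)
      ultimately have "bump (bump_deriv_poly p m) (m + 2) t =
        (poly (pderiv p) t * r\<^sup>2 - of_nat m * poly p t * (1 - 2 * t) * r + poly p t * (1 - 2 * t))
          * inverse r ^ (m + 2) * exp (- inverse r)"
        by (simp only:)
      also have "\<dots> = poly (pderiv p) t * (r\<^sup>2 * inverse r ^ (m + 2)) * exp (- inverse r)
         + poly p t * (1 - 2 * t) * exp (- inverse r) * inverse r ^ (m + 2)
         - poly p t * (1 - 2 * t) * exp (- inverse r) * (of_nat m * (r * inverse r ^ (m + 2)))"
        by (simp add: algebra_simps)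
      also have "r\<^sup>2 * inverse r ^ (m + 2) = inverse r ^ m"
        using r by (simp add: power_add power2_eq_square field_simps)
      also have "of_nat m * (r * inverse r ^ (m + 2)) = of_nat m * (inverse r ^ (m - 1) * (inverse r)\<^sup>2)"
        using r by (cases m) (simp_all add: power2_eq_square)
      finally show ?thesis by (simp add: algebra_simps power2_eq_square)
    qed
    finally show ?thesis by (simp add: field_simps)
  qed
  then show ?thesis
  proof (rule has_field_derivative_transform_within_open[where S="{0<..<1}"])
  qed (use True in \<open>auto simp: bump_def\<close>)
next
  case False
  obtain C where C: "0 \<le> C" "\<And>s. \<bar>bump p m s\<bar> \<le> C * (max 0 (s * (1 - s)))\<^sup>2"
    using bump_le_square by blast
  have "\<bar>bump p m s\<bar> \<le> C * (s - t)\<^sup>2" for s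
  proof (cases "0 < s \<and> s < 1")
    case True
    have "s * (1 - s) \<le> s" "s * (1 - s) \<le> 1 - s"
      using True mult_mono[of s s "1 - s" 1] mult_mono[of s 1 "1 - s" "1 - s"] by auto
    moreover have "t \<le> 0 \<or> 1 \<le> t" using False by auto
    ultimately have "s * (1 - s) \<le> \<bar>s - t\<bar>" by linarith
    moreover have "0 < s * (1 - s)" using True by simp
    ultimately have "(max 0 (s * (1 - s)))\<^sup>2 \<le> \<bar>s - t\<bar>\<^sup>2" by (intro power_mono) auto
    then show ?thesis using C(2)[of s] mult_left_mono[OF _ C(1)] by (fastforce intro: order_trans)
  qed (use C in \<open>auto simp: bump_def\<close>)
  then have "(bump p m has_real_derivative 0) (at t)" by (rule has_real_derivative_0_if_quadratic)
  then show ?thesis using False by (auto simp: bump_def)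
qed

definition bump_prod :: "('n \<Rightarrow> real poly) \<Rightarrow> ('n \<Rightarrow> nat) \<Rightarrow> real \<Rightarrow> real^'n::finite \<Rightarrow> real" where
  "bump_prod p m \<epsilon> z = (\<Prod>i\<in>UNIV. bump (p i) (m i) (z $ i / \<epsilon>))"

definition bump_prod_partial :: "'n \<Rightarrow> ('n \<Rightarrow> real poly) \<Rightarrow> ('n \<Rightarrow> nat) \<Rightarrow> real \<Rightarrow> real^'n::finite \<Rightarrow> real" where
  "bump_prod_partial i p m \<epsilon> z =
     1 / \<epsilon> * bump_prod (p(i := bump_deriv_poly (p i) (m i))) (m(i := m i + 2)) \<epsilon> z"

lemma bump_prod_has_derivative:
  fixes p :: "'n::finite \<Rightarrow> real poly" and x :: "real^'n"
  shows
  "((\<lambda>z. bump_prod p m \<epsilon> (z - x)) has_derivative (\<lambda>h. \<Sum>i\<in>UNIV. h $ i * bump_prod_partial i p m \<epsilon> (z - x))) (at z)"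
proof -
  have 1: "((\<lambda>z. bump (p i) (m i) ((z - x) $ i / \<epsilon>)) has_derivative
     (\<lambda>h. h $ i / \<epsilon> * bump (bump_deriv_poly (p i) (m i)) (m i + 2) ((z - x) $ i / \<epsilon>))) (at z)" for i
  proof -
    have "((\<lambda>z. (z - x) $ i / \<epsilon>) has_derivative (\<lambda>h. h $ i / \<epsilon>)) (at z)"
      unfolding vector_minus_component divide_inverse
      by (auto intro!: derivative_eq_intros bounded_linear.has_derivative[OF bounded_linear_vec_nth])
    from has_derivative_compose[OF this bump_has_derivative[unfolded has_field_derivative_def]]
    show ?thesis by (simp add: mult.commute)
  qed
  have "(\<Prod>j\<in>UNIV - {i}. bump (p j) (m j) ((z - x) $ j / \<epsilon>))
      * bump (bump_deriv_poly (p i) (m i)) (m i + 2) ((z - x) $ i / \<epsilon>)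
    = bump_prod (p(i := bump_deriv_poly (p i) (m i))) (m(i := m i + 2)) \<epsilon> (z - x)" for i
    unfolding bump_prod_def by (subst (2) prod.remove[of _ i]) (auto intro!: prod.cong)
  then have 2: "(h $ i / \<epsilon> * bump (bump_deriv_poly (p i) (m i)) (m i + 2) ((z - x) $ i / \<epsilon>))
      * (\<Prod>j\<in>UNIV - {i}. bump (p j) (m j) ((z - x) $ j / \<epsilon>))
    = h $ i * bump_prod_partial i p m \<epsilon> (z - x)" for i and h :: "real^'n"
    by (simp add: bump_prod_partial_def mult.assoc mult.commute)
  show ?thesis
  proof -
    have "((\<lambda>z. \<Prod>i\<in>UNIV. bump (p i) (m i) ((z - x) $ i / \<epsilon>)) has_derivative
      (\<lambda>h. \<Sum>i\<in>UNIV. (h $ i / \<epsilon> * bump (bump_deriv_poly (p i) (m i)) (m i + 2) ((z - x) $ i / \<epsilon>))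
        * (\<Prod>j\<in>UNIV - {i}. bump (p j) (m j) ((z - x) $ j / \<epsilon>)))) (at z)"
      by (intro has_derivative_prod 1)
    then show ?thesis unfolding bump_prod_def[of p m \<epsilon>] by (simp only: 2)
  qed
qed

lemma pderiv_at_bump_prod:
  "pderiv_at i (\<lambda>z. c * bump_prod p m \<epsilon> (z - x)) z = c * bump_prod_partial i p m \<epsilon> (z - x)"
proof -
  have "((\<lambda>z. c * bump_prod p m \<epsilon> (z - x)) has_derivative
    (\<lambda>h. c * (\<Sum>i\<in>UNIV. h $ i * bump_prod_partial i p m \<epsilon> (z - x)))) (at z)"
    by (intro has_derivative_mult_right bump_prod_has_derivative)
  then have "pderiv_at i (\<lambda>z. c * bump_prod p m \<epsilon> (z - x)) z
    = c * (\<Sum>j\<in>UNIV. axis i 1 $ j * bump_prod_partial j p m \<epsilon> (z - x))"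
    unfolding pderiv_at_def by (simp only: frechet_derivative_at[symmetric])
  also have "(\<Sum>j\<in>UNIV. axis i 1 $ j * bump_prod_partial j p m \<epsilon> (z - x))
    = (\<Sum>j\<in>UNIV. if j = i then bump_prod_partial j p m \<epsilon> (z - x) else 0)"
    by (intro sum.cong) (auto simp: axis_def)
  finally show ?thesis by simp
qed

lemma continuous_on_bump_prod: "continuous_on A (\<lambda>z. bump_prod p m \<epsilon> (z - x))"
  using bump_prod_has_derivative has_derivative_continuous
  by (blast intro: continuous_at_imp_continuous_on)

text \<open>The partial derivatives of a product of bump functions are products of the same kind, with one
polynomial and one exponent changed. Hence the induction is over all parameters.\<close>

lemma C_k_bump_prod: "C_k k (\<lambda>z. c * bump_prod p m \<epsilon> (z - x))"
proof (induction k arbitrary: c p m)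
  case 0
  show ?case by (simp add: continuous_on_bump_prod continuous_on_mult_left)
next
  case (Suc k)
  have "(\<lambda>z. c * bump_prod p m \<epsilon> (z - x)) differentiable (at z)" for z
    unfolding differentiable_def using has_derivative_mult_right[OF bump_prod_has_derivative] by blast
  moreover have "C_k k (pderiv_at i (\<lambda>z. c * bump_prod p m \<epsilon> (z - x)))" for i
    using Suc[of "c * (1 / \<epsilon>)"] unfolding pderiv_at_bump_prod[abs_def] bump_prod_partial_def
    by (simp only: mult.assoc)
  ultimately show ?case by simp
qed

lemma bump_prod_bounded: "\<exists>C\<ge>0. \<forall>z. \<bar>bump_prod p m \<epsilon> z\<bar> \<le> C"
proof -
  have "\<forall>i. \<exists>C\<ge>0. \<forall>t. \<bar>bump (p i) (m i) t\<bar> \<le> C" using bump_bounded by blast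
  then obtain C where C: "\<And>i. 0 \<le> C i" "\<And>i t. \<bar>bump (p i) (m i) t\<bar> \<le> C i" by metis
  show ?thesis
    unfolding bump_prod_def abs_prod using C
    by (intro exI[of _ "\<Prod>i\<in>UNIV. C i"] conjI allI prod_mono prod_nonneg) auto
qed

lemma norm_power2_vec: "(norm h)\<^sup>2 = (\<Sum>i\<in>UNIV. (h $ i)\<^sup>2)" for h :: "real^'n::finite"
  unfolding power2_norm_eq_inner inner_vec_def by (simp add: power2_eq_square)

lemma onorm_sum_components_le:
  fixes c :: "'n::finite \<Rightarrow> real"
  shows "onorm (\<lambda>h::real^'n. \<Sum>i\<in>UNIV. h $ i * c i) \<le> (\<Sum>i\<in>UNIV. \<bar>c i\<bar>)"
proof (rule onorm_bound)
  fix h :: "real^'n"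
  have "norm (\<Sum>i\<in>UNIV. h $ i * c i) \<le> (\<Sum>i\<in>UNIV. norm (h $ i * c i))" by (rule norm_sum)
  also have "\<dots> \<le> (\<Sum>i\<in>UNIV. \<bar>c i\<bar> * norm h)"
    using component_le_norm_cart[of h]
    by (intro sum_mono) (simp add: abs_mult mult.commute[of "\<bar>h $ _\<bar>"] mult_left_mono)
  finally show "norm (\<Sum>i\<in>UNIV. h $ i * c i) \<le> (\<Sum>i\<in>UNIV. \<bar>c i\<bar>) * norm h" by (simp add: sum_distrib_right)
qed (auto intro: sum_nonneg)

text \<open>The partial derivatives are Lipschitz continuous because their own partial derivatives are again
products of bump functions, and therefore bounded.\<close>

lemma bump_prod_taylor:
  fixes p :: "'n::finite \<Rightarrow> real poly"
  shows "\<exists>C\<ge>0. \<forall>z h. \<bar>bump_prod p m \<epsilon> (z + h) - bump_prod p m \<epsilon> z - (\<Sum>i\<in>UNIV. h $ i * bump_prod_partial i p m \<epsilon> z)\<bar>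
    \<le> C * (\<Sum>i\<in>UNIV. (h $ i)\<^sup>2)"
proof -
  let ?P = "\<lambda>i. bump_prod_partial i p m \<epsilon>"
  have "\<exists>L\<ge>0. \<forall>y z. \<bar>?P i y - ?P i z\<bar> \<le> L * norm (y - z)" for i
  proof -
    let ?p = "p(i := bump_deriv_poly (p i) (m i))" and ?m = "m(i := m i + 2)"
    have "\<forall>j. \<exists>C\<ge>0. \<forall>z. \<bar>1 / \<epsilon> * bump_prod_partial j ?p ?m \<epsilon> z\<bar> \<le> C"
    proof
      fix j
      obtain C where "0 \<le> C" "\<And>z. \<bar>bump_prod (?p(j := bump_deriv_poly (?p j) (?m j))) (?m(j := ?m j + 2)) \<epsilon> z\<bar> \<le> C"
        using bump_prod_bounded by blast
      then show "\<exists>C\<ge>0. \<forall>z. \<bar>1 / \<epsilon> * bump_prod_partial j ?p ?m \<epsilon> z\<bar> \<le> C"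
        unfolding bump_prod_partial_def mult.assoc[symmetric]
        by (intro exI[of _ "\<bar>1 / \<epsilon> * (1 / \<epsilon>)\<bar> * C"]) (auto simp: abs_mult intro!: mult_left_mono divide_right_mono)
    qed
    then obtain C where C: "\<And>j. 0 \<le> C j" "\<And>j z. \<bar>1 / \<epsilon> * bump_prod_partial j ?p ?m \<epsilon> z\<bar> \<le> C j" by metis
    have der: "(?P i has_derivative (\<lambda>h. \<Sum>j\<in>UNIV. h $ j * (1 / \<epsilon> * bump_prod_partial j ?p ?m \<epsilon> z))) (at z)" for z
      using has_derivative_mult_right[OF bump_prod_has_derivative[of ?p ?m \<epsilon> 0 z], of "1 / \<epsilon>"]
      by (simp add: bump_prod_partial_def[of i, abs_def] sum_distrib_left mult.left_commute)
    have "norm (?P i y - ?P i z) \<le> (\<Sum>j\<in>UNIV. C j) * norm (y - z)" for y z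
    proof (rule differentiable_bound[of UNIV])
      fix x :: "real^'n"
      show "(?P i has_derivative (\<lambda>h. \<Sum>j\<in>UNIV. h $ j * (1 / \<epsilon> * bump_prod_partial j ?p ?m \<epsilon> x))) (at x within UNIV)"
        using der by simp
      show "onorm (\<lambda>h. \<Sum>j\<in>UNIV. h $ j * (1 / \<epsilon> * bump_prod_partial j ?p ?m \<epsilon> x)) \<le> (\<Sum>j\<in>UNIV. C j)"
        by (rule order_trans[OF onorm_sum_components_le sum_mono]) (rule C(2))
    qed auto
    then show ?thesis using C(1) by (intro exI[of _ "\<Sum>j\<in>UNIV. C j"]) (auto intro: sum_nonneg)
  qed
  then obtain L where L: "\<And>i. 0 \<le> L i" "\<And>i y z. \<bar>?P i y - ?P i z\<bar> \<le> L i * norm (y - z)" by metis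
  define C where "C = (\<Sum>i\<in>UNIV. L i)"
  have "\<bar>bump_prod p m \<epsilon> (z + h) - bump_prod p m \<epsilon> z - (\<Sum>i\<in>UNIV. h $ i * ?P i z)\<bar> \<le> C * (\<Sum>i\<in>UNIV. (h $ i)\<^sup>2)" for z h
  proof -
    let ?S = "cball z (norm h)"
    have "norm (bump_prod p m \<epsilon> (z + h) - bump_prod p m \<epsilon> z - (\<lambda>k. \<Sum>i\<in>UNIV. k $ i * ?P i z) (z + h - z))
        \<le> norm (z + h - z) * (C * norm h)"
    proof (rule differentiable_bound_linearization[where S="?S" and f'="\<lambda>x k. \<Sum>i\<in>UNIV. k $ i * ?P i x"])
      fix t :: real assume "t \<in> {0..1}"
      then show "z + t *\<^sub>R (z + h - z) \<in> ?S" by (auto simp: dist_norm intro!: mult_left_le_one_le)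
    next
      fix x assume "x \<in> ?S"
      show "(bump_prod p m \<epsilon> has_derivative (\<lambda>k. \<Sum>i\<in>UNIV. k $ i * ?P i x)) (at x within ?S)"
        using bump_prod_has_derivative[of p m \<epsilon> 0 x] by (auto intro: has_derivative_at_withinI)
      have "onorm ((\<lambda>k. \<Sum>i\<in>UNIV. k $ i * ?P i x) - (\<lambda>k. \<Sum>i\<in>UNIV. k $ i * ?P i z))
        = onorm (\<lambda>k::real^'n. \<Sum>i\<in>UNIV. k $ i * (?P i x - ?P i z))"
        by (simp add: fun_diff_def right_diff_distrib sum_subtractf)
      also have "\<dots> \<le> (\<Sum>i\<in>UNIV. \<bar>?P i x - ?P i z\<bar>)" by (rule onorm_sum_components_le)
      also have "\<dots> \<le> (\<Sum>i\<in>UNIV. L i * norm h)"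
      proof (intro sum_mono)
        fix i
        show "\<bar>?P i x - ?P i z\<bar> \<le> L i * norm h"
          using \<open>x \<in> ?S\<close> by (intro order_trans[OF L(2)] mult_left_mono L(1)) (simp add: dist_norm norm_minus_commute)
      qed
      also have "\<dots> = C * norm h" by (simp add: C_def sum_distrib_right)
      finally show "onorm ((\<lambda>k. \<Sum>i\<in>UNIV. k $ i * ?P i x) - (\<lambda>k. \<Sum>i\<in>UNIV. k $ i * ?P i z)) \<le> C * norm h" .
    qed simp
    then show ?thesis unfolding norm_power2_vec[symmetric] by (simp add: power2_eq_square mult.left_commute)
  qed
  moreover have "0 \<le> C" using L(1) by (simp add: C_def sum_nonneg)
  ultimately show ?thesis by blast
qed

section \<open>Mollification\<close>

text \<open>The kernel lives on the cube \<open>[0, \<epsilon>]\<^sup>n\<close>, not on a cube centred at the origin. The mollification at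
\<open>x\<close> thus only sees points that are coordinatewise at least \<open>x\<close>, and it never reaches across the
boundary of the orthant.\<close>

abbreviation kernel :: "real \<Rightarrow> real^'n::finite \<Rightarrow> real" where
  "kernel \<equiv> bump_prod (\<lambda>_. 1) (\<lambda>_. 0)"

abbreviation kernel_partial :: "'n \<Rightarrow> real \<Rightarrow> real^'n::finite \<Rightarrow> real" where
  "kernel_partial i \<equiv> bump_prod_partial i (\<lambda>_. 1) (\<lambda>_. 0)"

text \<open>The normalizing constant depends on the dimension, which is passed as a type.\<close>

definition kernel_mass :: "'n::finite itself \<Rightarrow> real \<Rightarrow> real" where
  "kernel_mass _ \<epsilon> = (\<integral>z. kernel \<epsilon> z \<partial>(lborel :: (real^'n) measure))"

definition mollify :: "real \<Rightarrow> (real^'n::finite \<Rightarrow> real) \<Rightarrow> real^'n \<Rightarrow> real" where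
  "mollify \<epsilon> u x = (\<integral>z. u z * kernel \<epsilon> (z - x) \<partial>lborel) / kernel_mass TYPE('n) \<epsilon>"

lemma bump_prod_eq_0:
  fixes z :: "real^'n::finite"
  assumes "0 < \<epsilon>" "z \<notin> cbox 0 (\<chi> i. \<epsilon>)"
  shows "bump_prod p m \<epsilon> z = 0"
proof -
  obtain i where "z $ i < 0 \<or> \<epsilon> < z $ i" using assms(2) by (auto simp: mem_box_cart not_le)
  then have "bump (p i) (m i) (z $ i / \<epsilon>) = 0" using assms(1) by (auto simp: bump_def field_simps)
  then show ?thesis unfolding bump_prod_def by (intro prod_zero) auto
qed

lemma borel_measurable_bump_prod [measurable]: "bump_prod p m \<epsilon> \<in> borel_measurable borel"
  using continuous_on_bump_prod[of UNIV p m \<epsilon> 0] by (simp add: borel_measurable_continuous_onI)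

lemma borel_measurable_bump_prod_partial [measurable]: "bump_prod_partial i p m \<epsilon> \<in> borel_measurable borel"
  unfolding bump_prod_partial_def[abs_def] by measurable

lemma kernel_nonneg: "0 \<le> kernel \<epsilon> z"
  unfolding bump_prod_def bump_def by (intro prod_nonneg) auto

lemma integrable_kernel:
  assumes "0 < \<epsilon>"
  shows "integrable lborel (kernel \<epsilon> :: real^'n::finite \<Rightarrow> real)"
proof -
  have "integrable lborel (\<lambda>z. indicator (cbox 0 (\<chi> i. \<epsilon>)) z *\<^sub>R kernel \<epsilon> (z :: real^'n))"
    using continuous_on_bump_prod[of "cbox 0 (\<chi> i. \<epsilon>)" _ _ \<epsilon> 0]
    by (intro borel_integrable_compact) auto
  also have "(\<lambda>z. indicator (cbox 0 (\<chi> i. \<epsilon>)) z *\<^sub>R kernel \<epsilon> (z :: real^'n)) = kernel \<epsilon>"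
    by (rule ext) (auto simp: indicator_def intro!: bump_prod_eq_0[OF assms])
  finally show ?thesis .
qed

lemma not_AE_notin_cube:
  assumes "0 < \<epsilon>"
  shows "\<not> (AE z in lborel. z \<notin> box 0 ((\<chi> i. \<epsilon>) :: real^'n::finite))"
proof
  assume "AE z in lborel. z \<notin> box 0 ((\<chi> i. \<epsilon>) :: real^'n)"
  then have "emeasure lborel (box 0 ((\<chi> i. \<epsilon>) :: real^'n)) = 0"
    by (subst (asm) AE_iff_measurable[where N="box 0 (\<chi> i. \<epsilon>)"]) auto
  then have "negligible (box 0 ((\<chi> i. \<epsilon>) :: real^'n))"
    by (simp add: negligible_iff_null_sets null_sets_completionI null_sets_def)
  moreover have "(\<chi> i. \<epsilon> / 2) \<in> box 0 ((\<chi> i. \<epsilon>) :: real^'n)" using assms by (simp add: mem_box_cart)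
  ultimately show False using open_not_negligible[OF open_box] by blast
qed

lemma kernel_mass_pos:
  assumes "0 < \<epsilon>"
  shows "0 < kernel_mass TYPE('n::finite) \<epsilon>"
proof -
  have "kernel_mass TYPE('n) \<epsilon> \<noteq> 0"
  proof
    assume "kernel_mass TYPE('n) \<epsilon> = 0"
    then have "AE z in lborel. kernel \<epsilon> (z :: real^'n) = 0"
      using integral_nonneg_eq_0_iff_AE[OF integrable_kernel[OF assms]] kernel_nonneg
      by (auto simp: kernel_mass_def)
    moreover have "kernel \<epsilon> z > 0" if "z \<in> box 0 (\<chi> i. \<epsilon>)" for z :: "real^'n"
      using that assms unfolding bump_prod_def bump_def by (intro prod_pos) (auto simp: mem_box_cart)
    ultimately have "AE z in lborel. z \<notin> box 0 ((\<chi> i. \<epsilon>) :: real^'n)" by (metis (mono_tags, lifting) eventually_mono less_irrefl)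
    then show False using not_AE_notin_cube[OF assms] by blast
  qed
  moreover have "0 \<le> kernel_mass TYPE('n) \<epsilon>"
    unfolding kernel_mass_def using kernel_nonneg by (intro Bochner_Integration.integral_nonneg) auto
  ultimately show ?thesis by simp
qed

lemma nn_integral_lborel_reflect:
  fixes f :: "real^'n::finite \<Rightarrow> ennreal"
  assumes [measurable]: "f \<in> borel_measurable borel"
  shows "(\<integral>\<^sup>+x. f (t - x) \<partial>lborel) = (\<integral>\<^sup>+x. f x \<partial>lborel)"
    and "(\<integral>\<^sup>+x. f (x - t) \<partial>lborel) = (\<integral>\<^sup>+x. f x \<partial>lborel)"
proof -
  have "(\<integral>\<^sup>+x. f x \<partial>lborel) = (\<integral>\<^sup>+x. f x \<partial>(density (distr lborel borel (\<lambda>x. t + (-1) *\<^sub>R x)) (\<lambda>_. \<bar>-1::real\<bar> ^ DIM(real^'n))))"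
    using lborel_affine[of "-1::real" t] by (simp only: )
  then show "(\<integral>\<^sup>+x. f (t - x) \<partial>lborel) = (\<integral>\<^sup>+x. f x \<partial>lborel)"
    by (simp add: nn_integral_density nn_integral_distr)
  have "(\<integral>\<^sup>+x. f x \<partial>lborel) = (\<integral>\<^sup>+x. f x \<partial>(distr lborel borel ((+) (- t))))"
    by (simp only: lborel_distr_plus)
  then show "(\<integral>\<^sup>+x. f (x - t) \<partial>lborel) = (\<integral>\<^sup>+x. f x \<partial>lborel)"
    by (simp add: nn_integral_distr)
qed

lemma nn_integral_kernel:
  fixes z :: "real^'n::finite"
  assumes "0 < \<epsilon>"
  shows "(\<integral>\<^sup>+x. ennreal (kernel \<epsilon> (z - x)) \<partial>lborel) = ennreal (kernel_mass TYPE('n) \<epsilon>)"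
    and "(\<integral>\<^sup>+x. ennreal (kernel \<epsilon> (x - z)) \<partial>lborel) = ennreal (kernel_mass TYPE('n) \<epsilon>)"
  using nn_integral_lborel_reflect[of "\<lambda>x. ennreal (kernel \<epsilon> x)" z]
    nn_integral_eq_integral[OF integrable_kernel[OF assms, where 'n='n]]
  by (auto simp: kernel_mass_def kernel_nonneg)

lemma integrable_mult_bump_prod:
  fixes u :: "real^'n::finite \<Rightarrow> real"
  assumes "integrable lborel u"
  shows "integrable lborel (\<lambda>z. u z * bump_prod p m \<epsilon> (z - x))"
proof -
  obtain C where C: "0 \<le> C" "\<And>z :: real^'n. \<bar>bump_prod p m \<epsilon> z\<bar> \<le> C" using bump_prod_bounded by blast
  note [measurable] = borel_measurable_integrable[OF assms]
  show ?thesis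
    by (rule Bochner_Integration.integrable_bound[of _ "\<lambda>z. C * u z"])
       (use assms C in \<open>auto simp: abs_mult mult.commute[of C] intro!: mult_left_mono\<close>)
qed

lemma borel_measurable_mollify [measurable]:
  assumes [measurable]: "u \<in> borel_measurable borel"
  shows "mollify \<epsilon> u \<in> borel_measurable borel"
  unfolding mollify_def[abs_def] by measurable

lemma mollify_bounded:
  fixes u :: "real^'n::finite \<Rightarrow> real"
  assumes "integrable lborel u"
  shows "\<exists>B. \<forall>x. \<bar>mollify \<epsilon> u x\<bar> \<le> B"
proof -
  obtain C where C: "0 \<le> C" "\<And>z :: real^'n. \<bar>kernel \<epsilon> z\<bar> \<le> C" using bump_prod_bounded by blast
  have "\<bar>\<integral>z. u z * kernel \<epsilon> (z - x) \<partial>lborel\<bar> \<le> (\<integral>z. C * \<bar>u z\<bar> \<partial>lborel)" for x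
    using assms C integrable_mult_bump_prod[OF assms]
    by (intro integral_abs_bound[THEN order_trans] integral_mono integrable_abs)
       (auto simp: abs_mult mult.commute[of C] intro!: mult_left_mono)
  then show ?thesis
    unfolding mollify_def abs_divide
    by (intro exI[of _ "(\<integral>z. C * \<bar>u z\<bar> \<partial>lborel) / \<bar>kernel_mass TYPE('n) \<epsilon>\<bar>"] allI divide_right_mono) auto
qed

text \<open>Integrating the Taylor bound of the kernel against \<open>u\<close> transfers it to the mollification, whatever
the regularity of \<open>u\<close>. The gradient carries a minus sign since \<open>x\<close> enters the kernel through \<open>z - x\<close>.\<close>

lemma mollify_taylor:
  fixes u :: "real^'n::finite \<Rightarrow> real"
  assumes u: "integrable lborel u"
  shows "\<exists>C. \<forall>x y. \<bar>mollify \<epsilon> u y - mollify \<epsilon> u x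
      - (\<Sum>i\<in>UNIV. (y $ i - x $ i) * (- (\<integral>z. u z * kernel_partial i \<epsilon> (z - x) \<partial>lborel) / kernel_mass TYPE('n) \<epsilon>))\<bar>
    \<le> C * (\<Sum>i\<in>UNIV. (y $ i - x $ i)\<^sup>2)"
proof -
  let ?N = "kernel_mass TYPE('n) \<epsilon>"
  obtain C where C: "0 \<le> C" "\<And>z h :: real^'n. \<bar>kernel \<epsilon> (z + h) - kernel \<epsilon> z - (\<Sum>i\<in>UNIV. h $ i * kernel_partial i \<epsilon> z)\<bar>
    \<le> C * (\<Sum>i\<in>UNIV. (h $ i)\<^sup>2)" using bump_prod_taylor by blast
  note iu = integrable_mult_bump_prod[OF u]
  have ip: "integrable lborel (\<lambda>z. u z * kernel_partial i \<epsilon> (z - x))" for i x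
    unfolding bump_prod_partial_def using integrable_mult_right[OF iu, of "1 / \<epsilon>"] by (simp only: mult.left_commute)
  have "\<bar>mollify \<epsilon> u y - mollify \<epsilon> u x
      - (\<Sum>i\<in>UNIV. (y $ i - x $ i) * (- (\<integral>z. u z * kernel_partial i \<epsilon> (z - x) \<partial>lborel) / ?N))\<bar>
    \<le> ((\<integral>z. \<bar>u z\<bar> \<partial>lborel) * C / \<bar>?N\<bar>) * (\<Sum>i\<in>UNIV. (y $ i - x $ i)\<^sup>2)" for x y
  proof -
    let ?R = "\<lambda>z. u z * kernel \<epsilon> (z - y) - u z * kernel \<epsilon> (z - x) - (\<Sum>i\<in>UNIV. (x $ i - y $ i) * (u z * kernel_partial i \<epsilon> (z - x)))"
    have R: "\<bar>?R z\<bar> \<le> C * (\<Sum>i\<in>UNIV. (y $ i - x $ i)\<^sup>2) * \<bar>u z\<bar>" for z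
    proof -
      have "?R z = u z * (kernel \<epsilon> ((z - x) + (x - y)) - kernel \<epsilon> (z - x)
          - (\<Sum>i\<in>UNIV. (x - y) $ i * kernel_partial i \<epsilon> (z - x)))"
        by (simp add: right_diff_distrib sum_distrib_left mult.left_commute)
      also have "\<bar>\<dots>\<bar> \<le> \<bar>u z\<bar> * (C * (\<Sum>i\<in>UNIV. ((x - y) $ i)\<^sup>2))"
        unfolding abs_mult by (intro mult_left_mono C) auto
      also have "(\<Sum>i\<in>UNIV. ((x - y) $ i)\<^sup>2) = (\<Sum>i\<in>UNIV. (y $ i - x $ i)\<^sup>2)"
        by (simp add: power2_commute)
      finally show ?thesis by (simp add: mult.commute)
    qed
    have iR: "integrable lborel ?R"
      by (intro Bochner_Integration.integrable_diff Bochner_Integration.integrable_sum integrable_mult_right iu ip)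
    have "mollify \<epsilon> u y - mollify \<epsilon> u x
      - (\<Sum>i\<in>UNIV. (y $ i - x $ i) * (- (\<integral>z. u z * kernel_partial i \<epsilon> (z - x) \<partial>lborel) / ?N))
      = ((\<integral>z. u z * kernel \<epsilon> (z - y) \<partial>lborel) - (\<integral>z. u z * kernel \<epsilon> (z - x) \<partial>lborel)
        - (\<Sum>i\<in>UNIV. (x $ i - y $ i) * (\<integral>z. u z * kernel_partial i \<epsilon> (z - x) \<partial>lborel))) / ?N"
      unfolding mollify_def
      by (simp add: diff_divide_distrib sum_divide_distrib left_diff_distrib sum_subtractf)
    also have "\<dots> = (\<integral>z. ?R z \<partial>lborel) / ?N"
      using iu ip by (simp add: Bochner_Integration.integrable_sum)
    also have "\<bar>\<dots>\<bar> \<le> (\<integral>z. C * (\<Sum>i\<in>UNIV. (y $ i - x $ i)\<^sup>2) * \<bar>u z\<bar> \<partial>lborel) / \<bar>?N\<bar>"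
      unfolding abs_divide using iR u R
      by (intro divide_right_mono integral_abs_bound[THEN order_trans] integral_mono integrable_abs integrable_mult_right) auto
    also have "\<dots> = ((\<integral>z. \<bar>u z\<bar> \<partial>lborel) * C / \<bar>?N\<bar>) * (\<Sum>i\<in>UNIV. (y $ i - x $ i)\<^sup>2)"
      by (simp add: mult.commute mult.left_commute)
    finally show ?thesis .
  qed
  then show ?thesis by blast
qed

text \<open>As a function of \<open>z\<close>, the kernel \<open>kernel \<epsilon> (z - x)\<close> is a test function with support in \<open>K\<close>, so the
definition of the weak derivative moves the derivative from the kernel to \<open>f\<close>. Together with
\<open>mollify_taylor\<close>, the classical gradient of the mollification is the mollified weak gradient.\<close>

lemma mollify_weak_pderiv:
  fixes f h :: "real^'n::finite \<Rightarrow> real"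
  assumes wd: "has_weak_pderiv_on f i h \<Omega>" and \<epsilon>: "0 < \<epsilon>"
    and K: "K \<subseteq> \<Omega>" "cbox x (x + (\<chi> i. \<epsilon>)) \<subseteq> K"
  shows "- (\<integral>z. indicator K z * f z * kernel_partial i \<epsilon> (z - x) \<partial>lborel) / kernel_mass TYPE('n) \<epsilon>
    = mollify \<epsilon> (\<lambda>z. indicator K z * h z) x"
proof -
  let ?\<phi> = "\<lambda>z. 1 * kernel \<epsilon> (z - x)"
  have shift: "z \<in> cbox x (x + (\<chi> i. \<epsilon>)) \<longleftrightarrow> z - x \<in> cbox 0 (\<chi> i. \<epsilon>)" for z
    by (auto simp: mem_box_cart algebra_simps)
  have zero: "bump_prod p m \<epsilon> (z - x) = 0" if "z \<notin> cbox x (x + (\<chi> i. \<epsilon>))" for z p m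
    using bump_prod_eq_0[OF \<epsilon>] that unfolding shift by auto
  have zero': "bump_prod p m \<epsilon> (z - x) = 0" if "z \<notin> K" for z p m
    using zero K(2) that by blast
  have "?\<phi> \<in> test_functions \<Omega>"
    unfolding test_functions_def
  proof (intro CollectI conjI allI exI[of _ "cbox x (x + (\<chi> i. \<epsilon>))"] C_k_bump_prod)
    show "cbox x (x + (\<chi> i. \<epsilon>)) \<subseteq> \<Omega>" using K by blast
    show "z \<notin> cbox x (x + (\<chi> i. \<epsilon>)) \<longrightarrow> 1 * kernel \<epsilon> (z - x) = 0" for z using zero by simp
  qed simp
  then have "(LINT z:\<Omega>|lborel. f z * pderiv_at i ?\<phi> z) = - (LINT z:\<Omega>|lborel. h z * ?\<phi> z)"
    using wd unfolding has_weak_pderiv_on_def by blast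
  moreover have "(LINT z:\<Omega>|lborel. f z * pderiv_at i ?\<phi> z) = (\<integral>z. indicator K z * f z * kernel_partial i \<epsilon> (z - x) \<partial>lborel)"
    unfolding set_lebesgue_integral_def pderiv_at_bump_prod
    using K(1) by (intro Bochner_Integration.integral_cong) (auto simp: zero' indicator_def bump_prod_partial_def)
  moreover have "(LINT z:\<Omega>|lborel. h z * ?\<phi> z) = (\<integral>z. indicator K z * h z * kernel \<epsilon> (z - x) \<partial>lborel)"
    unfolding set_lebesgue_integral_def
    using K(1) by (intro Bochner_Integration.integral_cong) (auto simp: zero' indicator_def)
  ultimately have "(\<integral>z. indicator K z * f z * kernel_partial i \<epsilon> (z - x) \<partial>lborel)
    = - (\<integral>z. indicator K z * h z * kernel \<epsilon> (z - x) \<partial>lborel)" by simp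
  then show ?thesis by (simp add: mollify_def)
qed

text \<open>The normalized kernel is a probability density, so the square of the mollification is at most the
mollification of the square. Tonelli's theorem then integrates out the kernel.\<close>

lemma nn_integral_mollify_power2_le:
  fixes u :: "real^'n::finite \<Rightarrow> real"
  assumes \<epsilon>: "0 < \<epsilon>" and [measurable]: "u \<in> borel_measurable borel"
  shows "(\<integral>\<^sup>+x. ennreal ((mollify \<epsilon> u x)\<^sup>2) \<partial>lborel) \<le> (\<integral>\<^sup>+x. ennreal ((u x)\<^sup>2) \<partial>lborel)"
proof -
  define N where "N = kernel_mass TYPE('n) \<epsilon>"
  have N: "0 < N" using kernel_mass_pos[OF \<epsilon>] by (simp add: N_def)
  have le: "ennreal ((mollify \<epsilon> u x)\<^sup>2) \<le> ennreal (1 / N) * (\<integral>\<^sup>+z. ennreal ((u z)\<^sup>2 * kernel \<epsilon> (z - x)) \<partial>lborel)" for x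
  proof -
    let ?I = "\<integral>z. u z * kernel \<epsilon> (z - x) \<partial>lborel"
    have "ennreal \<bar>?I\<bar> \<le> (\<integral>\<^sup>+z. ennreal \<bar>u z * kernel \<epsilon> (z - x)\<bar> \<partial>lborel)"
    proof (cases "integrable lborel (\<lambda>z. u z * kernel \<epsilon> (z - x))")
      case True
      then show ?thesis using integral_norm_bound_ennreal by fastforce
    qed (simp add: not_integrable_integral_eq)
    \<comment> \<open>Splitting the kernel into two square roots prepares the Cauchy-Schwarz inequality.\<close>
    also have "\<dots> = (\<integral>\<^sup>+z. ennreal (\<bar>u z\<bar> * sqrt (kernel \<epsilon> (z - x))) * ennreal (sqrt (kernel \<epsilon> (z - x))) \<partial>lborel)"
      by (intro nn_integral_cong) (simp add: kernel_nonneg abs_mult mult.assoc flip: ennreal_mult)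
    finally have "(ennreal \<bar>?I\<bar>)\<^sup>2 \<le> (\<integral>\<^sup>+z. ennreal (\<bar>u z\<bar> * sqrt (kernel \<epsilon> (z - x))) * ennreal (sqrt (kernel \<epsilon> (z - x))) \<partial>lborel)\<^sup>2"
      by (intro power_mono) auto
    also have "\<dots> \<le> (\<integral>\<^sup>+z. (ennreal (\<bar>u z\<bar> * sqrt (kernel \<epsilon> (z - x))))\<^sup>2 \<partial>lborel)
        * (\<integral>\<^sup>+z. (ennreal (sqrt (kernel \<epsilon> (z - x))))\<^sup>2 \<partial>lborel)"
      by (intro Cauchy_Schwarz_nn_integral) auto
    also have "(\<integral>\<^sup>+z. (ennreal (\<bar>u z\<bar> * sqrt (kernel \<epsilon> (z - x))))\<^sup>2 \<partial>lborel) = (\<integral>\<^sup>+z. ennreal ((u z)\<^sup>2 * kernel \<epsilon> (z - x)) \<partial>lborel)"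
      by (simp add: kernel_nonneg ennreal_power power_mult_distrib)
    also have "(\<integral>\<^sup>+z. (ennreal (sqrt (kernel \<epsilon> (z - x))))\<^sup>2 \<partial>lborel) = ennreal N"
      using nn_integral_kernel(2)[OF \<epsilon>, of x] by (simp add: kernel_nonneg ennreal_power N_def)
    finally have "(ennreal \<bar>?I\<bar>)\<^sup>2 \<le> (\<integral>\<^sup>+z. ennreal ((u z)\<^sup>2 * kernel \<epsilon> (z - x)) \<partial>lborel) * ennreal N" .
    then have "ennreal (1 / N\<^sup>2) * (ennreal \<bar>?I\<bar>)\<^sup>2
        \<le> ennreal (1 / N\<^sup>2) * ((\<integral>\<^sup>+z. ennreal ((u z)\<^sup>2 * kernel \<epsilon> (z - x)) \<partial>lborel) * ennreal N)"
      by (intro mult_left_mono) auto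
    also have "ennreal (1 / N\<^sup>2) * (ennreal \<bar>?I\<bar>)\<^sup>2 = ennreal ((mollify \<epsilon> u x)\<^sup>2)"
      by (simp add: mollify_def N_def[symmetric] ennreal_power power_divide flip: ennreal_mult)
    also have "ennreal (1 / N\<^sup>2) * ((\<integral>\<^sup>+z. ennreal ((u z)\<^sup>2 * kernel \<epsilon> (z - x)) \<partial>lborel) * ennreal N)
        = (ennreal (1 / N\<^sup>2) * ennreal N) * (\<integral>\<^sup>+z. ennreal ((u z)\<^sup>2 * kernel \<epsilon> (z - x)) \<partial>lborel)"
      by (simp only: ac_simps)
    also have "ennreal (1 / N\<^sup>2) * ennreal N = ennreal (1 / N)"
      using N by (simp add: power2_eq_square flip: ennreal_mult)
    finally show ?thesis .
  qed
  have "(\<integral>\<^sup>+x. ennreal ((mollify \<epsilon> u x)\<^sup>2) \<partial>lborel)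
    \<le> (\<integral>\<^sup>+x. ennreal (1 / N) * (\<integral>\<^sup>+z. ennreal ((u z)\<^sup>2 * kernel \<epsilon> (z - x)) \<partial>lborel) \<partial>lborel)"
    by (intro nn_integral_mono le)
  also have "\<dots> = ennreal (1 / N) * (\<integral>\<^sup>+x. \<integral>\<^sup>+z. ennreal ((u z)\<^sup>2 * kernel \<epsilon> (z - x)) \<partial>lborel \<partial>lborel)"
    by (intro nn_integral_cmult) measurable
  also have "(\<integral>\<^sup>+x. \<integral>\<^sup>+z. ennreal ((u z)\<^sup>2 * kernel \<epsilon> (z - x)) \<partial>lborel \<partial>(lborel :: (real^'n) measure))
    = (\<integral>\<^sup>+z. \<integral>\<^sup>+x. ennreal ((u z)\<^sup>2 * kernel \<epsilon> (z - x)) \<partial>lborel \<partial>lborel)"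
    by (intro lborel_pair.Fubini') measurable
  also have "\<dots> = (\<integral>\<^sup>+z. ennreal ((u z)\<^sup>2) * ennreal N \<partial>lborel)"
    by (intro nn_integral_cong)
      (simp add: kernel_nonneg ennreal_mult nn_integral_cmult N_def nn_integral_kernel(1)[OF \<epsilon>])
  also have "\<dots> = (\<integral>\<^sup>+z. ennreal ((u z)\<^sup>2) \<partial>lborel) * ennreal N" by (intro nn_integral_multc) measurable
  also have "ennreal (1 / N) * ((\<integral>\<^sup>+z. ennreal ((u z)\<^sup>2) \<partial>lborel) * ennreal N)
    = (\<integral>\<^sup>+z. ennreal ((u z)\<^sup>2) \<partial>lborel) * (ennreal (1 / N) * ennreal N)" by (simp only: ac_simps)
  also have "ennreal (1 / N) * ennreal N = 1" using N by (simp flip: ennreal_mult)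
  finally show ?thesis by simp
qed

text \<open>A measurable function is almost everywhere a limit of continuous functions. Truncating both the
function and the approximants at a height \<open>n\<close> makes dominated convergence applicable.\<close>

lemma L2_approx_continuous:
  fixes u :: "'a::euclidean_space \<Rightarrow> real"
  assumes K: "compact K" and [measurable]: "u \<in> borel_measurable borel"
    and u2: "(\<integral>\<^sup>+x. ennreal ((u x)\<^sup>2) * indicator K x \<partial>lborel) < \<infinity>" and e: "0 < e"
  obtains c where "continuous_on UNIV c" "(\<integral>\<^sup>+x. ennreal ((u x - c x)\<^sup>2) * indicator K x \<partial>lborel) < ennreal e"
proof -
  have [measurable]: "K \<in> sets borel" using K by (simp add: borel_compact)
  have Kfin: "emeasure lborel K < \<infinity>" using emeasure_bounded_finite[OF compact_imp_bounded[OF K]] by simp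
  define T where "T n v = max (- real n) (min (real n) v)" for n and v :: real
  have T_le: "\<bar>v - T n v\<bar> \<le> \<bar>v\<bar>" "\<bar>T n v\<bar> \<le> real n" for n v unfolding T_def by (auto simp: max_def min_def)
  have [measurable]: "T n \<in> borel_measurable borel" for n unfolding T_def by measurable
  have "(\<lambda>n. \<integral>\<^sup>+x. ennreal ((u x - T n (u x))\<^sup>2) * indicator K x \<partial>lborel) \<longlonglongrightarrow> (\<integral>\<^sup>+x. 0 \<partial>(lborel :: 'a measure))"
  proof (rule nn_integral_dominated_convergence[where w="\<lambda>x. ennreal ((u x)\<^sup>2) * indicator K x"])
    show "AE x in lborel. ennreal ((u x - T n (u x))\<^sup>2) * indicator K x \<le> ennreal ((u x)\<^sup>2) * indicator K x" for n
      using T_le(1) by (intro AE_I2 mult_right_mono ennreal_leI) (auto simp: abs_le_square_iff[symmetric])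
    show "AE x in lborel. (\<lambda>n. ennreal ((u x - T n (u x))\<^sup>2) * indicator K x) \<longlonglongrightarrow> 0"
    proof (intro AE_I2 tendsto_eventually)
      fix x
      obtain m :: nat where m: "\<bar>u x\<bar> \<le> real m" using real_arch_simple by blast
      show "eventually (\<lambda>n. ennreal ((u x - T n (u x))\<^sup>2) * indicator K x = 0) sequentially"
        using eventually_ge_at_top[of m]
      proof eventually_elim
        case (elim n)
        then have "\<bar>u x\<bar> \<le> real n" using m by linarith
        then have "T n (u x) = u x" by (auto simp: T_def)
        then show ?case by simp
      qed
    qed
  qed (use u2 in auto)
  then have "eventually (\<lambda>n. (\<integral>\<^sup>+x. ennreal ((u x - T n (u x))\<^sup>2) * indicator K x \<partial>lborel) < ennreal (e / 4)) sequentially"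
    by (rule order_tendstoD(2)) (use e in simp)
  then obtain n where n: "(\<integral>\<^sup>+x. ennreal ((u x - T n (u x))\<^sup>2) * indicator K x \<partial>lborel) < ennreal (e / 4)"
    by (meson eventually_happens trivial_limit_sequentially)
  have "u measurable_on UNIV"
    by (rule lebesgue_measurable_imp_measurable_on) (auto intro: measurable_completion)
  then obtain N g where N: "negligible N" and g: "\<And>j. continuous_on UNIV (g j)"
      and lim: "\<And>x. x \<notin> N \<Longrightarrow> (\<lambda>j. g j x) \<longlonglongrightarrow> u x"
    unfolding measurable_on_def by auto
  have [measurable]: "g j \<in> borel_measurable borel" for j using g by (rule borel_measurable_continuous_onI)
  obtain N' where N': "N' \<in> null_sets lborel" "N \<subseteq> N'"
    using N by (auto simp: negligible_iff_null_sets null_sets_completion_iff2)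
  have "(\<lambda>j. \<integral>\<^sup>+x. ennreal ((T n (u x) - T n (g j x))\<^sup>2) * indicator K x \<partial>lborel) \<longlonglongrightarrow> (\<integral>\<^sup>+x. 0 \<partial>(lborel :: 'a measure))"
  proof (rule nn_integral_dominated_convergence[where w="\<lambda>x. ennreal ((2 * real n)\<^sup>2) * indicator K x"])
    show "AE x in lborel. ennreal ((T n (u x) - T n (g j x))\<^sup>2) * indicator K x \<le> ennreal ((2 * real n)\<^sup>2) * indicator K x" for j
    proof (intro AE_I2 mult_right_mono ennreal_leI)
      fix x
      have "\<bar>T n (u x) - T n (g j x)\<bar> \<le> \<bar>2 * real n\<bar>" using T_le(2)[of n "u x"] T_le(2)[of n "g j x"] by linarith
      then show "(T n (u x) - T n (g j x))\<^sup>2 \<le> (2 * real n)\<^sup>2" by (simp only: abs_le_square_iff)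
    qed auto
    show "AE x in lborel. (\<lambda>j. ennreal ((T n (u x) - T n (g j x))\<^sup>2) * indicator K x) \<longlonglongrightarrow> 0"
      using AE_not_in[OF N'(1)]
    proof eventually_elim
      case (elim x)
      then have "(\<lambda>j. g j x) \<longlonglongrightarrow> u x" using lim N' by blast
      then have "(\<lambda>j. (T n (u x) - T n (g j x))\<^sup>2 * indicator K x) \<longlonglongrightarrow> (T n (u x) - T n (u x))\<^sup>2 * indicator K x"
        unfolding T_def by (intro tendsto_intros)
      then have "(\<lambda>j. ennreal ((T n (u x) - T n (g j x))\<^sup>2 * indicator K x)) \<longlonglongrightarrow> ennreal 0"
        by (intro tendsto_ennrealI) simp
      then show ?case by (simp add: ennreal_mult ennreal_indicator)
    qed
    show "(\<integral>\<^sup>+x. ennreal ((2 * real n)\<^sup>2) * indicator K x \<partial>lborel) < \<infinity>"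
      using Kfin by (simp add: nn_integral_cmult_indicator ennreal_mult_less_top)
  qed auto
  then have "eventually (\<lambda>j. (\<integral>\<^sup>+x. ennreal ((T n (u x) - T n (g j x))\<^sup>2) * indicator K x \<partial>lborel) < ennreal (e / 4)) sequentially"
    by (rule order_tendstoD(2)) (use e in simp)
  then obtain j where j: "(\<integral>\<^sup>+x. ennreal ((T n (u x) - T n (g j x))\<^sup>2) * indicator K x \<partial>lborel) < ennreal (e / 4)"
    by (meson eventually_happens trivial_limit_sequentially)
  show thesis
  proof (rule that)
    show "continuous_on UNIV (\<lambda>x. T n (g j x))" unfolding T_def by (intro continuous_intros g)
    have "(\<integral>\<^sup>+x. ennreal ((u x - T n (g j x))\<^sup>2) * indicator K x \<partial>lborel)
      \<le> (\<integral>\<^sup>+x. 2 * (ennreal ((u x - T n (u x))\<^sup>2) * indicator K x) + 2 * (ennreal ((T n (u x) - T n (g j x))\<^sup>2) * indicator K x) \<partial>lborel)"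
    proof (intro nn_integral_mono)
      fix x
      have *: "(u x - T n (g j x))\<^sup>2 \<le> 2 * (u x - T n (u x))\<^sup>2 + 2 * (T n (u x) - T n (g j x))\<^sup>2"
        using sum_squares_ge_zero[of "u x - 2 * T n (u x) + T n (g j x)" 0] by (simp add: power2_eq_square algebra_simps)
      then have "ennreal ((u x - T n (g j x))\<^sup>2) \<le> 2 * ennreal ((u x - T n (u x))\<^sup>2) + 2 * ennreal ((T n (u x) - T n (g j x))\<^sup>2)"
      proof -
        have "ennreal (2 * a + 2 * b) = 2 * ennreal a + 2 * ennreal b" if "0 \<le> a" "0 \<le> b" for a b
          using that by (simp add: ennreal_mult)
        with * show ?thesis by (metis ennreal_leI zero_le_power2)
      qed
      then show "ennreal ((u x - T n (g j x))\<^sup>2) * indicator K x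
        \<le> 2 * (ennreal ((u x - T n (u x))\<^sup>2) * indicator K x) + 2 * (ennreal ((T n (u x) - T n (g j x))\<^sup>2) * indicator K x)"
        by (auto simp: indicator_def)
    qed
    also have "\<dots> = 2 * (\<integral>\<^sup>+x. ennreal ((u x - T n (u x))\<^sup>2) * indicator K x \<partial>lborel)
        + 2 * (\<integral>\<^sup>+x. ennreal ((T n (u x) - T n (g j x))\<^sup>2) * indicator K x \<partial>lborel)"
      by (simp add: nn_integral_add nn_integral_cmult)
    also have "\<dots> < 2 * ennreal (e / 4) + 2 * ennreal (e / 4)"
      using n j by (intro add_strict_mono) (auto intro!: ennreal_mult_strict_left_mono)
    also have "\<dots> = ennreal e" using e by (simp flip: ennreal_plus ennreal_numeral ennreal_mult)
    finally show "(\<integral>\<^sup>+x. ennreal ((u x - T n (g j x))\<^sup>2) * indicator K x \<partial>lborel) < ennreal e" .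
  qed
qed

section \<open>Convergence in mean square\<close>

lemma square_sum3_le: "(a + b - d)\<^sup>2 \<le> 3 * a\<^sup>2 + 3 * b\<^sup>2 + 3 * d\<^sup>2" for a b d :: real
proof -
  have "0 \<le> (a - b)\<^sup>2 + (a + d)\<^sup>2 + (b + d)\<^sup>2" by simp
  then show ?thesis by (simp add: power2_eq_square algebra_simps)
qed

text \<open>By density: \<open>u\<close> is split into a continuous part, whose mollifications converge uniformly on \<open>K\<close>, and
a remainder that is small in mean square and stays so under mollification. Mollification at points of
\<open>K\<close> only sees \<open>L\<close>, where the continuous part is uniformly continuous.\<close>

lemma mollify_tendsto_L2:
  fixes u :: "real^'n::finite \<Rightarrow> real"
  assumes L: "compact L" and [measurable]: "K \<in> sets borel" and KL: "K \<subseteq> L"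
    and \<epsilon>\<^sub>0: "0 < \<epsilon>\<^sub>0" "\<And>x. x \<in> K \<Longrightarrow> cbox x (x + (\<chi> i. \<epsilon>\<^sub>0)) \<subseteq> L"
    and [measurable]: "u \<in> borel_measurable borel" and uL: "\<And>x. x \<notin> L \<Longrightarrow> u x = 0"
    and u2: "(\<integral>\<^sup>+x. ennreal ((u x)\<^sup>2) \<partial>lborel) < \<infinity>"
  shows "((\<lambda>\<epsilon>. \<integral>\<^sup>+x. ennreal ((mollify \<epsilon> u x - u x)\<^sup>2) * indicator K x \<partial>lborel) \<longlongrightarrow> 0) (at_right 0)"
proof (rule order_tendstoI)
  fix a :: ennreal assume "0 < a"
  then obtain e' where e': "0 < e'" "e' < a" using dense by blast
  then obtain e where e: "0 < e" "ennreal e < a"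
    by (metis ennreal_cases ennreal_less_zero_iff not_less_iff_gr_or_eq top.extremum_strict)
  have [measurable]: "L \<in> sets borel" using L by (simp add: borel_compact)
  have Lfin: "emeasure lborel L < \<infinity>" using emeasure_bounded_finite[OF compact_imp_bounded[OF L]] by simp
  define V where "V = measure lborel L"
  have V: "0 \<le> V" "emeasure lborel L = ennreal V"
    using Lfin by (auto simp: V_def emeasure_eq_ennreal_measure)
  have u2L: "(\<integral>\<^sup>+x. ennreal ((u x)\<^sup>2) * indicator L x \<partial>lborel) < \<infinity>"
  proof (rule le_less_trans[OF nn_integral_mono u2])
    show "ennreal ((u x)\<^sup>2) * indicator L x \<le> ennreal ((u x)\<^sup>2)" for x by (auto simp: indicator_def)
  qed
  obtain c where c: "continuous_on UNIV c"
    and uc: "(\<integral>\<^sup>+x. ennreal ((u x - c x)\<^sup>2) * indicator L x \<partial>lborel) < ennreal (e / 12)"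
    using L2_approx_continuous[OF L _ u2L, of "e / 12"] e by auto
  have [measurable]: "c \<in> borel_measurable borel" using c by (rule borel_measurable_continuous_onI)
  define c' r where "c' x = indicator L x * c x" and "r x = u x - c' x" for x
  have [measurable]: "c' \<in> borel_measurable borel" "r \<in> borel_measurable borel"
    unfolding c'_def r_def by measurable
  have r2: "(\<integral>\<^sup>+x. ennreal ((r x)\<^sup>2) \<partial>lborel) \<le> ennreal (e / 12)"
  proof -
    have "(\<integral>\<^sup>+x. ennreal ((r x)\<^sup>2) \<partial>lborel) = (\<integral>\<^sup>+x. ennreal ((u x - c x)\<^sup>2) * indicator L x \<partial>lborel)"
      using uL by (intro nn_integral_cong) (auto simp: r_def c'_def indicator_def)
    then show ?thesis using uc by simp
  qed
  have intc: "integrable lborel c'"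
    unfolding c'_def[abs_def]
    using borel_integrable_compact[OF L continuous_on_subset[OF c]] by simp
  have intu: "integrable lborel u"
  proof (rule integrableI_bounded)
    have "(\<integral>\<^sup>+x. ennreal (norm (u x)) \<partial>lborel) \<le> (\<integral>\<^sup>+x. indicator L x + ennreal ((u x)\<^sup>2) \<partial>lborel)"
    proof (intro nn_integral_mono)
      fix x
      have "\<bar>u x\<bar> \<le> 1 + (u x)\<^sup>2"
      proof (cases "\<bar>u x\<bar> \<le> 1")
        case False
        then have "\<bar>u x\<bar> * 1 \<le> \<bar>u x\<bar> * \<bar>u x\<bar>" by (intro mult_left_mono) auto
        then show ?thesis by (simp add: power2_eq_square)
      qed (simp add: add_increasing2)
      then have "ennreal \<bar>u x\<bar> \<le> ennreal (1 + (u x)\<^sup>2)" by (rule ennreal_leI)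
      then have "ennreal \<bar>u x\<bar> \<le> 1 + ennreal ((u x)\<^sup>2)" by simp
      then show "ennreal (norm (u x)) \<le> indicator L x + ennreal ((u x)\<^sup>2)"
        using uL[of x] by (cases "x \<in> L") auto
    qed
    also have "\<dots> < \<infinity>" using u2 Lfin by (simp add: nn_integral_add)
    finally show "(\<integral>\<^sup>+x. ennreal (norm (u x)) \<partial>lborel) < \<infinity>" .
  qed simp
  have intr: "integrable lborel r" unfolding r_def[abs_def] using intu intc by simp
  \<comment> \<open>The error \<open>e\<close> is shared as \<open>e / 4\<close> for each of the two terms in \<open>r\<close> and \<open>e / 2\<close> for the uniform error \<open>\<eta>\<close>.\<close>
  define \<eta> where "\<eta> = sqrt (e / (6 * (V + 1)))"
  have \<eta>: "0 < \<eta>" "3 * \<eta>\<^sup>2 * V \<le> e / 2"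
  proof -
    show "0 < \<eta>" using e V by (simp add: \<eta>_def)
    have "3 * \<eta>\<^sup>2 * V = (e / 2) * (V / (V + 1))" using e V by (simp add: \<eta>_def field_simps)
    also have "\<dots> \<le> (e / 2) * 1" using e V by (intro mult_left_mono) auto
    finally show "3 * \<eta>\<^sup>2 * V \<le> e / 2" by simp
  qed
  have "uniformly_continuous_on L c"
    using compact_uniformly_continuous[OF continuous_on_subset[OF c] L] by simp
  then obtain \<delta> where \<delta>: "0 < \<delta>" "\<And>x z. x \<in> L \<Longrightarrow> z \<in> L \<Longrightarrow> dist z x < \<delta> \<Longrightarrow> dist (c z) (c x) < \<eta>"
    unfolding uniformly_continuous_on_def using \<eta>(1) by metis
  define \<epsilon>\<^sub>1 where "\<epsilon>\<^sub>1 = min \<epsilon>\<^sub>0 (\<delta> / (real CARD('n) + 1))"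
  have \<epsilon>\<^sub>1: "0 < \<epsilon>\<^sub>1" using \<epsilon>\<^sub>0 \<delta> by (simp add: \<epsilon>\<^sub>1_def add_nonneg_pos)
  have main: "(\<integral>\<^sup>+x. ennreal ((mollify \<epsilon> u x - u x)\<^sup>2) * indicator K x \<partial>lborel) \<le> ennreal e"
    if \<epsilon>: "0 < \<epsilon>" "\<epsilon> < \<epsilon>\<^sub>1" for \<epsilon>
  proof -
    let ?N = "kernel_mass TYPE('n) \<epsilon>"
    have N: "0 < ?N" using kernel_mass_pos[OF \<epsilon>(1)] .
    have kint: "integrable lborel (\<lambda>z. kernel \<epsilon> (z - x))" "(\<integral>z. kernel \<epsilon> (z - x) \<partial>lborel) = ?N" for x :: "real^'n"
    proof -
      have "(\<integral>\<^sup>+z. ennreal (kernel \<epsilon> (z - x)) \<partial>lborel) = ennreal ?N" by (rule nn_integral_kernel(2)[OF \<epsilon>(1)])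
      then have "has_bochner_integral lborel (\<lambda>z. kernel \<epsilon> (z - x)) ?N"
        using N by (intro has_bochner_integral_nn_integral) (auto simp: kernel_nonneg)
      then show "integrable lborel (\<lambda>z. kernel \<epsilon> (z - x))" "(\<integral>z. kernel \<epsilon> (z - x) \<partial>lborel) = ?N"
        by (auto simp: has_bochner_integral_iff)
    qed
    have split: "mollify \<epsilon> u x = mollify \<epsilon> r x + mollify \<epsilon> c' x" for x
    proof -
      have "(\<integral>z. u z * kernel \<epsilon> (z - x) \<partial>lborel)
        = (\<integral>z. r z * kernel \<epsilon> (z - x) + c' z * kernel \<epsilon> (z - x) \<partial>lborel)"
        by (intro Bochner_Integration.integral_cong) (auto simp: r_def algebra_simps)
      also have "\<dots> = (\<integral>z. r z * kernel \<epsilon> (z - x) \<partial>lborel) + (\<integral>z. c' z * kernel \<epsilon> (z - x) \<partial>lborel)"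
        by (intro Bochner_Integration.integral_add integrable_mult_bump_prod intr intc)
      finally show ?thesis by (simp add: mollify_def add_divide_distrib)
    qed
    have close: "\<bar>mollify \<epsilon> c' x - c x\<bar> \<le> \<eta>" if x: "x \<in> K" for x
    proof -
      have pt: "\<bar>(c' z - c x) * kernel \<epsilon> (z - x)\<bar> \<le> \<eta> * kernel \<epsilon> (z - x)" for z
      proof (cases "z \<in> cbox x (x + (\<chi> i. \<epsilon>))")
        case True
        then have comp: "0 \<le> (z - x) $ i" "(z - x) $ i \<le> \<epsilon>" for i by (auto simp: mem_box_cart algebra_simps)
        have "\<epsilon> \<le> \<epsilon>\<^sub>0" using \<epsilon> by (simp add: \<epsilon>\<^sub>1_def)
        then have "z \<in> cbox x (x + (\<chi> i. \<epsilon>\<^sub>0))" using True by (auto simp: mem_box_cart intro: order_trans)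
        then have zL: "z \<in> L" using \<epsilon>\<^sub>0(2)[OF x] by blast
        have "norm (z - x) \<le> (\<Sum>i\<in>UNIV. \<bar>(z - x) $ i\<bar>)" by (rule norm_le_l1_cart)
        also have "\<dots> \<le> (\<Sum>i\<in>(UNIV :: 'n set). \<epsilon>)" using comp by (intro sum_mono) (auto simp: abs_le_iff intro: order_trans[of _ 0])
        also have "\<dots> \<le> (real CARD('n) + 1) * \<epsilon>" using \<epsilon> by (simp add: algebra_simps)
        also have "\<dots> < \<delta>" using \<epsilon> by (simp add: \<epsilon>\<^sub>1_def field_simps add_nonneg_pos)
        finally have "dist (c z) (c x) < \<eta>" using x KL zL by (intro \<delta>(2)) (auto simp: dist_norm)
        then have "\<bar>c' z - c x\<bar> \<le> \<eta>" using zL by (simp add: c'_def dist_real_def)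
        then show ?thesis by (simp add: abs_mult kernel_nonneg mult_right_mono)
      next
        case False
        then have "z - x \<notin> cbox 0 (\<chi> i. \<epsilon>)" by (auto simp: mem_box_cart algebra_simps)
        then have "kernel \<epsilon> (z - x) = 0" by (rule bump_prod_eq_0[OF \<epsilon>(1)])
        then show ?thesis by simp
      qed
      have ic: "integrable lborel (\<lambda>z. (c' z - c x) * kernel \<epsilon> (z - x))"
        using integrable_mult_bump_prod[OF intc] kint(1) by (simp add: left_diff_distrib)
      have "mollify \<epsilon> c' x - c x = (\<integral>z. (c' z - c x) * kernel \<epsilon> (z - x) \<partial>lborel) / ?N"
        using N integrable_mult_bump_prod[OF intc] kint
        by (simp add: mollify_def left_diff_distrib diff_divide_distrib)
      also have "\<bar>\<dots>\<bar> \<le> (\<integral>z. \<eta> * kernel \<epsilon> (z - x) \<partial>lborel) / ?N"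
        unfolding abs_divide using N ic kint pt
        by (simp only: abs_of_pos)
          (intro divide_right_mono integral_abs_bound[THEN order_trans] integral_mono integrable_abs integrable_mult_right, auto)
      also have "\<dots> = \<eta>" using N kint by simp
      finally show ?thesis .
    qed
    have "(\<integral>\<^sup>+x. ennreal ((mollify \<epsilon> u x - u x)\<^sup>2) * indicator K x \<partial>lborel)
      \<le> (\<integral>\<^sup>+x. ennreal 3 * ennreal ((mollify \<epsilon> r x)\<^sup>2) + ennreal (3 * \<eta>\<^sup>2) * indicator L x + ennreal 3 * ennreal ((r x)\<^sup>2) \<partial>lborel)"
    proof (intro nn_integral_mono)
      fix x
      show "ennreal ((mollify \<epsilon> u x - u x)\<^sup>2) * indicator K x
        \<le> ennreal 3 * ennreal ((mollify \<epsilon> r x)\<^sup>2) + ennreal (3 * \<eta>\<^sup>2) * indicator L x + ennreal 3 * ennreal ((r x)\<^sup>2)"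
      proof (cases "x \<in> K")
        case True
        then have xL: "x \<in> L" using KL by auto
        have "mollify \<epsilon> u x - u x = mollify \<epsilon> r x + (mollify \<epsilon> c' x - c x) - r x"
          using xL by (simp add: split r_def c'_def)
        then have "(mollify \<epsilon> u x - u x)\<^sup>2 \<le> 3 * (mollify \<epsilon> r x)\<^sup>2 + 3 * (mollify \<epsilon> c' x - c x)\<^sup>2 + 3 * (r x)\<^sup>2"
          using square_sum3_le by metis
        moreover have "(mollify \<epsilon> c' x - c x)\<^sup>2 \<le> \<eta>\<^sup>2"
          using close[OF True] by (simp add: abs_le_square_iff[symmetric])
        ultimately have "(mollify \<epsilon> u x - u x)\<^sup>2 \<le> 3 * (mollify \<epsilon> r x)\<^sup>2 + 3 * \<eta>\<^sup>2 + 3 * (r x)\<^sup>2" by linarith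
        then have "ennreal ((mollify \<epsilon> u x - u x)\<^sup>2) \<le> ennreal (3 * (mollify \<epsilon> r x)\<^sup>2 + 3 * \<eta>\<^sup>2 + 3 * (r x)\<^sup>2)"
          by (rule ennreal_leI)
        then show ?thesis using True xL by (simp add: ennreal_mult')
      qed simp
    qed
    also have "\<dots> = ennreal 3 * (\<integral>\<^sup>+x. ennreal ((mollify \<epsilon> r x)\<^sup>2) \<partial>lborel) + ennreal (3 * \<eta>\<^sup>2) * emeasure lborel L
        + ennreal 3 * (\<integral>\<^sup>+x. ennreal ((r x)\<^sup>2) \<partial>lborel)"
      by (simp add: nn_integral_add nn_integral_cmult nn_integral_cmult_indicator)
    also have "\<dots> \<le> ennreal 3 * ennreal (e / 12) + ennreal (3 * \<eta>\<^sup>2) * ennreal V + ennreal 3 * ennreal (e / 12)"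
      using r2 nn_integral_mollify_power2_le[OF \<epsilon>(1), of r] unfolding V(2)
      by (intro add_mono mult_left_mono order_refl) auto
    also have "\<dots> = ennreal (3 * (e / 12) + 3 * \<eta>\<^sup>2 * V + 3 * (e / 12))"
    proof -
      have "ennreal 3 * ennreal p + ennreal q * ennreal v + ennreal 3 * ennreal p = ennreal (3 * p + q * v + 3 * p)"
        if "0 \<le> p" "0 \<le> q" "0 \<le> v" for p q v
        using that by (simp add: ennreal_mult[symmetric] ennreal_plus[symmetric] del: ennreal_plus ennreal_numeral)
      then show ?thesis using e V by auto
    qed
    also have "\<dots> \<le> ennreal e" using \<eta>(2) by (intro ennreal_leI) simp
    finally show ?thesis .
  qed
  have "eventually (\<lambda>\<epsilon>. \<epsilon> \<in> {0<..<\<epsilon>\<^sub>1}) (at_right 0)" by (rule eventually_at_right_real[OF \<epsilon>\<^sub>1])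
  then show "eventually (\<lambda>\<epsilon>. (\<integral>\<^sup>+x. ennreal ((mollify \<epsilon> u x - u x)\<^sup>2) * indicator K x \<partial>lborel) < a) (at_right 0)"
    by eventually_elim (use main e in \<open>auto intro: le_less_trans\<close>)
qed simp

lemma L2_mult_integrable:
  assumes "f \<in> L2 M" "g \<in> L2 M"
  shows "integrable M (\<lambda>x. f x * g x)"
proof (rule Bochner_Integration.integrable_bound[of _ "\<lambda>x. (f x)\<^sup>2 + (g x)\<^sup>2"])
  show "AE x in M. norm (f x * g x) \<le> norm ((f x)\<^sup>2 + (g x)\<^sup>2)"
  proof (intro AE_I2)
    fix x
    have "2 * (\<bar>f x\<bar> * \<bar>g x\<bar>) \<le> (f x)\<^sup>2 + (g x)\<^sup>2"
      using sum_squares_bound[of "\<bar>f x\<bar>" "\<bar>g x\<bar>"] by simp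
    moreover have "0 \<le> \<bar>f x\<bar> * \<bar>g x\<bar>" by simp
    ultimately show "norm (f x * g x) \<le> norm ((f x)\<^sup>2 + (g x)\<^sup>2)" unfolding real_norm_def abs_mult by linarith
  qed
qed (use assms in \<open>auto simp: L2_def\<close>)

lemma L2_diff: "f \<in> L2 M \<Longrightarrow> g \<in> L2 M \<Longrightarrow> (\<lambda>x. f x - g x) \<in> L2 M"
  using L2_mult_integrable[of f M g] by (auto simp: L2_def power2_diff mult.assoc)

lemma Cauchy_Schwarz_L2:
  assumes "f \<in> L2 M" "g \<in> L2 M"
  shows "\<bar>\<integral>x. f x * g x \<partial>M\<bar> \<le> sqrt (\<integral>x. (f x)\<^sup>2 \<partial>M) * sqrt (\<integral>x. (g x)\<^sup>2 \<partial>M)"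
proof -
  have [measurable]: "f \<in> borel_measurable M" "g \<in> borel_measurable M" using assms by (auto simp: L2_def)
  have i: "integrable M (\<lambda>x. (f x)\<^sup>2)" "integrable M (\<lambda>x. (g x)\<^sup>2)" using assms by (auto simp: L2_def)
  have "(\<integral>\<^sup>+x. ennreal \<bar>f x\<bar> * ennreal \<bar>g x\<bar> \<partial>M)\<^sup>2
    \<le> (\<integral>\<^sup>+x. (ennreal \<bar>f x\<bar>)\<^sup>2 \<partial>M) * (\<integral>\<^sup>+x. (ennreal \<bar>g x\<bar>)\<^sup>2 \<partial>M)"
    by (intro Cauchy_Schwarz_nn_integral) auto
  also have "(\<integral>\<^sup>+x. (ennreal \<bar>f x\<bar>)\<^sup>2 \<partial>M) = ennreal (\<integral>x. (f x)\<^sup>2 \<partial>M)"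
    using i by (simp add: ennreal_power nn_integral_eq_integral)
  also have "(\<integral>\<^sup>+x. (ennreal \<bar>g x\<bar>)\<^sup>2 \<partial>M) = ennreal (\<integral>x. (g x)\<^sup>2 \<partial>M)"
    using i by (simp add: ennreal_power nn_integral_eq_integral)
  also have "(\<integral>\<^sup>+x. ennreal \<bar>f x\<bar> * ennreal \<bar>g x\<bar> \<partial>M) = ennreal (\<integral>x. \<bar>f x * g x\<bar> \<partial>M)"
    using integrable_abs[OF L2_mult_integrable[OF assms]]
    by (subst nn_integral_eq_integral[symmetric]) (auto simp: abs_mult ennreal_mult)
  finally have "(\<integral>x. \<bar>f x * g x\<bar> \<partial>M)\<^sup>2 \<le> (\<integral>x. (f x)\<^sup>2 \<partial>M) * (\<integral>x. (g x)\<^sup>2 \<partial>M)"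
    by (simp add: ennreal_power ennreal_le_iff flip: ennreal_mult)
  then have "(\<integral>x. \<bar>f x * g x\<bar> \<partial>M) \<le> sqrt ((\<integral>x. (f x)\<^sup>2 \<partial>M) * (\<integral>x. (g x)\<^sup>2 \<partial>M))" by (rule real_le_rsqrt)
  then have "(\<integral>x. \<bar>f x * g x\<bar> \<partial>M) \<le> sqrt (\<integral>x. (f x)\<^sup>2 \<partial>M) * sqrt (\<integral>x. (g x)\<^sup>2 \<partial>M)"
    by (simp only: real_sqrt_mult)
  with integral_abs_bound show ?thesis by (rule order_trans)
qed

text \<open>Convergence in mean square carries second moments along, and on a finite measure space first moments
too, by the Cauchy-Schwarz inequality for the differences.\<close>

lemma L2_limit:
  assumes u: "u \<in> L2 M" and U: "\<And>n. U n \<in> L2 M"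
    and lim: "((\<lambda>n. \<integral>\<^sup>+x. ennreal ((U n x - u x)\<^sup>2) \<partial>M) \<longlongrightarrow> 0) F"
  shows "((\<lambda>n. \<integral>x. (U n x)\<^sup>2 \<partial>M) \<longlongrightarrow> (\<integral>x. (u x)\<^sup>2 \<partial>M)) F"
    and "finite_measure M \<Longrightarrow> ((\<lambda>n. \<integral>x. U n x \<partial>M) \<longlongrightarrow> (\<integral>x. u x \<partial>M)) F"
proof -
  define a where "a n x = U n x - u x" for n x
  have a: "a n \<in> L2 M" for n unfolding a_def[abs_def] by (intro L2_diff U u)
  have "(\<integral>\<^sup>+x. ennreal ((a n x)\<^sup>2) \<partial>M) = ennreal (\<integral>x. (a n x)\<^sup>2 \<partial>M)" for n
    using a[of n] by (intro nn_integral_eq_integral) (auto simp: L2_def)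
  then have "((\<lambda>n. ennreal (\<integral>x. (a n x)\<^sup>2 \<partial>M)) \<longlongrightarrow> ennreal 0) F" using lim by (simp add: a_def)
  then have a2: "((\<lambda>n. \<integral>x. (a n x)\<^sup>2 \<partial>M) \<longlongrightarrow> 0) F"
    by (rule tendsto_ennrealD) auto
  have cross: "((\<lambda>n. \<integral>x. v x * a n x \<partial>M) \<longlongrightarrow> 0) F" if v: "v \<in> L2 M" for v
  proof (rule Lim_null_comparison)
    show "eventually (\<lambda>n. norm (\<integral>x. v x * a n x \<partial>M) \<le> sqrt (\<integral>x. (v x)\<^sup>2 \<partial>M) * sqrt (\<integral>x. (a n x)\<^sup>2 \<partial>M)) F"
      using Cauchy_Schwarz_L2[OF v a] by simp
    show "((\<lambda>n. sqrt (\<integral>x. (v x)\<^sup>2 \<partial>M) * sqrt (\<integral>x. (a n x)\<^sup>2 \<partial>M)) \<longlongrightarrow> 0) F"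
      using tendsto_mult_right_zero[OF tendsto_real_sqrt[OF a2, simplified]] .
  qed
  have i2: "integrable M (\<lambda>x. (v x)\<^sup>2)" if "v \<in> L2 M" for v using that by (simp add: L2_def)
  have "(\<integral>x. (U n x)\<^sup>2 \<partial>M) = (\<integral>x. (u x)\<^sup>2 \<partial>M) + 2 * (\<integral>x. u x * a n x \<partial>M) + (\<integral>x. (a n x)\<^sup>2 \<partial>M)" for n
  proof -
    have "(\<integral>x. (U n x)\<^sup>2 \<partial>M) = (\<integral>x. (u x)\<^sup>2 + 2 * (u x * a n x) + (a n x)\<^sup>2 \<partial>M)"
      by (intro Bochner_Integration.integral_cong) (auto simp: a_def power2_eq_square algebra_simps)
    also have "\<dots> = (\<integral>x. (u x)\<^sup>2 \<partial>M) + 2 * (\<integral>x. u x * a n x \<partial>M) + (\<integral>x. (a n x)\<^sup>2 \<partial>M)"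
      using i2[OF u] i2[OF a] L2_mult_integrable[OF u a] by simp
    finally show ?thesis .
  qed
  moreover have "((\<lambda>n. (\<integral>x. (u x)\<^sup>2 \<partial>M) + 2 * (\<integral>x. u x * a n x \<partial>M) + (\<integral>x. (a n x)\<^sup>2 \<partial>M))
      \<longlongrightarrow> (\<integral>x. (u x)\<^sup>2 \<partial>M) + 2 * 0 + 0) F"
    by (intro tendsto_intros cross[OF u] a2)
  ultimately show "((\<lambda>n. \<integral>x. (U n x)\<^sup>2 \<partial>M) \<longlongrightarrow> (\<integral>x. (u x)\<^sup>2 \<partial>M)) F" by simp
  assume "finite_measure M"
  then interpret finite_measure M .
  have one: "(\<lambda>_. 1) \<in> L2 M" by (simp add: L2_def)
  have int: "integrable M v" if "v \<in> L2 M" for v using L2_mult_integrable[OF one that] by simp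
  have "(\<integral>x. U n x \<partial>M) = (\<integral>x. u x \<partial>M) + (\<integral>x. 1 * a n x \<partial>M)" for n
    using int[OF U] int[OF u] by (simp add: a_def)
  moreover have "((\<lambda>n. (\<integral>x. u x \<partial>M) + (\<integral>x. 1 * a n x \<partial>M)) \<longlongrightarrow> (\<integral>x. u x \<partial>M) + 0) F"
    by (intro tendsto_intros cross[OF one])
  ultimately show "((\<lambda>n. \<integral>x. U n x \<partial>M) \<longlongrightarrow> (\<integral>x. u x \<partial>M)) F" by simp
qed

section \<open>Weakly differentiable functions on boxes\<close>

text \<open>The mollifications of \<open>f\<close> satisfy \<open>brascamp_lieb_convex\<close> with the mollified weak derivatives as
gradient, and every integral in that inequality converges as \<open>\<epsilon>\<close> tends to 0. The larger box \<open>L\<close>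
contains all points that the mollification on \<open>K\<close> sees for \<open>\<epsilon> \<le> 1\<close>. On \<open>L\<close> the weight lies between
two positive constants, so weighted and unweighted mean-square convergence agree.\<close>

proposition brascamp_lieb_box_weak:
  fixes \<alpha> :: "real^'n::finite" and f :: "real^'n \<Rightarrow> real" and D :: "'n \<Rightarrow> real^'n \<Rightarrow> real"
    and l u :: real
  assumes \<alpha>: "\<And>i. 1 < \<alpha> $ i"
    and g: "log_concave_on {0<..} g" "\<And>r. 0 < r \<Longrightarrow> 0 < g r"
    and l: "0 < l"
    and wd: "\<And>i. has_weak_pderiv_on f i (D i) pos_orthant"
  defines "K \<equiv> cbox (\<chi> i. l) (\<chi> i. u)" and "L \<equiv> cbox (\<chi> i. l) (\<chi> i. u + 1)"
  assumes f2: "set_integrable lborel L (\<lambda>x. (f x)\<^sup>2 * liouville_weight \<alpha> g x)"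
    and D2: "\<And>i. set_integrable lborel L (\<lambda>x. (D i x)\<^sup>2 * liouville_weight \<alpha> g x)"
  shows "(LINT x:K|lborel. liouville_weight \<alpha> g x) * (LINT x:K|lborel. (f x)\<^sup>2 * liouville_weight \<alpha> g x)
      - (LINT x:K|lborel. f x * liouville_weight \<alpha> g x)\<^sup>2
    \<le> (LINT x:K|lborel. liouville_weight \<alpha> g x)
      * (LINT x:K|lborel. (\<Sum>i\<in>UNIV. 1 / (\<alpha> $ i - 1) * (x $ i)\<^sup>2 * (D i x)\<^sup>2) * liouville_weight \<alpha> g x)"
proof -
  let ?W = "liouville_weight \<alpha> g"
  have KL: "K \<subseteq> L"
    unfolding K_def L_def by (intro subset_box_imp) (simp add: Basis_vec_def inner_axis)
  have Lorth: "L \<subseteq> pos_orthant" using l by (auto simp: L_def pos_orthant_def mem_box_cart intro: less_le_trans)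
  have cL: "compact L" and cK: "compact K" by (auto simp: K_def L_def)
  have [measurable]: "K \<in> sets borel" "L \<in> sets borel" by (auto simp: K_def L_def)
  have shift: "cbox x (x + (\<chi> i. 1)) \<subseteq> L" if "x \<in> K" for x
  proof
    fix z assume z: "z \<in> cbox x (x + (\<chi> i. 1))"
    have "l \<le> z $ i \<and> z $ i \<le> u + 1" for i
    proof -
      have "x $ i \<le> z $ i" "z $ i \<le> x $ i + 1" using z by (auto simp: mem_box_cart)
      moreover have "l \<le> x $ i" "x $ i \<le> u" using that by (auto simp: K_def mem_box_cart)
      ultimately show ?thesis by linarith
    qed
    then show "z \<in> L" by (auto simp: L_def mem_box_cart)
  qed
  have contL: "continuous_on L ?W"
    using continuous_on_liouville_weight[OF g(1)] Lorth by (rule continuous_on_subset)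
  have contK: "continuous_on K ?W" using contL KL by (rule continuous_on_subset)
  have Wpos: "0 < ?W x" if "x \<in> L" for x using that Lorth g(2) by (intro liouville_weight_pos) auto
  obtain B where B: "\<And>x. x \<in> L \<Longrightarrow> ?W x \<le> B" "0 \<le> B"
  proof -
    have "bounded (?W ` L)" using compact_imp_bounded[OF compact_continuous_image[OF contL cL]] .
    then obtain B where "\<forall>y\<in>?W ` L. norm y \<le> B" by (auto simp: bounded_iff)
    then show thesis by (intro that[of "max 0 B"]) (auto intro: order_trans[OF abs_ge_self] simp: max.coboundedI2)
  qed
  obtain b where b: "\<And>x. x \<in> L \<Longrightarrow> b \<le> ?W x" "0 < b"
  proof (cases "L = {}")
    case False
    then obtain x where "x \<in> L" "\<And>y. y \<in> L \<Longrightarrow> ?W x \<le> ?W y"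
      using continuous_attains_inf[OF cL False contL] by blast
    then show thesis using Wpos by (intro that[of "?W x"]) auto
  qed (use that[of 1] in auto)
  define f' D' where "f' x = indicator L x * f x" and "D' i x = indicator L x * D i x" for i x
  have meas: "(\<lambda>x. indicator L x * h x) \<in> borel_measurable borel"
    if "locally_integrable_on h pos_orthant" for h :: "real^'n \<Rightarrow> real"
  proof -
    have "set_integrable lborel L h" using that cL Lorth by (auto simp: locally_integrable_on_def)
    then show ?thesis by (auto simp: set_integrable_def dest: borel_measurable_integrable)
  qed
  have [measurable]: "f' \<in> borel_measurable borel" "D' i \<in> borel_measurable borel" for i
    unfolding f'_def[abs_def] D'_def[abs_def] using wd by (auto simp: has_weak_pderiv_on_def intro!: meas)
  define w where "w x = indicator K x * ?W x" for x
  have w_meas [measurable]: "w \<in> borel_measurable borel"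
    using borel_measurable_continuous_on_indicator[OF _ contK] by (simp add: w_def[abs_def])
  have w0: "0 \<le> w x" "w x \<le> B * indicator K x" for x
    using Wpos[of x] B(1)[of x] KL by (auto simp: w_def indicator_def less_imp_le)
  have Wint: "set_integrable lborel K ?W"
    unfolding set_integrable_def by (rule borel_integrable_compact[OF cK contK])
  \<comment> \<open>All integrals of the claim are integrals with respect to this finite measure.\<close>
  define M where "M = density lborel (\<lambda>x. ennreal (w x))"
  have [measurable_cong]: "sets M = sets borel" by (simp add: M_def)
  have emM: "(\<integral>\<^sup>+x. ennreal (w x) \<partial>lborel) < top"
    using Wint w0(1) by (simp add: set_integrable_def w_def[abs_def] nn_integral_eq_integral)
  interpret M: finite_measure M
    by (rule finite_measureI) (use emM in \<open>simp add: M_def emeasure_density\<close>)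
  have nnM: "(\<integral>\<^sup>+x. h x \<partial>M) = (\<integral>\<^sup>+x. ennreal (w x) * h x \<partial>lborel)"
    if "h \<in> borel_measurable borel" for h :: "real^'n \<Rightarrow> ennreal"
    using that unfolding M_def by (subst nn_integral_density) auto
  have intM: "(\<integral>x. h x \<partial>M) = (LINT x:K|lborel. h x * ?W x)"
    if "h \<in> borel_measurable borel" for h :: "real^'n \<Rightarrow> real"
  proof -
    have "(\<integral>x. h x \<partial>M) = (\<integral>x. w x *\<^sub>R h x \<partial>lborel)"
      unfolding M_def using that w0(1) by (intro integral_density) auto
    then show ?thesis by (simp add: set_lebesgue_integral_def w_def ac_simps)
  qed
  have fin: "(\<integral>\<^sup>+x. ennreal ((indicator L x * h x)\<^sup>2) \<partial>lborel) < top"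
    if "set_integrable lborel L (\<lambda>x. (h x)\<^sup>2 * ?W x)" for h
  proof -
    have int: "integrable lborel (\<lambda>x. indicator L x *\<^sub>R ((h x)\<^sup>2 * ?W x))" using that by (simp add: set_integrable_def)
    have "(\<integral>\<^sup>+x. ennreal ((indicator L x * h x)\<^sup>2) \<partial>lborel)
      \<le> (\<integral>\<^sup>+x. ennreal (indicator L x *\<^sub>R ((h x)\<^sup>2 * ?W x) / b) \<partial>lborel)"
    proof (intro nn_integral_mono ennreal_leI)
      fix x
      show "(indicator L x * h x)\<^sup>2 \<le> indicator L x *\<^sub>R ((h x)\<^sup>2 * ?W x) / b"
        using b mult_left_mono[OF b(1)[of x], of "(h x)\<^sup>2"] by (auto simp: indicator_def le_divide_eq)
    qed
    also have "\<dots> = ennreal (\<integral>x. indicator L x *\<^sub>R ((h x)\<^sup>2 * ?W x) / b \<partial>lborel)"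
      using int b Wpos by (intro nn_integral_eq_integral) (auto simp: indicator_def less_imp_le)
    finally show ?thesis by (rule le_less_trans) simp
  qed
  have f2': "(\<integral>\<^sup>+x. ennreal ((f' x)\<^sup>2) \<partial>lborel) < top" and D2': "(\<integral>\<^sup>+x. ennreal ((D' i x)\<^sup>2) \<partial>lborel) < top" for i
    unfolding f'_def D'_def using fin[OF f2] fin[OF D2] by auto
  define a where "a = max \<bar>u\<bar> 0"
  have xa: "(x $ i)\<^sup>2 \<le> a\<^sup>2" if "x \<in> K" for x i
    using that l by (intro power_mono) (auto simp: K_def mem_box_cart a_def intro: order_trans less_imp_le)
  have L2M: "v \<in> L2 M" if [measurable]: "v \<in> borel_measurable borel"
    and v: "\<And>x. x \<in> K \<Longrightarrow> (v x)\<^sup>2 \<le> C * (h x)\<^sup>2" "0 \<le> C" and h: "(\<integral>\<^sup>+x. ennreal ((h x)\<^sup>2) * indicator K x \<partial>lborel) < top"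
    and [measurable]: "h \<in> borel_measurable borel"
    for v h :: "real^'n \<Rightarrow> real" and C
  proof -
    have "(\<integral>\<^sup>+x. ennreal ((v x)\<^sup>2) \<partial>M) \<le> (\<integral>\<^sup>+x. ennreal (B * C) * (ennreal ((h x)\<^sup>2) * indicator K x) \<partial>lborel)"
    proof (subst nnM, measurable, intro nn_integral_mono)
      fix x
      have "w x * (v x)\<^sup>2 \<le> (B * indicator K x) * (C * (h x)\<^sup>2)"
        using w0[of x] v(1)[of x] v(2) by (cases "x \<in> K") (auto intro!: mult_mono simp: w_def B)
      then have "ennreal (w x * (v x)\<^sup>2) \<le> ennreal ((B * indicator K x) * (C * (h x)\<^sup>2))" by (rule ennreal_leI)
      also have "\<dots> = ennreal (B * C) * (ennreal ((h x)\<^sup>2) * indicator K x)"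
        using B v(2) by (auto simp: indicator_def mult.assoc simp flip: ennreal_mult)
      finally show "ennreal (w x) * ennreal ((v x)\<^sup>2) \<le> ennreal (B * C) * (ennreal ((h x)\<^sup>2) * indicator K x)"
        using w0 by (simp flip: ennreal_mult)
    qed
    also have "\<dots> < top" using h by (simp add: nn_integral_cmult ennreal_mult_less_top)
    finally have "(\<integral>\<^sup>+x. ennreal ((v x)\<^sup>2) \<partial>M) < top" .
    then show ?thesis by (auto simp: L2_def integrable_iff_bounded)
  qed
  have finK: "(\<integral>\<^sup>+x. ennreal ((h x)\<^sup>2) * indicator K x \<partial>lborel) < top"
    if "(\<integral>\<^sup>+x. ennreal ((h x)\<^sup>2) \<partial>lborel) < top" for h :: "real^'n \<Rightarrow> real"
    by (rule le_less_trans[OF nn_integral_mono that]) (auto simp: indicator_def)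
  have u_int: "integrable lborel h"
    if "(\<integral>\<^sup>+x. ennreal ((h x)\<^sup>2) \<partial>lborel) < top" "\<And>x. x \<notin> L \<Longrightarrow> h x = 0" and [measurable]: "h \<in> borel_measurable borel"
    for h :: "real^'n \<Rightarrow> real"
  proof -
    have "(\<lambda>x. (indicator L x)\<^sup>2) = (indicator L :: real^'n \<Rightarrow> real)" by (auto simp: indicator_def)
    then have "(\<lambda>x. indicator L x) \<in> L2 (lborel :: (real^'n) measure)"
      using emeasure_bounded_finite[OF compact_imp_bounded[OF cL]] by (simp add: L2_def)
    moreover have "h \<in> L2 lborel" using that by (auto simp: L2_def integrable_iff_bounded)
    ultimately have "integrable lborel (\<lambda>x. indicator L x * h x)" by (rule L2_mult_integrable)
    also have "(\<lambda>x. indicator L x * h x) = h"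
    proof
      fix x show "indicator L x * h x = h x" using that(2)[of x] by (cases "x \<in> L") auto
    qed
    finally show ?thesis .
  qed
  have f'_int: "integrable lborel f'" and D'_int: "integrable lborel (D' i)" for i
    using f2' D2' by (auto intro!: u_int simp: f'_def[of x for x] D'_def[of _ x for x])
  have step: "(\<integral>x. 1 \<partial>M) * (\<integral>x. (mollify \<epsilon> f' x)\<^sup>2 \<partial>M) - (\<integral>x. mollify \<epsilon> f' x \<partial>M)\<^sup>2
    \<le> (\<integral>x. 1 \<partial>M) * (\<Sum>i\<in>UNIV. 1 / (\<alpha> $ i - 1) * (\<integral>x. (x $ i * mollify \<epsilon> (D' i) x)\<^sup>2 \<partial>M))"
    if \<epsilon>: "0 < \<epsilon>" "\<epsilon> < 1" for \<epsilon>
  proof -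
    obtain B0 where B0: "\<And>x. \<bar>mollify \<epsilon> f' x\<bar> \<le> B0" using mollify_bounded[OF f'_int] by blast
    have "\<forall>i. \<exists>B. \<forall>x. \<bar>mollify \<epsilon> (D' i) x\<bar> \<le> B" using mollify_bounded[OF D'_int] by blast
    then obtain B1 where B1: "\<And>i x. \<bar>mollify \<epsilon> (D' i) x\<bar> \<le> B1 i" by metis
    define B2 where "B2 = \<bar>B0\<bar> + (\<Sum>i\<in>UNIV. \<bar>B1 i\<bar>)"
    have B1s: "\<bar>B1 i\<bar> \<le> (\<Sum>i\<in>UNIV. \<bar>B1 i\<bar>)" for i by (rule member_le_sum) auto
    have sn: "0 \<le> (\<Sum>i\<in>UNIV. \<bar>B1 i\<bar>)" by (rule sum_nonneg) auto
    have B2: "\<bar>mollify \<epsilon> f' x\<bar> \<le> B2" "\<bar>mollify \<epsilon> (D' i) x\<bar> \<le> B2" for x i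
      using B0[of x] B1[of i x] B1s[of i] sn unfolding B2_def by linarith+
    obtain C where C: "\<And>x y. \<bar>mollify \<epsilon> f' y - mollify \<epsilon> f' x
      - (\<Sum>i\<in>UNIV. (y $ i - x $ i) * (- (\<integral>z. f' z * kernel_partial i \<epsilon> (z - x) \<partial>lborel) / kernel_mass TYPE('n) \<epsilon>))\<bar>
      \<le> C * (\<Sum>i\<in>UNIV. (y $ i - x $ i)\<^sup>2)" using mollify_taylor[OF f'_int] by blast
    have grad: "- (\<integral>z. f' z * kernel_partial i \<epsilon> (z - x) \<partial>lborel) / kernel_mass TYPE('n) \<epsilon> = mollify \<epsilon> (D' i) x"
      if "x \<in> K" for i x
    proof -
      have "cbox x (x + (\<chi> i. \<epsilon>)) \<subseteq> cbox x (x + (\<chi> i. 1))"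
        by (intro subset_box_imp) (use \<epsilon> in \<open>auto simp: Basis_vec_def inner_axis\<close>)
      then show ?thesis
        unfolding f'_def D'_def[abs_def] using shift[OF that] Lorth
        by (intro mollify_weak_pderiv[OF wd \<epsilon>(1)]) auto
    qed
    have "(LINT x:K|lborel. ?W x) * (LINT x:K|lborel. (mollify \<epsilon> f' x)\<^sup>2 * ?W x)
        - (LINT x:K|lborel. mollify \<epsilon> f' x * ?W x)\<^sup>2
      \<le> (LINT x:K|lborel. ?W x)
        * (LINT x:K|lborel. (\<Sum>i\<in>UNIV. 1 / (\<alpha> $ i - 1) * (x $ i)\<^sup>2 * (mollify \<epsilon> (D' i) x)\<^sup>2) * ?W x)"
    proof (rule brascamp_lieb_convex[where u=u and M=B2 and C=C])
      show "convex K" by (simp add: K_def convex_box)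
      show "0 < x $ i" if "x \<in> K" for x i using that KL Lorth by (auto simp: pos_orthant_def)
      show "x $ i \<le> u" if "x \<in> K" for x i using that by (auto simp: K_def mem_box_cart)
      show "\<bar>mollify \<epsilon> f' y - mollify \<epsilon> f' x - (\<Sum>i\<in>UNIV. (y $ i - x $ i) * mollify \<epsilon> (D' i) x)\<bar>
        \<le> C * (\<Sum>i\<in>UNIV. (y $ i - x $ i)\<^sup>2)" if "x \<in> K" for x y
        using C[of y x] by (simp only: grad[OF that])
    qed (use \<alpha> g B2 Wint in auto)
    also have "(LINT x:K|lborel. ?W x) = (\<integral>x. 1 \<partial>M)" by (subst intM) auto
    also have "(LINT x:K|lborel. (mollify \<epsilon> f' x)\<^sup>2 * ?W x) = (\<integral>x. (mollify \<epsilon> f' x)\<^sup>2 \<partial>M)" by (subst intM) auto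
    also have "(LINT x:K|lborel. mollify \<epsilon> f' x * ?W x) = (\<integral>x. mollify \<epsilon> f' x \<partial>M)" by (subst intM) auto
    also have "(LINT x:K|lborel. (\<Sum>i\<in>UNIV. 1 / (\<alpha> $ i - 1) * (x $ i)\<^sup>2 * (mollify \<epsilon> (D' i) x)\<^sup>2) * ?W x)
      = (\<integral>x. (\<Sum>i\<in>UNIV. 1 / (\<alpha> $ i - 1) * (x $ i * mollify \<epsilon> (D' i) x)\<^sup>2) \<partial>M)"
      by (subst intM) (auto simp: power_mult_distrib mult.assoc)
    also have "\<dots> = (\<Sum>i\<in>UNIV. 1 / (\<alpha> $ i - 1) * (\<integral>x. (x $ i * mollify \<epsilon> (D' i) x)\<^sup>2 \<partial>M))"
    proof -
      have "(\<lambda>x. x $ i * mollify \<epsilon> (D' i) x) \<in> L2 M" for i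
      proof (rule L2M[where C="a\<^sup>2 * B2\<^sup>2" and h="\<lambda>_. 1"])
        show "(x $ i * mollify \<epsilon> (D' i) x)\<^sup>2 \<le> a\<^sup>2 * B2\<^sup>2 * 1\<^sup>2" if "x \<in> K" for x
          unfolding power_mult_distrib using xa[OF that, of i] B2(2)[of i x]
          by (simp add: mult_mono abs_le_square_iff[symmetric])
        show "(\<integral>\<^sup>+x. ennreal (1\<^sup>2) * indicator K x \<partial>(lborel :: (real^'n) measure)) < top"
          using emeasure_bounded_finite[OF compact_imp_bounded[OF cK]] by simp
      qed auto
      then show ?thesis by (simp add: L2_def)
    qed
    finally show ?thesis .
  qed
  \<comment> \<open>The factor \<open>k\<close> is 1 for \<open>f\<close> and the coordinate \<open>x $ i\<close> for the partial derivatives.\<close>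
  have lims: "((\<lambda>\<epsilon>. \<integral>x. (k x * mollify \<epsilon> h x)\<^sup>2 \<partial>M) \<longlongrightarrow> (\<integral>x. (k x * h x)\<^sup>2 \<partial>M)) (at_right 0) \<and>
      ((\<lambda>\<epsilon>. \<integral>x. k x * mollify \<epsilon> h x \<partial>M) \<longlongrightarrow> (\<integral>x. k x * h x \<partial>M)) (at_right 0)"
    if h: "(\<integral>\<^sup>+x. ennreal ((h x)\<^sup>2) \<partial>lborel) < top" "\<And>x. x \<notin> L \<Longrightarrow> h x = 0"
      and [measurable]: "h \<in> borel_measurable borel" "k \<in> borel_measurable borel"
      and k: "\<And>x. x \<in> K \<Longrightarrow> (k x)\<^sup>2 \<le> C"
    for h k :: "real^'n \<Rightarrow> real" and C
  proof -
    have kC: "(k x)\<^sup>2 \<le> max C 0" if "x \<in> K" for x using k[OF that] by simp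
    have kh: "(\<lambda>x. k x * h x) \<in> L2 M"
      by (rule L2M[where C="max C 0" and h=h])
         (use kC in \<open>auto simp: power_mult_distrib intro!: mult_right_mono finK h(1)\<close>)
    have km: "(\<lambda>x. k x * mollify \<epsilon> h x) \<in> L2 M" for \<epsilon>
    proof -
      obtain B3 where B3: "\<And>x. \<bar>mollify \<epsilon> h x\<bar> \<le> B3" using mollify_bounded[OF u_int[OF h]] by auto
      show ?thesis
      proof (rule L2M[where C="max C 0 * B3\<^sup>2" and h="\<lambda>_. 1"])
        show "(k x * mollify \<epsilon> h x)\<^sup>2 \<le> max C 0 * B3\<^sup>2 * 1\<^sup>2" if "x \<in> K" for x
        proof -
          have "(mollify \<epsilon> h x)\<^sup>2 \<le> B3\<^sup>2" using B3[of x] by (simp add: abs_le_square_iff[symmetric])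
          then show ?thesis unfolding power_mult_distrib using kC[OF that] by (auto intro!: mult_mono)
        qed
        show "(\<integral>\<^sup>+x. ennreal (1\<^sup>2) * indicator K x \<partial>(lborel :: (real^'n) measure)) < top"
          using emeasure_bounded_finite[OF compact_imp_bounded[OF cK]] by simp
      qed auto
    qed
    have conv: "((\<lambda>\<epsilon>. \<integral>\<^sup>+x. ennreal ((mollify \<epsilon> h x - h x)\<^sup>2) * indicator K x \<partial>lborel) \<longlongrightarrow> 0) (at_right 0)"
      by (rule mollify_tendsto_L2[OF cL _ KL, of 1]) (use shift h in auto)
    have "((\<lambda>\<epsilon>. \<integral>\<^sup>+x. ennreal ((k x * mollify \<epsilon> h x - k x * h x)\<^sup>2) \<partial>M) \<longlongrightarrow> 0) (at_right 0)"
    proof (rule tendsto_sandwich[OF always_eventually always_eventually tendsto_const])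
      show "\<forall>\<epsilon>. (\<integral>\<^sup>+x. ennreal ((k x * mollify \<epsilon> h x - k x * h x)\<^sup>2) \<partial>M)
        \<le> ennreal (B * max C 0) * (\<integral>\<^sup>+x. ennreal ((mollify \<epsilon> h x - h x)\<^sup>2) * indicator K x \<partial>lborel)"
      proof
        fix \<epsilon>
        have "(\<integral>\<^sup>+x. ennreal ((k x * mollify \<epsilon> h x - k x * h x)\<^sup>2) \<partial>M)
          \<le> (\<integral>\<^sup>+x. ennreal (B * max C 0) * (ennreal ((mollify \<epsilon> h x - h x)\<^sup>2) * indicator K x) \<partial>lborel)"
        proof (subst nnM, measurable, intro nn_integral_mono)
          fix x
          let ?d = "mollify \<epsilon> h x - h x"
          have "w x * ((k x)\<^sup>2 * ?d\<^sup>2) \<le> (B * indicator K x) * (max C 0 * ?d\<^sup>2)"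
            using w0[of x] kC[of x] B(2) by (cases "x \<in> K") (auto intro!: mult_mono simp: w_def)
          then have "ennreal (w x * ((k x)\<^sup>2 * ?d\<^sup>2)) \<le> ennreal ((B * indicator K x) * (max C 0 * ?d\<^sup>2))" by (rule ennreal_leI)
          also have "\<dots> = ennreal (B * max C 0) * (ennreal (?d\<^sup>2) * indicator K x)"
            using B by (auto simp: indicator_def mult.assoc simp flip: ennreal_mult)
          also have "(k x)\<^sup>2 * ?d\<^sup>2 = (k x * mollify \<epsilon> h x - k x * h x)\<^sup>2"
            by (simp add: power2_eq_square algebra_simps)
          finally show "ennreal (w x) * ennreal ((k x * mollify \<epsilon> h x - k x * h x)\<^sup>2)
            \<le> ennreal (B * max C 0) * (ennreal (?d\<^sup>2) * indicator K x)"
            using w0 by (simp flip: ennreal_mult)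
        qed
        also have "\<dots> = ennreal (B * max C 0) * (\<integral>\<^sup>+x. ennreal ((mollify \<epsilon> h x - h x)\<^sup>2) * indicator K x \<partial>lborel)"
          by (intro nn_integral_cmult) measurable
        finally show "(\<integral>\<^sup>+x. ennreal ((k x * mollify \<epsilon> h x - k x * h x)\<^sup>2) \<partial>M)
          \<le> ennreal (B * max C 0) * (\<integral>\<^sup>+x. ennreal ((mollify \<epsilon> h x - h x)\<^sup>2) * indicator K x \<partial>lborel)" .
      qed
      show "((\<lambda>\<epsilon>. ennreal (B * max C 0) * (\<integral>\<^sup>+x. ennreal ((mollify \<epsilon> h x - h x)\<^sup>2) * indicator K x \<partial>lborel)) \<longlongrightarrow> 0) (at_right 0)"
        using ennreal_tendsto_cmult[OF _ conv, of "ennreal (B * max C 0)"] by simp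
    qed simp
    from L2_limit(1)[OF kh km this] L2_limit(2)[OF kh km this M.finite_measure_axioms]
    show ?thesis by simp
  qed
  have f_lims: "((\<lambda>\<epsilon>. \<integral>x. (mollify \<epsilon> f' x)\<^sup>2 \<partial>M) \<longlongrightarrow> (\<integral>x. (f' x)\<^sup>2 \<partial>M)) (at_right 0)"
      "((\<lambda>\<epsilon>. \<integral>x. mollify \<epsilon> f' x \<partial>M) \<longlongrightarrow> (\<integral>x. f' x \<partial>M)) (at_right 0)"
    using lims[of f' "\<lambda>_. 1" 1] f2' by (auto simp: f'_def[of x for x])
  have D_lims: "((\<lambda>\<epsilon>. \<integral>x. (x $ i * mollify \<epsilon> (D' i) x)\<^sup>2 \<partial>M) \<longlongrightarrow> (\<integral>x. (x $ i * D' i x)\<^sup>2 \<partial>M)) (at_right 0)" for i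
    using lims[of "D' i" "\<lambda>x. x $ i" "a\<^sup>2"] D2' xa by (auto simp: D'_def[of _ x for x])
  have lim: "(\<integral>x. 1 \<partial>M) * (\<integral>x. (f' x)\<^sup>2 \<partial>M) - (\<integral>x. f' x \<partial>M)\<^sup>2
    \<le> (\<integral>x. 1 \<partial>M) * (\<Sum>i\<in>UNIV. 1 / (\<alpha> $ i - 1) * (\<integral>x. (x $ i * D' i x)\<^sup>2 \<partial>M))"
  proof (rule tendsto_le[OF trivial_limit_at_right_real])
    show "((\<lambda>\<epsilon>. (\<integral>x. 1 \<partial>M) * (\<integral>x. (mollify \<epsilon> f' x)\<^sup>2 \<partial>M) - (\<integral>x. mollify \<epsilon> f' x \<partial>M)\<^sup>2)
      \<longlongrightarrow> (\<integral>x. 1 \<partial>M) * (\<integral>x. (f' x)\<^sup>2 \<partial>M) - (\<integral>x. f' x \<partial>M)\<^sup>2) (at_right 0)"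
      by (intro tendsto_intros f_lims)
    show "((\<lambda>\<epsilon>. (\<integral>x. 1 \<partial>M) * (\<Sum>i\<in>UNIV. 1 / (\<alpha> $ i - 1) * (\<integral>x. (x $ i * mollify \<epsilon> (D' i) x)\<^sup>2 \<partial>M)))
      \<longlongrightarrow> (\<integral>x. 1 \<partial>M) * (\<Sum>i\<in>UNIV. 1 / (\<alpha> $ i - 1) * (\<integral>x. (x $ i * D' i x)\<^sup>2 \<partial>M))) (at_right 0)"
      by (intro tendsto_intros D_lims)
    show "eventually (\<lambda>\<epsilon>. (\<integral>x. 1 \<partial>M) * (\<integral>x. (mollify \<epsilon> f' x)\<^sup>2 \<partial>M) - (\<integral>x. mollify \<epsilon> f' x \<partial>M)\<^sup>2
      \<le> (\<integral>x. 1 \<partial>M) * (\<Sum>i\<in>UNIV. 1 / (\<alpha> $ i - 1) * (\<integral>x. (x $ i * mollify \<epsilon> (D' i) x)\<^sup>2 \<partial>M))) (at_right 0)"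
      by (rule eventually_mono[OF eventually_at_right_real[OF zero_less_one]], rule step) simp_all
  qed
  have DL2: "(\<lambda>x. x $ i * D' i x) \<in> L2 M" for i
    by (rule L2M[where C="a\<^sup>2" and h="D' i"])
       (use xa D2' in \<open>auto simp: power_mult_distrib intro!: mult_right_mono finK\<close>)
  have "(\<Sum>i\<in>UNIV. 1 / (\<alpha> $ i - 1) * (\<integral>x. (x $ i * D' i x)\<^sup>2 \<partial>M))
    = (\<integral>x. (\<Sum>i\<in>UNIV. 1 / (\<alpha> $ i - 1) * (x $ i * D' i x)\<^sup>2) \<partial>M)"
    using DL2 by (simp add: L2_def)
  also have "\<dots> = (LINT x:K|lborel. (\<Sum>i\<in>UNIV. 1 / (\<alpha> $ i - 1) * (x $ i * D' i x)\<^sup>2) * ?W x)"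
    by (rule intM) measurable
  also have "\<dots> = (LINT x:K|lborel. (\<Sum>i\<in>UNIV. 1 / (\<alpha> $ i - 1) * (x $ i)\<^sup>2 * (D i x)\<^sup>2) * ?W x)"
    using KL by (intro set_lebesgue_integral_cong) (auto simp: D'_def power_mult_distrib mult.assoc subset_iff)
  finally have e1: "(\<Sum>i\<in>UNIV. 1 / (\<alpha> $ i - 1) * (\<integral>x. (x $ i * D' i x)\<^sup>2 \<partial>M))
    = (LINT x:K|lborel. (\<Sum>i\<in>UNIV. 1 / (\<alpha> $ i - 1) * (x $ i)\<^sup>2 * (D i x)\<^sup>2) * ?W x)" .
  have e2: "(\<integral>x. (f' x)\<^sup>2 \<partial>M) = (LINT x:K|lborel. (f x)\<^sup>2 * ?W x)"
    using KL by (subst intM, measurable) (intro set_lebesgue_integral_cong, auto simp: f'_def)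
  have e3: "(\<integral>x. f' x \<partial>M) = (LINT x:K|lborel. f x * ?W x)"
    using KL by (subst intM, measurable) (intro set_lebesgue_integral_cong, auto simp: f'_def)
  have e4: "(\<integral>x. 1 \<partial>M) = (LINT x:K|lborel. ?W x)" by (subst intM) auto
  show ?thesis using lim unfolding e1 e2 e3 e4 .
qed

section \<open>The Liouville distribution\<close>

lemma borel_pos_orthant [measurable]: "pos_orthant \<in> sets (borel :: (real^'n::finite) measure)"
proof -
  have "open {x :: real^'n. 0 < x $ i}" for i by (intro open_Collect_less continuous_intros)
  then have "open (\<Inter>i. {x :: real^'n. 0 < x $ i})" by (intro open_INT) auto
  also have "(\<Inter>i. {x :: real^'n. 0 < x $ i}) = pos_orthant" by (auto simp: pos_orthant_def)
  finally show ?thesis by simp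
qed

lemma liouville_Z_pos:
  fixes \<alpha> :: "real^'n::finite"
  assumes "liouville_normalizable \<alpha> g" "\<And>r. 0 < r \<Longrightarrow> 0 < g r"
  shows "0 < liouville_Z \<alpha> g"
proof -
  let ?w = "\<lambda>x. indicator pos_orthant x *\<^sub>R liouville_weight \<alpha> g x"
  have w0: "0 \<le> ?w x" for x
    using liouville_weight_pos[of x g \<alpha>] assms(2) by (auto simp: indicator_def less_imp_le)
  have int: "integrable lborel ?w" using assms(1) by (simp add: liouville_normalizable_def set_integrable_def)
  have "liouville_Z \<alpha> g \<noteq> 0"
  proof
    assume "liouville_Z \<alpha> g = 0"
    then have "AE x in lborel. ?w x = 0"
      using integral_nonneg_eq_0_iff_AE[OF int] w0 by (simp add: liouville_Z_def set_lebesgue_integral_def)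
    moreover have "?w x \<noteq> 0" if "x \<in> box 0 (\<chi> i. 1)" for x
    proof -
      have "x \<in> pos_orthant" using that by (auto simp: mem_box_cart pos_orthant_def)
      then show ?thesis using liouville_weight_pos[of x g \<alpha>] assms(2) by auto
    qed
    ultimately have "AE x in lborel. x \<notin> box 0 ((\<chi> i. 1) :: real^'n)" by (metis (mono_tags, lifting) eventually_mono)
    then show False using not_AE_notin_cube[OF zero_less_one] by blast
  qed
  moreover have "0 \<le> liouville_Z \<alpha> g"
    unfolding liouville_Z_def set_lebesgue_integral_def using w0 by (intro Bochner_Integration.integral_nonneg)
  ultimately show ?thesis by simp
qed

lemma liouville_integral:
  fixes \<alpha> :: "real^'n::finite" and h :: "real^'n \<Rightarrow> real"
  assumes norm: "liouville_normalizable \<alpha> g" and g: "\<And>r. 0 < r \<Longrightarrow> 0 < g r"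
    and h: "h \<in> borel_measurable (liouville \<alpha> g)"
  shows "integrable (liouville \<alpha> g) h \<longleftrightarrow> set_integrable lborel pos_orthant (\<lambda>x. h x * liouville_weight \<alpha> g x)"
    and "(\<integral>x. h x \<partial>liouville \<alpha> g)
      = inverse (liouville_Z \<alpha> g) * (LINT x:pos_orthant|lborel. h x * liouville_weight \<alpha> g x)"
proof -
  let ?R = "restrict_space lborel (pos_orthant :: (real^'n) set)" and ?W = "liouville_weight \<alpha> g"
  have Z: "0 < liouville_Z \<alpha> g" by (rule liouville_Z_pos[OF norm g])
  have h': "h \<in> borel_measurable ?R" using h by (simp add: liouville_def)
  have "(\<lambda>x. indicator pos_orthant x *\<^sub>R ?W x) \<in> borel_measurable lborel"
    using norm by (auto simp: liouville_normalizable_def set_integrable_def)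
  then have "?W \<in> borel_measurable ?R"
    by (subst borel_measurable_restrict_space_iff) auto
  then have d: "liouville_density \<alpha> g \<in> borel_measurable ?R"
    unfolding liouville_density_def[abs_def] by measurable
  have dpos: "AE x in ?R. 0 \<le> liouville_density \<alpha> g x"
    using Z liouville_weight_pos[of _ g \<alpha>] g
    by (intro AE_I2) (auto simp: liouville_density_def space_restrict_space less_imp_le)
  have eq: "indicator pos_orthant x *\<^sub>R (liouville_density \<alpha> g x *\<^sub>R h x)
    = inverse (liouville_Z \<alpha> g) * (indicator pos_orthant x *\<^sub>R (h x * ?W x))" for x
    by (simp add: liouville_density_def ac_simps)
  have "integrable (liouville \<alpha> g) h \<longleftrightarrow> integrable ?R (\<lambda>x. liouville_density \<alpha> g x *\<^sub>R h x)"
    unfolding liouville_def using h' d dpos by (intro integrable_density)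
  also have "\<dots> \<longleftrightarrow> integrable lborel (\<lambda>x. indicator pos_orthant x *\<^sub>R (liouville_density \<alpha> g x *\<^sub>R h x))"
    by (intro integrable_restrict_space) simp
  also have "\<dots> \<longleftrightarrow> set_integrable lborel pos_orthant (\<lambda>x. h x * ?W x)"
    unfolding eq set_integrable_def using Z by simp
  finally show "integrable (liouville \<alpha> g) h \<longleftrightarrow> set_integrable lborel pos_orthant (\<lambda>x. h x * ?W x)" .
  have "(\<integral>x. h x \<partial>liouville \<alpha> g) = (\<integral>x. liouville_density \<alpha> g x *\<^sub>R h x \<partial>?R)"
    unfolding liouville_def using h' d dpos by (intro integral_density)
  also have "\<dots> = (\<integral>x. indicator pos_orthant x *\<^sub>R (liouville_density \<alpha> g x *\<^sub>R h x) \<partial>lborel)"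
    by (intro integral_restrict_space) simp
  also have "\<dots> = inverse (liouville_Z \<alpha> g) * (LINT x:pos_orthant|lborel. h x * ?W x)"
    unfolding eq set_lebesgue_integral_def by simp
  finally show "(\<integral>x. h x \<partial>liouville \<alpha> g) = inverse (liouville_Z \<alpha> g) * (LINT x:pos_orthant|lborel. h x * ?W x)" .
qed

theorem proposition3p3:
  fixes \<alpha> :: "real^'n::finite" and g :: "real \<Rightarrow> real"
    and f :: "real^'n \<Rightarrow> real" and D :: "'n \<Rightarrow> real^'n \<Rightarrow> real"
  assumes "\<And>i. 0 < \<alpha> $ i"
    and "\<And>r. 0 < r \<Longrightarrow> 0 < g r"
    and "liouville_normalizable \<alpha> g"
    and "log_concave_on {0<..} g"
    and "1 < (\<Sum>i\<in>UNIV. \<alpha> $ i)"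
    and "\<And>i. 1 < \<alpha> $ i"
    and "f \<in> L2 (liouville \<alpha> g)"
    and "\<And>i. has_weak_pderiv_on f i (D i) pos_orthant"
    and "integrable (liouville \<alpha> g) (\<lambda>x. \<Sum>i\<in>UNIV. 1 / (\<alpha> $ i - 1) * (x $ i)\<^sup>2 * (D i x)\<^sup>2)"
  shows "Var (liouville \<alpha> g) f
    \<le> (LINT x|liouville \<alpha> g. (\<Sum>i\<in>UNIV. 1 / (\<alpha> $ i - 1) * (x $ i)\<^sup>2 * (D i x)\<^sup>2))"
proof -
  let ?W = "liouville_weight \<alpha> g" and ?O = "pos_orthant :: (real^'n) set" and ?\<mu> = "liouville \<alpha> g"
  let ?S = "\<lambda>x. \<Sum>i\<in>UNIV. 1 / (\<alpha> $ i - 1) * (x $ i)\<^sup>2 * (D i x)\<^sup>2"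
  note g = assms(2) and norm = assms(3) and \<alpha> = assms(6) and wd = assms(8)
  define Z where "Z = liouville_Z \<alpha> g"
  have Z: "0 < Z" unfolding Z_def by (rule liouville_Z_pos[OF norm g])
  have Wpos: "0 < ?W x" if "x \<in> ?O" for x using that g by (intro liouville_weight_pos) auto
  have Wint: "set_integrable lborel ?O ?W" using norm by (simp add: liouville_normalizable_def)
  have f_meas [measurable]: "f \<in> borel_measurable ?\<mu>" using assms(7) by (simp add: L2_def)
  have f2_int: "set_integrable lborel ?O (\<lambda>x. (f x)\<^sup>2 * ?W x)"
    using assms(7) liouville_integral(1)[OF norm g, where h="\<lambda>x. (f x)\<^sup>2"] by (simp add: L2_def)
  have S_int: "set_integrable lborel ?O (\<lambda>x. ?S x * ?W x)"
    using assms(9) liouville_integral(1)[OF norm g borel_measurable_integrable[OF assms(9)]] by simp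
  have f_int: "set_integrable lborel ?O (\<lambda>x. f x * ?W x)"
  proof -
    have "integrable ?\<mu> (\<lambda>_. 1 :: real)"
      using Wint liouville_integral(1)[OF norm g, where h="\<lambda>_. 1"] by simp
    then have "(\<lambda>_. 1) \<in> L2 ?\<mu>" by (simp add: L2_def)
    from L2_mult_integrable[OF this assms(7)] show ?thesis
      using liouville_integral(1)[OF norm g, where h=f] by simp
  qed
  \<comment> \<open>The boxes \<open>K k\<close> exhaust the orthant. \<open>L k\<close> is \<open>K k\<close> enlarged upwards by the room that
    mollification needs.\<close>
  define K L :: "nat \<Rightarrow> (real^'n) set"
    where "K k = cbox (\<chi> i. 1 / real (k + 1)) (\<chi> i. real k)"
      and "L k = cbox (\<chi> i. 1 / real (k + 1)) (\<chi> i. real k + 1)" for k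
  have LO: "L k \<subseteq> ?O" for k
  proof
    fix x assume x: "x \<in> L k"
    have "0 < x $ i" for i
    proof -
      have "1 / real (k + 1) \<le> x $ i" using x by (auto simp: L_def mem_box_cart)
      moreover have "0 < 1 / real (k + 1)" by simp
      ultimately show ?thesis by linarith
    qed
    then show "x \<in> ?O" by (simp add: pos_orthant_def)
  qed
  \<comment> \<open>On \<open>L k\<close> the coordinates are at least \<open>1 / (k + 1)\<close>, so that a multiple of the energy
    density dominates the square of each partial derivative.\<close>
  have D2_int: "set_integrable lborel (L k) (\<lambda>x. (D i x)\<^sup>2 * ?W x)" for k i
  proof -
    define c where "c = (\<alpha> $ i - 1) * (real (k + 1))\<^sup>2"
    have [measurable]: "L k \<in> sets borel" by (simp add: L_def)
    have SL: "set_integrable lborel (L k) (\<lambda>x. c * (?S x * ?W x))"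
      using set_integrable_subset[OF S_int _ LO] by (intro set_integrable_mult_right) simp
    show ?thesis
      unfolding set_integrable_def
    proof (rule Bochner_Integration.integrable_bound[OF SL[unfolded set_integrable_def]])
      have "set_integrable lborel (L k) (D i)" "set_integrable lborel (L k) ?W"
        using wd[of i] LO[of k] set_integrable_subset[OF Wint _ LO[of k]]
        by (auto simp: has_weak_pderiv_on_def locally_integrable_on_def L_def)
      then have [measurable]: "(\<lambda>x. indicator (L k) x *\<^sub>R D i x) \<in> borel_measurable borel"
          "(\<lambda>x. indicator (L k) x *\<^sub>R ?W x) \<in> borel_measurable borel"
        by (auto simp: set_integrable_def)
      have "(\<lambda>x. (indicator (L k) x *\<^sub>R D i x)\<^sup>2 * (indicator (L k) x *\<^sub>R ?W x)) \<in> borel_measurable borel"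
        by measurable
      also have "(\<lambda>x. (indicator (L k) x *\<^sub>R D i x)\<^sup>2 * (indicator (L k) x *\<^sub>R ?W x))
          = (\<lambda>x. indicator (L k) x *\<^sub>R ((D i x)\<^sup>2 * ?W x))" by (auto simp: indicator_def fun_eq_iff)
      finally show "(\<lambda>x. indicator (L k) x *\<^sub>R ((D i x)\<^sup>2 * ?W x)) \<in> borel_measurable lborel" by simp
      show "AE x in lborel. norm (indicator (L k) x *\<^sub>R ((D i x)\<^sup>2 * ?W x))
        \<le> norm (indicator (L k) x *\<^sub>R (c * (?S x * ?W x)))"
      proof (intro AE_I2)
        fix x
        show "norm (indicator (L k) x *\<^sub>R ((D i x)\<^sup>2 * ?W x)) \<le> norm (indicator (L k) x *\<^sub>R (c * (?S x * ?W x)))"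
        proof (cases "x \<in> L k")
          case True
          have W: "0 < ?W x" using True LO by (intro Wpos) auto
          have xi: "1 / real (k + 1) \<le> x $ i" using True by (auto simp: L_def mem_box_cart)
          then have "1 \<le> real (k + 1) * x $ i" by (simp add: field_simps)
          then have "1\<^sup>2 \<le> (real (k + 1) * x $ i)\<^sup>2" by (intro power_mono) auto
          then have "1 * (D i x)\<^sup>2 \<le> (real (k + 1) * x $ i)\<^sup>2 * (D i x)\<^sup>2" by (intro mult_right_mono) auto
          also have "\<dots> = c * (1 / (\<alpha> $ i - 1) * (x $ i)\<^sup>2 * (D i x)\<^sup>2)"
            using \<alpha>[of i] by (simp add: c_def power_mult_distrib)
          also have "\<dots> \<le> c * ?S x"
          proof (intro mult_left_mono)
            show "1 / (\<alpha> $ i - 1) * (x $ i)\<^sup>2 * (D i x)\<^sup>2 \<le> ?S x"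
              using \<alpha> by (intro member_le_sum[where f="\<lambda>i. 1 / (\<alpha> $ i - 1) * (x $ i)\<^sup>2 * (D i x)\<^sup>2"])
                (auto simp: less_imp_le)
            show "0 \<le> c" using \<alpha>[of i] by (simp add: c_def)
          qed
          finally have *: "(D i x)\<^sup>2 * ?W x \<le> c * ?S x * ?W x" using W by (intro mult_right_mono) auto
          have "0 \<le> (D i x)\<^sup>2 * ?W x" using W by simp
          with * have "\<bar>(D i x)\<^sup>2 * ?W x\<bar> \<le> \<bar>c * ?S x * ?W x\<bar>" by linarith
          then show ?thesis using True by (simp add: mult.assoc)
        qed simp
      qed
    qed
  qed
  have box: "(LINT x:K k|lborel. ?W x) * (LINT x:K k|lborel. (f x)\<^sup>2 * ?W x) - (LINT x:K k|lborel. f x * ?W x)\<^sup>2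
    \<le> (LINT x:K k|lborel. ?W x) * (LINT x:K k|lborel. ?S x * ?W x)" for k
    unfolding K_def
  proof (rule brascamp_lieb_box_weak)
    show "set_integrable lborel (cbox (\<chi> i. 1 / real (k + 1)) (\<chi> i. real k + 1)) (\<lambda>x. (f x)\<^sup>2 * ?W x)"
      using set_integrable_subset[OF f2_int _ LO[of k]] by (simp add: L_def)
    show "set_integrable lborel (cbox (\<chi> i. 1 / real (k + 1)) (\<chi> i. real k + 1)) (\<lambda>x. (D i x)\<^sup>2 * ?W x)" for i
      using D2_int[of k i] by (simp add: L_def)
  qed (use \<alpha> assms(4) g wd in auto)
  have incK: "incseq K"
  proof (intro incseq_SucI)
    fix k
    have "1 / real (Suc k + 1) \<le> 1 / real (k + 1)" by (intro divide_left_mono) auto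
    then show "K k \<subseteq> K (Suc k)"
      unfolding K_def by (intro subset_box_imp) (auto simp: Basis_vec_def inner_axis)
  qed
  have UK: "(\<Union>k. K k) = ?O"
  proof
    have "K k \<subseteq> L k" for k
      unfolding K_def L_def by (intro subset_box_imp) (auto simp: Basis_vec_def inner_axis)
    then show "(\<Union>k. K k) \<subseteq> ?O" using LO by blast
    show "?O \<subseteq> (\<Union>k. K k)"
    proof
      fix x assume x: "x \<in> ?O"
      obtain m where m: "\<And>i. x $ i \<le> real m" "\<And>i. 1 / x $ i \<le> real m"
      proof -
        define B where "B = (\<Sum>i\<in>UNIV. x $ i + 1 / x $ i)"
        obtain m where m: "B \<le> real m" using real_arch_simple by blast
        have pos: "0 < x $ i" for i using x by (simp add: pos_orthant_def)
        have "x $ i + 1 / x $ i \<le> B" for i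
          unfolding B_def using pos by (intro member_le_sum) (auto simp: less_imp_le add_nonneg_nonneg)
        then have "x $ i \<le> real m" "1 / x $ i \<le> real m" for i
          using m pos[of i] by (smt (verit) divide_pos_pos)+
        then show thesis by (rule that)
      qed
      have "1 / real (m + 1) \<le> x $ i" for i
      proof -
        have "0 < x $ i" using x by (simp add: pos_orthant_def)
        then show ?thesis using m(2)[of i] by (simp add: field_simps)
      qed
      then have "x \<in> K m" using m(1) by (simp add: K_def mem_box_cart)
      then show "x \<in> (\<Union>k. K k)" by blast
    qed
  qed
  have lim: "(\<lambda>k. LINT x:K k|lborel. h x) \<longlonglongrightarrow> (LINT x:?O|lborel. h x)"
    if "set_integrable lborel ?O h" for h :: "real^'n \<Rightarrow> real"
    using set_integral_cont_up[OF _ incK, of lborel h] that UK by (simp add: K_def)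
  have "(LINT x:?O|lborel. ?W x) * (LINT x:?O|lborel. (f x)\<^sup>2 * ?W x) - (LINT x:?O|lborel. f x * ?W x)\<^sup>2
    \<le> (LINT x:?O|lborel. ?W x) * (LINT x:?O|lborel. ?S x * ?W x)"
  proof (rule LIMSEQ_le)
    show "(\<lambda>k. (LINT x:K k|lborel. ?W x) * (LINT x:K k|lborel. (f x)\<^sup>2 * ?W x) - (LINT x:K k|lborel. f x * ?W x)\<^sup>2)
      \<longlonglongrightarrow> (LINT x:?O|lborel. ?W x) * (LINT x:?O|lborel. (f x)\<^sup>2 * ?W x) - (LINT x:?O|lborel. f x * ?W x)\<^sup>2"
      by (intro tendsto_intros lim Wint f2_int f_int)
    show "(\<lambda>k. (LINT x:K k|lborel. ?W x) * (LINT x:K k|lborel. ?S x * ?W x))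
      \<longlonglongrightarrow> (LINT x:?O|lborel. ?W x) * (LINT x:?O|lborel. ?S x * ?W x)"
      by (intro tendsto_mult lim Wint S_int)
  qed (use box in blast)
  moreover have "(LINT x:?O|lborel. ?W x) = Z" by (simp add: Z_def liouville_Z_def)
  ultimately have main: "Z * (LINT x:?O|lborel. (f x)\<^sup>2 * ?W x) - (LINT x:?O|lborel. f x * ?W x)\<^sup>2
    \<le> Z * (LINT x:?O|lborel. ?S x * ?W x)" by simp
  have e1: "(\<integral>x. (f x)\<^sup>2 \<partial>?\<mu>) = inverse Z * (LINT x:?O|lborel. (f x)\<^sup>2 * ?W x)"
    unfolding Z_def by (rule liouville_integral(2)[OF norm g]) simp_all
  have e2: "(\<integral>x. f x \<partial>?\<mu>) = inverse Z * (LINT x:?O|lborel. f x * ?W x)"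
    unfolding Z_def by (rule liouville_integral(2)[OF norm g]) simp_all
  have e3: "(\<integral>x. ?S x \<partial>?\<mu>) = inverse Z * (LINT x:?O|lborel. ?S x * ?W x)"
    unfolding Z_def by (rule liouville_integral(2)[OF norm g borel_measurable_integrable[OF assms(9)]]) simp_all
  have "Var ?\<mu> f = inverse Z * inverse Z * (Z * (LINT x:?O|lborel. (f x)\<^sup>2 * ?W x) - (LINT x:?O|lborel. f x * ?W x)\<^sup>2)"
    unfolding Var_def e1 e2 using Z by (simp add: power2_eq_square field_simps)
  also have "\<dots> \<le> inverse Z * inverse Z * (Z * (LINT x:?O|lborel. ?S x * ?W x))"
    using Z by (intro mult_left_mono[OF main]) auto
  also have "\<dots> = (\<integral>x. ?S x \<partial>?\<mu>)" unfolding e3 using Z by simp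
  finally show ?thesis .
qed

end
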